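(* Let $G\le \mathrm{Homeo}_+(S^1)$ be a subgroup with no non-abelian free subgroups. Then either $G$ is abelian, or there are subgroups $H_0$ and $Q$ of $\mathrm{Homeo}_+(S^1)$ and an embedding (injective group homomorphism) $G\hookrightarrow H_0\wr Q$ into the unrestricted wreath product such that the following hold. 1. The group $H_0$ has the following properties: (a) $\mathrm{Rot}$ is trivial over $H_0$, i.e. $\mathrm{Rot}(h)=0$ for every $h\in H_0$; (b) there is an embedding $H_0\hookrightarrow \prod_{\mathfrak N}\mathrm{Homeo}_+(I)$, where $\mathfrak N$ is an index set which is at most countable; (c) $H_0$ has no non-abelian free subgroups. 2. The group $Q\cong G/(\ker(\mathrm{Rot})\cap G)$ is isomorphic to a subgroup of $\mathbb R/\mathbb Z$ which is at most countable. 3. The subgroups $H_0,Q\le\mathrm{Homeo}_+(S^1)$ generate a subgroup $\langle H_0,Q\rangle$ of $\mathrm{Homeo}_+(S^1)$ isomorphic to the restricted wreath product $H_0\wr_r Q$; moreover this subgroup extends to an embedded copy of the unrestricted wreath product that contains $G$, i.e. there is an embedding $H_0\wr Q\hookrightarrow \mathrm{Homeo}_+(S^1)$ which extends an isomorphism $H_0\wr_r Q\to\langle H_0,Q\rangle$ and whose image contains $G$ (so that $G\hookrightarrow H_0\wr Q$ is the corresponding embedding).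
   Context: $S^1=\mathbb R/\mathbb Z$ is the circle and $I=[0,1]$. $\mathrm{Homeo}_+(S^1)$ and $\mathrm{Homeo}_+(I)$ denote the groups of all orientation-preserving homeomorphisms of $S^1$ and of $I$. The rotation number of $f\in\mathrm{Homeo}_+(S^1)$ is $\mathrm{Rot}(f)=\lim_{n\to\infty}F^n(t)/n \pmod 1\in\mathbb R/\mathbb Z$, where $F:\mathbb R\to\mathbb R$ is any lift of $f$ and $t\in\mathbb R$ is any point (the limit exists and is independent of $F$ and $t$ modulo 1). $\ker(\mathrm{Rot})$ denotes the set of elements of $\mathrm{Homeo}_+(S^1)$ with rotation number $0$. It is known that if $G\le\mathrm{Homeo}_+(S^1)$ has no non-abelian free subgroups then $\mathrm{Rot}:G\to\mathbb R/\mathbb Z$ is a group homomorphism, so $\ker(\mathrm{Rot})\cap G$ is then a normal subgroup of $G$. For groups $C,T$, $C\wr T\cong\left(\prod_{t\in T}C\right)\rtimes T$ is the unrestricted standard wreath product and $C\wr_r T\cong\left(\bigoplus_{t\in T}C\right)\rtimes T$ is the restricted standard wreath product, with $T$ permuting the factors by translation of the index. *)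

theory Defs
  imports "HOL-Analysis.Analysis" "HOL-Algebra.Algebra"
begin

section \<open>The circle \<open>\<real> / \<int>\<close>\<close>

definition int_cong :: "real \<Rightarrow> real \<Rightarrow> bool"
  where "int_cong x y \<longleftrightarrow> x - y \<in> \<int>"

quotient_type circle = real / int_cong
  morphisms rep_circle to_circle
proof (rule equivpI)
  show "reflp int_cong"
    by (simp add: reflp_def int_cong_def)
  show "symp int_cong"
    unfolding symp_def int_cong_def by (metis Ints_minus minus_diff_eq)
  show "transp int_cong"
  proof (rule transpI)
    fix x y z assume "int_cong x y" "int_cong y z"
    then have "(x - y) + (y - z) \<in> \<int>" unfolding int_cong_def by (rule Ints_add)
    then show "int_cong x z" by (simp add: int_cong_def)
  qed
qed

instantiation circle :: ab_group_add
begin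

lift_definition zero_circle :: circle is 0 .

lift_definition plus_circle :: "circle \<Rightarrow> circle \<Rightarrow> circle" is "(+)"
proof -
  fix a b c d assume "int_cong a b" "int_cong c d"
  then have "(a - b) + (c - d) \<in> \<int>" unfolding int_cong_def by (rule Ints_add)
  then show "int_cong (a + c) (b + d)" by (simp add: int_cong_def algebra_simps)
qed

lift_definition uminus_circle :: "circle \<Rightarrow> circle" is uminus
  unfolding int_cong_def by (metis Ints_minus minus_diff_eq minus_diff_minus)

lift_definition minus_circle :: "circle \<Rightarrow> circle \<Rightarrow> circle" is "(-)"
proof -
  fix a b c d assume "int_cong a b" "int_cong c d"
  then have "(a - b) - (c - d) \<in> \<int>" unfolding int_cong_def by (rule Ints_diff)
  then show "int_cong (a - c) (b - d)" by (simp add: int_cong_def algebra_simps)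
qed

instance
  by standard (transfer; simp add: int_cong_def)+

end

text \<open>The quotient topology.\<close>

instantiation circle :: topological_space
begin

definition open_circle :: "circle set \<Rightarrow> bool"
  where "open_circle U \<longleftrightarrow> open (to_circle -` U)"

instance
  by standard (auto simp: open_circle_def vimage_Union intro: open_Int)

end

definition circle_group :: "circle monoid"
  where "circle_group = \<lparr>carrier = UNIV, mult = (+), one = 0\<rparr>"


section \<open>Homeomorphism groups and the rotation number\<close>

definition is_lift :: "(circle \<Rightarrow> circle) \<Rightarrow> (real \<Rightarrow> real) \<Rightarrow> bool"
  where "is_lift f F \<longleftrightarrow>
    continuous_on UNIV F \<and> (\<forall>x. to_circle (F x) = f (to_circle x))"

text \<open>A homeomorphism of the circle preserves orientation iff it has an increasing lift.\<close>

definition Homeo_circle :: "(circle \<Rightarrow> circle) monoid"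
  where "Homeo_circle =
    \<lparr>carrier = {f. (\<exists>g. homeomorphism UNIV UNIV f g) \<and> (\<exists>F. is_lift f F \<and> strict_mono F)},
     mult = (\<circ>), one = id\<rparr>"

text \<open>Functions on the unit interval are represented extensionally (\<open>undefined\<close> outside of it).\<close>

definition Homeo_interval :: "(real \<Rightarrow> real) monoid"
  where "Homeo_interval =
    \<lparr>carrier = {f \<in> extensional {0..1}.
       (\<exists>g. homeomorphism {0..1} {0..1} f g) \<and> strict_mono_on {0..1} f},
     mult = compose {0..1}, one = (\<lambda>x\<in>{0..1}. x)\<rparr>"

text \<open>
  On \<open>Homeo_circle\<close> the limit exists and is, modulo 1, independent of the lift and of the starting
  point, so that fixing an arbitrary lift and the starting point 0 is harmless.
\<close>

definition Rot :: "(circle \<Rightarrow> circle) \<Rightarrow> circle"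
  where "Rot f =
    to_circle (lim (\<lambda>n. ((SOME F. is_lift f F) ^^ n) 0 / real n))"

definition ker_Rot :: "(circle \<Rightarrow> circle) set"
  where "ker_Rot = {f \<in> carrier Homeo_circle. Rot f = 0}"

abbreviation Homeo_sub :: "(circle \<Rightarrow> circle) set \<Rightarrow> (circle \<Rightarrow> circle) monoid"
  where "Homeo_sub H \<equiv> Homeo_circle\<lparr>carrier := H\<rparr>"


section \<open>Free subgroups\<close>

text \<open>
  Words over a set of group elements: the letter \<open>(x, True)\<close> stands for \<open>x\<close>, the letter
  \<open>(x, False)\<close> for its inverse.
\<close>

fun eval_word :: "('a, 'b) monoid_scheme \<Rightarrow> ('a \<times> bool) list \<Rightarrow> 'a"
  where
    "eval_word G [] = \<one>\<^bsub>G\<^esub>"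
  | "eval_word G ((x, b) # w) = (if b then x else inv\<^bsub>G\<^esub> x) \<otimes>\<^bsub>G\<^esub> eval_word G w"

definition reduced_word :: "('a \<times> bool) list \<Rightarrow> bool"
  where "reduced_word w \<longleftrightarrow> successively (\<lambda>(x, b) (y, c). \<not> (x = y \<and> b \<noteq> c)) w"

definition free_basis :: "('a, 'b) monoid_scheme \<Rightarrow> 'a set \<Rightarrow> bool"
  where "free_basis G S \<longleftrightarrow>
    S \<subseteq> carrier G \<and> generate G S = carrier G \<and>
    (\<forall>w. w \<noteq> [] \<and> fst ` set w \<subseteq> S \<and> reduced_word w \<longrightarrow> eval_word G w \<noteq> \<one>\<^bsub>G\<^esub>)"

definition free_group :: "('a, 'b) monoid_scheme \<Rightarrow> bool"
  where "free_group G \<longleftrightarrow> group G \<and> (\<exists>S. free_basis G S)"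

definition no_nonabelian_free_subgroups :: "('a, 'b) monoid_scheme \<Rightarrow> bool"
  where "no_nonabelian_free_subgroups G \<longleftrightarrow>
    \<not> (\<exists>F. subgroup F G \<and> free_group (G\<lparr>carrier := F\<rparr>) \<and> \<not> comm_group (G\<lparr>carrier := F\<rparr>))"


section \<open>Wreath products\<close>

definition semidirect ::
    "('n, 'c) monoid_scheme \<Rightarrow> ('t, 'd) monoid_scheme \<Rightarrow> ('t \<Rightarrow> 'n \<Rightarrow> 'n) \<Rightarrow> ('n \<times> 't) monoid"
  where "semidirect N T \<phi> =
    \<lparr>carrier = carrier N \<times> carrier T,
     mult = (\<lambda>(a, s) (b, t). (a \<otimes>\<^bsub>N\<^esub> \<phi> s b, s \<otimes>\<^bsub>T\<^esub> t)),
     one = (\<one>\<^bsub>N\<^esub>, \<one>\<^bsub>T\<^esub>)\<rparr>"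

text \<open>Left action of \<open>T\<close> on families indexed by \<open>T\<close>: the entry at index \<open>t\<close> moves to index \<open>s t\<close>.\<close>

definition translate :: "('t, 'd) monoid_scheme \<Rightarrow> 't \<Rightarrow> ('t \<Rightarrow> 'a) \<Rightarrow> 't \<Rightarrow> 'a"
  where "translate T s f = (\<lambda>t\<in>carrier T. f (inv\<^bsub>T\<^esub> s \<otimes>\<^bsub>T\<^esub> t))"

definition wreath ::
    "('a, 'c) monoid_scheme \<Rightarrow> ('t, 'd) monoid_scheme \<Rightarrow> (('t \<Rightarrow> 'a) \<times> 't) monoid"
  where "wreath C T = semidirect (product_group (carrier T) (\<lambda>_. C)) T (translate T)"

definition restricted_wreath ::
    "('a, 'c) monoid_scheme \<Rightarrow> ('t, 'd) monoid_scheme \<Rightarrow> (('t \<Rightarrow> 'a) \<times> 't) monoid"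
  where "restricted_wreath C T = semidirect (sum_group (carrier T) (\<lambda>_. C)) T (translate T)"

end

theory Submission imports Defs begin

text \<open>
  Suppose some element of \<open>G\<close> other than the identity has a fixed point (otherwise Hoelder's argument
  makes \<open>Rot\<close> an injective homomorphism and \<open>G\<close> is abelian). By ping-pong, two elements of \<open>G\<close> having
  fixed points share one. If a finite family has a nonempty common fixed point set \<open>K\<close> disjoint from
  the fixed point set of \<open>g\<close>, then the stabiliser of \<open>K\<close> contains an element without fixed points on
  the compact set \<open>Fix g\<close>, contradicting the case of two elements. So by compactness the elements
  with fixed points have a common closed fixed point set \<open>Fx\<close>, and Hoelder's argument, applied to
  the action of the lifts on the preimage of \<open>Fx\<close>, shows that \<open>Rot\<close> is a homomorphism on \<open>G\<close> whose
  kernel \<open>ker\<close> consists of these elements. The quotient \<open>T = Rot ` G\<close> acts freely on the components of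
  the complement of \<open>Fx\<close>. Choosing one component in each orbit and a section \<open>r\<close> of \<open>Rot\<close> identifies
  the complement of \<open>Fx\<close> with \<open>T \<times> D\<close>, where \<open>D\<close> is the union of the chosen components. Then \<open>H0\<close> is
  \<open>ker\<close> restricted to \<open>D\<close>, \<open>Q\<close> acts by translation of the first coordinate, and the Kaloujnine--Krasner
  formula puts \<open>G\<close> into the wreath product. A map which on every component agrees with an element of
  a fixed coset of \<open>ker\<close> is a homeomorphism, so everything takes place inside \<open>Homeo_circle\<close>.
\<close>

text \<open>The main obstacle lies in passing from two elements to a finite family. The stabiliser
  of \<open>K\<close> moves each point of the fixed point set of \<open>g\<close>, but a single
  element has to move all of them at once. It is built interval by interval from words
  \<open>b^k a^j b^m\<close>, with exponents of either sign; monotonicity and large exponents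
  exclude fixed points on the intervals treated before, while the image of the left end of the new
  interval is carried past its right end. The second obstacle is that the section \<open>r\<close>
  need not be a homomorphism, so the maps \<open>r q\<close> do not form a group that could serve as
  \<open>Q\<close>. Using \<open>r (q + t) \<circ> finv (r t)\<close> on the components of index
  \<open>t\<close> removes the defect. Such piecewise choices fit together because all elements of
  one coset of \<open>ker\<close> coincide on \<open>Fx\<close>. For the embedding of
  \<open>H0\<close> one interval is enough: \<open>H0\<close> fixes the points of \<open>Fx\<close>,
  and the circle can be cut open at any of them.\<close>

section \<open>Lifts of circle homeomorphisms\<close>

text \<open>With HOL-Algebra loaded, \<open>inv f\<close> parses as the inverse in a group.\<close>

abbreviation finv :: "('a \<Rightarrow> 'b) \<Rightarrow> 'b \<Rightarrow> 'a"
  where "finv f \<equiv> inv_into UNIV f"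

lemma to_circle_eq_iff: "to_circle x = to_circle y \<longleftrightarrow> x - y \<in> \<int>"
  by (simp add: circle.abs_eq_iff int_cong_def)

lemma to_circle_cases: obtains x where "p = to_circle x"
  by (metis Quotient_circle Quotient_abs_rep)

lemma to_circle_plus: "to_circle (x + y) = to_circle x + to_circle y"
  by (simp add: plus_circle.abs_eq)

lemma to_circle_minus: "to_circle (x - y) = to_circle x - to_circle y"
  by (simp add: minus_circle.abs_eq)

lemma to_circle_eq_0_iff: "to_circle x = 0 \<longleftrightarrow> x \<in> \<int>"
  using to_circle_eq_iff[of x 0] by (simp add: zero_circle_def)

lemma to_circle_of_int [simp]: "to_circle (of_int n) = 0"
  by (simp add: to_circle_eq_0_iff)

lemma to_circle_cases_interval:
  obtains x where "p = to_circle x" "x0 \<le> x" "x < x0 + 1"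
proof -
  obtain y where y: "p = to_circle y" by (rule to_circle_cases)
  define x where "x = y - of_int \<lfloor>y - x0\<rfloor>"
  have "p = to_circle x" by (simp add: x_def y to_circle_minus)
  moreover have "x0 \<le> x" "x < x0 + 1" unfolding x_def by linarith+
  ultimately show ?thesis by (rule that)
qed

lemma continuous_to_circle: "continuous_on UNIV to_circle"
  by (simp add: continuous_on_open_vimage open_circle_def)

lemma continuous_on_circleI:
  assumes "continuous_on UNIV (\<lambda>x. f (to_circle x))"
  shows "continuous_on UNIV f"
  using assms by (simp add: continuous_on_open_vimage open_circle_def vimage_def)

lemma continuous_Ints_valued_const:
  fixes d :: "real \<Rightarrow> real"
  assumes "continuous_on UNIV d" "\<And>x. d x \<in> \<int>"
  obtains n :: int where "\<And>x. d x = of_int n"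
proof -
  have "d constant_on UNIV"
  proof (rule continuous_discrete_range_constant[OF connected_UNIV assms(1)])
    fix x :: real
    have "1 \<le> norm (d y - d x)" if "d y \<noteq> d x" for y
    proof -
      have "d y - d x \<in> \<int>" using assms(2) by (rule Ints_diff[OF _ assms(2)])
      then show ?thesis using that by (metis Ints_nonzero_abs_ge1 diff_eq_diff_eq diff_self real_norm_def eq_iff_diff_eq_0)
    qed
    then show "\<exists>e>0. \<forall>y. y \<in> UNIV \<and> d y \<noteq> d x \<longrightarrow> e \<le> norm (d y - d x)"
      by (intro exI[of _ 1]) simp
  qed
  then show ?thesis using assms(2) that unfolding constant_on_def by (metis Ints_cases UNIV_I)
qed

lemma strict_mono_surj_continuous:
  fixes F :: "real \<Rightarrow> real"
  assumes "strict_mono F" "surj F"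
  shows "continuous_on A F"
proof -
  have "continuous_on UNIV F"
    by (rule continuous_onI_mono) (use assms in \<open>auto simp: strict_mono_less_eq\<close>)
  then show ?thesis by (rule continuous_on_subset) simp
qed

lemma strict_mono_bij:
  fixes F :: "real \<Rightarrow> real"
  assumes "strict_mono F" "surj F"
  shows "bij F"
  using assms by (simp add: bij_def strict_mono_on_imp_inj_on)

lemma strict_mono_inv_real:
  fixes F :: "real \<Rightarrow> real"
  assumes "strict_mono F" "surj F"
  shows "strict_mono (finv F)" "surj (finv F)"
  using strict_mono_inv[OF assms] strict_mono_bij[OF assms]
  by (auto simp: bij_is_inj inj_imp_surj_inv)

text \<open>Continuity is replaced by surjectivity, which implies it for increasing maps of the line
  and is stable under composition and inversion. Exhibiting such an \<open>F\<close> is then all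
  that is needed to place \<open>f\<close> in \<open>Homeo_circle\<close>.\<close>

definition circle_lift :: "(circle \<Rightarrow> circle) \<Rightarrow> (real \<Rightarrow> real) \<Rightarrow> bool"
  where "circle_lift f F \<longleftrightarrow> strict_mono F \<and> surj F \<and> (\<forall>x. F (x + 1) = F x + 1) \<and>
    (\<forall>x. to_circle (F x) = f (to_circle x))"

lemma circle_liftD:
  assumes "circle_lift f F"
  shows "strict_mono F" "surj F" "F (x + 1) = F x + 1" "to_circle (F x) = f (to_circle x)"
    "bij F"
  using assms strict_mono_bij by (auto simp: circle_lift_def)

lemma circle_lift_add_int:
  assumes "circle_lift f F"
  shows "F (x + of_int n) = F x + of_int n"
proof -
  have nat: "F (y + real k) = F y + real k" for y k
  proof (induction k)
    case (Suc k)
    have "F (y + real (Suc k)) = F ((y + real k) + 1)" by (simp add: algebra_simps)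
    then show ?case using Suc circle_liftD(3)[OF assms] by simp
  qed simp
  show ?thesis
  proof (cases "n \<ge> 0")
    case True
    then show ?thesis using nat[of x "nat n"] by simp
  next
    case False
    then show ?thesis using nat[of "x + of_int n" "nat (- n)"] by simp
  qed
qed

lemma circle_lift_id: "circle_lift id (\<lambda>x. x)"
  by (auto simp: circle_lift_def strict_mono_def)

lemma circle_lift_compose:
  assumes "circle_lift f F" "circle_lift g G"
  shows "circle_lift (f \<circ> g) (F \<circ> G)"
  using assms comp_surj[of G F] by (auto simp: circle_lift_def strict_mono_def o_def)

lemma circle_lift_inv:
  assumes "circle_lift f F" "bij f"
  shows "circle_lift (finv f) (finv F)"
proof -
  note F = circle_liftD[OF assms(1)]
  have "finv F (x + 1) = finv F x + 1" for x
    by (metis F(3,5) bij_inv_eq_iff)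
  moreover have "to_circle (finv F x) = finv f (to_circle x)" for x
    by (metis F(4,5) assms(2) bij_inv_eq_iff)
  ultimately show ?thesis
    using strict_mono_inv_real[OF F(1,2)] by (simp add: circle_lift_def)
qed

lemma circle_lift_shift:
  assumes "circle_lift f F"
  shows "circle_lift f (\<lambda>x. F x + of_int n)"
proof -
  note F = circle_liftD[OF assms]
  have "surj (\<lambda>x. F x + of_int n)"
  proof
    show "UNIV \<subseteq> range (\<lambda>x. F x + of_int n)"
    proof
      fix y
      obtain x where "F x = y - of_int n" using F(2) by (metis surjD)
      then show "y \<in> range (\<lambda>x. F x + of_int n)" by (intro image_eqI[of _ _ x]) auto
    qed
  qed simp
  with F show ?thesis by (auto simp: circle_lift_def strict_mono_def to_circle_plus)
qed

text \<open>The difference of two lifts is continuous and integer-valued, hence constant.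
  \<open>F'\<close> is an arbitrary continuous lift because \<open>Rot\<close> evaluates one chosen
  by \<open>SOME\<close>, of which only \<open>is_lift\<close> is known.\<close>

lemma is_lift_eq_plus_int:
  assumes "circle_lift f F" "is_lift f F'"
  obtains n :: int where "F' = (\<lambda>x. F x + of_int n)"
proof -
  note F = circle_liftD[OF assms(1)]
  have "continuous_on UNIV (\<lambda>x. F' x - F x)"
    using assms(2) strict_mono_surj_continuous[OF F(1,2)]
    by (simp add: is_lift_def continuous_on_diff)
  moreover have "F' x - F x \<in> \<int>" for x
    using assms(2) F(4) by (simp add: is_lift_def flip: to_circle_eq_iff)
  ultimately obtain n :: int where n: "\<And>x. F' x - F x = of_int n"
    using continuous_Ints_valued_const by metis
  have "F' x = F x + of_int n" for x
    using n[of x] by linarith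
  then show ?thesis using that by blast
qed

lemma circle_lift_imp_is_lift: "circle_lift f F \<Longrightarrow> is_lift f F"
  by (simp add: circle_lift_def is_lift_def strict_mono_surj_continuous)

text \<open>The number \<open>F (x + 1) - F x\<close> is an integer, and positive by monotonicity.
  If it were at least 2, \<open>F\<close> would take the value \<open>F x + 1\<close> strictly
  between \<open>x\<close> and \<open>x + 1\<close>, against the injectivity of
  \<open>f\<close>.\<close>

lemma Homeo_circle_obtain_lift:
  assumes "f \<in> carrier Homeo_circle"
  obtains F where "circle_lift f F"
proof -
  from assms obtain g F where hom: "homeomorphism UNIV UNIV f g"
    and F: "is_lift f F" "strict_mono F"
    by (auto simp: Homeo_circle_def)
  have inj: "inj f" using hom by (metis UNIV_I homeomorphism_def injI)
  have cont: "continuous_on A F" for A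
    using F(1) by (auto simp: is_lift_def intro: continuous_on_subset)
  have lift: "to_circle (F x) = f (to_circle x)" for x using F(1) by (simp add: is_lift_def)
  have F1: "F (x + 1) = F x + 1" for x
  proof -
    have "to_circle (x + 1) = to_circle x" by (simp add: to_circle_eq_iff)
    then have "F (x + 1) - F x \<in> \<int>" by (metis lift to_circle_eq_iff)
    then obtain n :: int where n: "F (x + 1) - F x = of_int n" by (auto elim: Ints_cases)
    have "F x < F (x + 1)" using F(2) by (simp add: strict_mono_less)
    then have "n \<ge> 1" using n by linarith
    moreover have "\<not> n \<ge> 2"
    proof
      assume "n \<ge> 2"
      then have "F x + 1 \<le> F (x + 1)" using n by linarith
      then obtain y where y: "x \<le> y" "y \<le> x + 1" "F y = F x + 1"
        using IVT'[of F x "F x + 1" "x + 1"] cont by auto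
      then have "to_circle (F y) = to_circle (F x)" by (simp add: to_circle_eq_iff)
      then have "y - x \<in> \<int>" using inj lift by (metis injD to_circle_eq_iff)
      moreover have "y \<noteq> x" using y(3) by auto
      moreover have "y \<noteq> x + 1" using y(3) n \<open>n \<ge> 2\<close> by auto
      ultimately obtain z :: int where "y - x = of_int z" "y - x > 0" "y - x < 1"
        using y(1,2) by (auto elim!: Ints_cases)
      then have "0 < z" "z < 1" by simp_all
      then show False by simp
    qed
    ultimately show ?thesis using n by (simp add: algebra_simps)
  qed
  have Fn: "F (x + real k) = F x + real k" for x k
  proof (induction k)
    case (Suc k)
    have "F (x + real (Suc k)) = F ((x + real k) + 1)" by (simp add: algebra_simps)
    then show ?case using Suc F1 by simp
  qed simp
  have "surj F"
  proof (rule surjI)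
    fix y
    obtain k where k: "real k \<ge> \<bar>y - F 0\<bar>" using real_arch_simple by blast
    have "F (- real k) = F 0 - real k" using Fn[of "- real k" k] by simp
    moreover have "F (real k) = F 0 + real k" using Fn[of 0 k] by simp
    ultimately have "F (- real k) \<le> y" "y \<le> F (real k)" using k by linarith+
    then have "\<exists>x. F x = y" using IVT'[of F "- real k" y "real k"] cont by auto
    then show "F (SOME x. F x = y) = y" by (rule someI_ex)
  qed
  then have "circle_lift f F" using F(2) F1 lift by (simp add: circle_lift_def)
  then show ?thesis by (rule that)
qed

lemma circle_lift_bij:
  assumes "circle_lift f F"
  shows "bij f"
proof -
  note F = circle_liftD[OF assms]
  have "inj f"
  proof (rule injI)
    fix p q assume eq: "f p = f q"
    obtain x y where xy: "p = to_circle x" "q = to_circle y" by (metis to_circle_cases)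
    then have "F x - F y \<in> \<int>" using eq F(4) by (metis to_circle_eq_iff)
    then obtain n :: int where "F x = F y + of_int n"
      by (elim Ints_cases) (simp add: diff_eq_eq add.commute)
    then have "F x = F (y + of_int n)" using circle_lift_add_int[OF assms] by simp
    then have "x = y + of_int n" using F(5) by (simp add: bij_def inj_eq)
    then show "p = q" using xy by (simp add: to_circle_plus)
  qed
  moreover have "surj f" using F(2,4) by (metis surj_def to_circle_cases)
  ultimately show ?thesis by (rule bijI)
qed

lemma circle_lift_imp_Homeo:
  assumes "circle_lift f F"
  shows "f \<in> carrier Homeo_circle"
proof -
  have cont: "continuous_on UNIV g" if "circle_lift g H" for g H
  proof (rule continuous_on_circleI)
    note H = circle_liftD[OF that]
    have "continuous_on UNIV (\<lambda>x. to_circle (H x))"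
      by (rule continuous_on_compose2[OF continuous_to_circle])
        (use strict_mono_surj_continuous[OF H(1,2)] in auto)
    then show "continuous_on UNIV (\<lambda>x. g (to_circle x))" by (simp add: H)
  qed
  have bij: "bij f" using assms by (rule circle_lift_bij)
  have "homeomorphism UNIV UNIV f (finv f)"
    using cont[OF assms] cont[OF circle_lift_inv[OF assms bij]] bij
    by (simp add: homeomorphism_def bij_is_inj bij_is_surj surj_f_inv_f bij_imp_bij_inv)
  moreover have "is_lift f F \<and> strict_mono F"
    using assms by (simp add: circle_lift_imp_is_lift circle_liftD)
  ultimately show ?thesis by (auto simp: Homeo_circle_def)
qed

lemma Homeo_circle_iff_lift: "f \<in> carrier Homeo_circle \<longleftrightarrow> (\<exists>F. circle_lift f F)"
  by (metis Homeo_circle_obtain_lift circle_lift_imp_Homeo)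

lemma Homeo_circle_bij: "f \<in> carrier Homeo_circle \<Longrightarrow> bij f"
  using circle_lift_bij unfolding Homeo_circle_iff_lift by blast

lemma Homeo_circle_simps [simp]:
  "mult Homeo_circle = (\<circ>)" "one Homeo_circle = id"
  by (simp_all add: Homeo_circle_def)

lemma Homeo_circle_comp:
  "f \<in> carrier Homeo_circle \<Longrightarrow> g \<in> carrier Homeo_circle \<Longrightarrow> f \<circ> g \<in> carrier Homeo_circle"
  using circle_lift_compose unfolding Homeo_circle_iff_lift by blast

lemma Homeo_circle_inv_closed:
  "f \<in> carrier Homeo_circle \<Longrightarrow> finv f \<in> carrier Homeo_circle"
  using circle_lift_inv circle_lift_bij unfolding Homeo_circle_iff_lift by blast

lemma group_Homeo_circle: "group Homeo_circle"
proof (rule groupI)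
  show "\<one>\<^bsub>Homeo_circle\<^esub> \<in> carrier Homeo_circle"
    using circle_lift_id circle_lift_imp_Homeo by auto
next
  fix f assume "f \<in> carrier Homeo_circle"
  then show "\<exists>g\<in>carrier Homeo_circle. g \<otimes>\<^bsub>Homeo_circle\<^esub> f = \<one>\<^bsub>Homeo_circle\<^esub>"
    using Homeo_circle_inv_closed[of f] Homeo_circle_bij[of f]
    by (intro bexI[of _ "finv f"]) (simp_all add: bij_is_inj)
qed (simp_all add: Homeo_circle_comp comp_assoc)

lemma Homeo_circle_m_inv:
  assumes "f \<in> carrier Homeo_circle"
  shows "inv\<^bsub>Homeo_circle\<^esub> f = finv f"
proof (rule group.inv_equality[OF group_Homeo_circle])
  show "finv f \<otimes>\<^bsub>Homeo_circle\<^esub> f = \<one>\<^bsub>Homeo_circle\<^esub>"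
    using Homeo_circle_bij[OF assms] by (simp add: bij_is_inj)
qed (simp_all add: assms Homeo_circle_inv_closed)

lemma circle_lift_unique:
  assumes "circle_lift f F" "circle_lift f F'" "F x = F' x"
  shows "F = F'"
proof -
  obtain n :: int where n: "F' = (\<lambda>x. F x + of_int n)"
    using is_lift_eq_plus_int[OF assms(1) circle_lift_imp_is_lift[OF assms(2)]] by blast
  have "n = 0" using assms(3) unfolding n by simp
  then show ?thesis unfolding n by simp
qed

text \<open>A lift with fixed point \<open>x\<close> maps each period starting at some
  \<open>x + k\<close> to itself, so a point that it moves by an integer is not moved at all. One
  such lift therefore sees all fixed points of \<open>f\<close>.\<close>

lemma circle_lift_fixed_iff:
  assumes "circle_lift f F" "F x = x"
  shows "F y = y \<longleftrightarrow> f (to_circle y) = to_circle y"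
proof
  assume "F y = y"
  then show "f (to_circle y) = to_circle y" using circle_liftD(4)[OF assms(1), of y] by simp
next
  note F = circle_liftD[OF assms(1)]
  assume "f (to_circle y) = to_circle y"
  then have "F y - y \<in> \<int>" using F(4)[of y] by (simp flip: to_circle_eq_iff)
  then obtain n :: int where n: "F y = y + of_int n"
    by (elim Ints_cases) (simp add: diff_eq_eq add.commute)
  define k where "k = \<lfloor>y - x\<rfloor>"
  have k: "x + of_int k \<le> y" "y < x + of_int k + 1" unfolding k_def by linarith+
  have "F (x + of_int k) = x + of_int k" "F (x + of_int k + 1) = x + of_int k + 1"
    using circle_lift_add_int[OF assms(1)] assms(2) F(3) by simp_all
  then have "x + of_int k \<le> F y" "F y < x + of_int k + 1"
    using k strict_mono_less_eq[OF F(1), of "x + of_int k" y]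
      strict_mono_less[OF F(1), of y "x + of_int k + 1"] by simp_all
  then have "n = 0" using n k by linarith
  then show "F y = y" using n by simp
qed

lemma obtain_fixing_lift:
  assumes "f \<in> carrier Homeo_circle" "f (to_circle x) = to_circle x"
  obtains F where "circle_lift f F" "F x = x"
proof -
  obtain F where F: "circle_lift f F" using assms(1) by (rule Homeo_circle_obtain_lift)
  then have "F x - x \<in> \<int>"
    using assms(2) circle_liftD(4)[OF F, of x] by (simp flip: to_circle_eq_iff)
  then obtain n :: int where n: "F x = x + of_int n"
    by (elim Ints_cases) (simp add: diff_eq_eq add.commute)
  show ?thesis
    by (rule that[OF circle_lift_shift[OF F, of "- n"]]) (simp add: n)
qed


section \<open>Increasing homeomorphisms of the line\<close>

lemma strict_mono_funpow:
  fixes F :: "real \<Rightarrow> real"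
  assumes "strict_mono F" "surj F"
  shows "strict_mono (F ^^ k)" "surj (F ^^ k)"
proof -
  have "strict_mono (F ^^ k) \<and> surj (F ^^ k)"
  proof (induction k)
    case (Suc k)
    then show ?case using assms comp_surj[of "F ^^ k" F] by (simp add: strict_mono_def)
  qed (simp add: strict_mono_def)
  then show "strict_mono (F ^^ k)" "surj (F ^^ k)" by auto
qed

lemma funpow_fixed: "F x = x \<Longrightarrow> (F ^^ k) x = x"
  by (induction k) auto

lemma funpow_finv_cancel:
  fixes F :: "'a \<Rightarrow> 'a"
  assumes "bij F"
  shows "(F ^^ k) y = x \<longleftrightarrow> y = (finv F ^^ k) x"
proof (induction k arbitrary: x)
  case (Suc k)
  have "(F ^^ Suc k) y = x \<longleftrightarrow> (F ^^ k) y = finv F x"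
    using assms by (metis bij_inv_eq_iff comp_apply funpow.simps(2))
  then show ?case using Suc by (simp add: funpow_swap1)
qed auto

text \<open>The fixed point \<open>x1\<close> bounds the increasing orbit, and the limit is fixed by
  continuity. It is the first fixed point above \<open>c\<close>, since every other one bounds the
  orbit as well.\<close>

lemma orbit_converges_up:
  fixes F :: "real \<Rightarrow> real"
  assumes F: "strict_mono F" "surj F" and x1: "F x1 = x1" "c \<le> x1" and c: "c < F c"
  obtains v where "F v = v" "c < v" "(\<lambda>k. (F ^^ k) c) \<longlonglongrightarrow> v" "\<And>k. (F ^^ k) c < v"
proof -
  let ?s = "\<lambda>k. (F ^^ k) c"
  have step: "?s k < ?s (Suc k)" for k
    using strict_mono_less[OF strict_mono_funpow(1)[OF F, of k], of c "F c"] c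
    by (simp add: funpow_swap1)
  have smono: "strict_mono ?s" using step by (simp add: strict_mono_Suc_iff)
  have "?s k \<le> x1" for k
    using strict_mono_less_eq[OF strict_mono_funpow(1)[OF F, of k], of c x1] x1
      funpow_fixed[of F x1 k] by simp
  then obtain v where v: "?s \<longlonglongrightarrow> v" "\<forall>k. ?s k \<le> v"
    using incseq_convergent[of ?s x1] strict_mono_mono[OF smono] by (auto simp: incseq_def mono_def)
  have "isCont F v"
    using strict_mono_surj_continuous[OF F, of UNIV] by (simp add: continuous_on_eq_continuous_at)
  then have "(\<lambda>k. F (?s k)) \<longlonglongrightarrow> F v" using v(1) by (rule isCont_tendsto_compose)
  then have "(\<lambda>k. ?s (Suc k)) \<longlonglongrightarrow> F v" by simp
  then have "F v = v" using LIMSEQ_Suc[OF v(1)] LIMSEQ_unique by blast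
  moreover have "?s k < v" for k using step[of k] v(2) by (meson less_le_trans)
  moreover from this[of 0] have "c < v" by simp
  ultimately show ?thesis using that v(1) by blast
qed

lemma orbit_converges_down:
  fixes F :: "real \<Rightarrow> real"
  assumes F: "strict_mono F" "surj F" and x0: "F x0 = x0" "x0 \<le> c" and c: "F c < c"
  obtains v where "F v = v" "v < c" "(\<lambda>k. (F ^^ k) c) \<longlonglongrightarrow> v" "\<And>k. v < (F ^^ k) c"
proof -
  \<comment> \<open>Conjugation by the reflection at 0 turns the downward orbit into an upward
    one.\<close>
  define H where "H = (\<lambda>x. - F (- x))"
  have H: "strict_mono H" "surj H"
  proof -
    show "strict_mono H" using F(1) by (auto simp: H_def strict_mono_def)
    show "surj H"
    proof (rule surjI)
      fix y show "H (- finv F (- y)) = y" using F(2) by (simp add: H_def surj_f_inv_f)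
    qed
  qed
  have Hk: "(H ^^ k) (- x) = - (F ^^ k) x" for k x
    by (induction k) (auto simp: H_def)
  obtain w where w: "H w = w" "- c < w" "(\<lambda>k. (H ^^ k) (- c)) \<longlonglongrightarrow> w" "\<And>k. (H ^^ k) (- c) < w"
    by (rule orbit_converges_up[OF H, of "- x0" "- c"]) (use x0 c in \<open>auto simp: H_def\<close>)
  show ?thesis
  proof
    show "F (- w) = - w" using w(1) by (simp add: H_def)
    show "- w < c" using w(2) by simp
    show "(\<lambda>k. (F ^^ k) c) \<longlonglongrightarrow> - w" using tendsto_minus[OF w(3)] by (simp add: Hk)
    show "- w < (F ^^ k) c" for k using w(4)[of k] by (simp add: Hk)
  qed
qed

lemma no_fixed_point_cases:
  fixes F :: "real \<Rightarrow> real"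
  assumes "strict_mono F" "surj F" "\<forall>x\<in>{c..d}. F x \<noteq> x"
  shows "(\<forall>x\<in>{c..d}. x < F x) \<or> (\<forall>x\<in>{c..d}. F x < x)"
proof (rule ccontr)
  assume "\<not> ?thesis"
  then obtain x y where xy: "x \<in> {c..d}" "y \<in> {c..d}" "F x \<le> x" "y \<le> F y" by force
  have cont: "continuous_on A (\<lambda>z. F z - z)" for A
    using strict_mono_surj_continuous[OF assms(1,2)] by (intro continuous_intros)
  have "\<exists>z. min x y \<le> z \<and> z \<le> max x y \<and> F z - z = 0"
  proof (cases "x \<le> y")
    case True
    then show ?thesis using IVT'[of "\<lambda>z. F z - z" x 0 y] xy cont by auto
  next
    case False
    then show ?thesis using IVT2'[of "\<lambda>z. F z - z" x 0 y] xy cont by auto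
  qed
  then obtain z where z: "min x y \<le> z" "z \<le> max x y" "F z = z" by auto
  have "z \<in> {c..d}" using z(1,2) xy(1,2) by (auto simp: min_def max_def split: if_splits)
  then show False using z(3) assms(3) by auto
qed

text \<open>All of \<open>{c..d}\<close> lies between two consecutive fixed points and is pushed to
  one of them, \<open>v\<close>. The interval \<open>{c'..d'}\<close> misses \<open>v\<close>, so it
  lies beyond \<open>v\<close>, where the orbit never arrives, or before it, where the orbit
  eventually passes.\<close>

lemma eventually_interval_disjoint:
  fixes F :: "real \<Rightarrow> real"
  assumes F: "strict_mono F" "surj F" "F x0 = x0" "F x1 = x1"
    and cd: "{c..d} \<subseteq> {x0..x1}" "\<forall>x\<in>{c..d}. F x \<noteq> x" "\<forall>x\<in>{c'..d'}. F x \<noteq> x"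
  shows "\<forall>\<^sub>F k in sequentially. (F ^^ k) ` {c..d} \<inter> {c'..d'} = {}"
proof (cases "c \<le> d \<and> c' \<le> d'")
  case False
  then show ?thesis by auto
next
  case True
  then have x01: "x0 \<le> c" "d \<le> x1" using cd(1) by auto
  note mono = strict_mono_less_eq[OF strict_mono_funpow(1)[OF F(1,2)]]
  from no_fixed_point_cases[OF F(1,2) cd(2)] show ?thesis
  proof
    assume up: "\<forall>x\<in>{c..d}. x < F x"
    obtain v where v: "F v = v" "c < v" "(\<lambda>k. (F ^^ k) c) \<longlonglongrightarrow> v"
      by (rule orbit_converges_up[OF F(1,2,4), of c]) (use True x01 up in auto)
    then have "d < v" using cd(2) True by force
    from v(1) cd(3) consider "v < c'" | "d' < v" by force
    then show ?thesis
    proof cases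
      case 1
      have "(F ^^ k) x < c'" if "x \<in> {c..d}" for k x
        using mono[of k x v] that \<open>d < v\<close> funpow_fixed[of F v k, OF v(1)] 1 by auto
      then have "(F ^^ k) ` {c..d} \<inter> {c'..d'} = {}" for k unfolding disjoint_iff by (metis atLeastAtMost_iff imageE leD)
      then show ?thesis by simp
    next
      case 2
      then have "\<forall>\<^sub>F k in sequentially. d' < (F ^^ k) c" using v(3) by (auto dest: order_tendstoD)
      then show ?thesis
      proof eventually_elim
        case (elim k)
        have "d' < (F ^^ k) x" if "x \<in> {c..d}" for x using mono[of k c x] that elim by auto
        then show ?case unfolding disjoint_iff by (metis atLeastAtMost_iff imageE leD)
      qed
    qed
  next
    assume down: "\<forall>x\<in>{c..d}. F x < x"
    obtain v where v: "F v = v" "v < d" "(\<lambda>k. (F ^^ k) d) \<longlonglongrightarrow> v"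
      by (rule orbit_converges_down[OF F(1,2,3), of d]) (use True x01 down in auto)
    then have "v < c" using cd(2) True by force
    from v(1) cd(3) consider "d' < v" | "v < c'" by force
    then show ?thesis
    proof cases
      case 1
      have "d' < (F ^^ k) x" if "x \<in> {c..d}" for k x
        using mono[of k v x] that \<open>v < c\<close> funpow_fixed[of F v k, OF v(1)] 1 by auto
      then have "(F ^^ k) ` {c..d} \<inter> {c'..d'} = {}" for k unfolding disjoint_iff by (metis atLeastAtMost_iff imageE leD)
      then show ?thesis by simp
    next
      case 2
      then have "\<forall>\<^sub>F k in sequentially. (F ^^ k) d < c'" using v(3) by (auto dest: order_tendstoD)
      then show ?thesis
      proof eventually_elim
        case (elim k)
        have "(F ^^ k) x < c'" if "x \<in> {c..d}" for x using mono[of k x d] that elim by auto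
        then show ?case unfolding disjoint_iff by (metis atLeastAtMost_iff imageE leD)
      qed
    qed
  qed
qed

lemma compact_interval_cover:
  fixes C :: "real set"
  assumes "compact C" "C \<subseteq> {x0..x1}" "open U" "C \<subseteq> U"
  obtains P where "finite P" "C \<subseteq> (\<Union>(c, d)\<in>P. {c..d})"
    "\<And>c d. (c, d) \<in> P \<Longrightarrow> {c..d} \<subseteq> {x0..x1} \<inter> U"
proof -
  have "\<exists>e>0. cball y e \<subseteq> U" if "y \<in> C" for y
    using assms(3,4) that by (meson open_contains_cball subsetD)
  then obtain e where e: "\<And>y. y \<in> C \<Longrightarrow> e y > 0 \<and> cball y (e y) \<subseteq> U" by metis
  obtain D where D: "D \<subseteq> C" "finite D" "C \<subseteq> (\<Union>y\<in>D. ball y (e y))"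
    by (rule compactE_image[OF assms(1), of C "\<lambda>y. ball y (e y)"]) (use e in force)+
  show ?thesis
  proof (rule that[of "(\<lambda>y. (max x0 (y - e y), min x1 (y + e y))) ` D"])
    show "C \<subseteq> (\<Union>(c, d)\<in>(\<lambda>y. (max x0 (y - e y), min x1 (y + e y))) ` D. {c..d})"
    proof
      fix x assume "x \<in> C"
      then obtain y where y: "y \<in> D" "x \<in> ball y (e y)" using D by auto
      moreover have "x \<in> {x0..x1}" using \<open>x \<in> C\<close> assms(2) by auto
      ultimately show "x \<in> (\<Union>(c, d)\<in>(\<lambda>y. (max x0 (y - e y), min x1 (y + e y))) ` D. {c..d})"
        by (force simp: dist_real_def)
    qed
    fix c d assume "(c, d) \<in> (\<lambda>y. (max x0 (y - e y), min x1 (y + e y))) ` D"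
    then obtain y where y: "y \<in> D" "c = max x0 (y - e y)" "d = min x1 (y + e y)" by auto
    then have "{c..d} \<subseteq> cball y (e y)" by (auto simp: dist_real_def)
    then show "{c..d} \<subseteq> {x0..x1} \<inter> U" using e[of y] y D(1) by fastforce
  qed (use D in auto)
qed

lemma open_not_fixed:
  fixes F :: "real \<Rightarrow> real"
  assumes "strict_mono F" "surj F"
  shows "open {x. F x \<noteq> x}"
  by (rule open_Collect_neq)
    (use strict_mono_surj_continuous[OF assms] in \<open>auto intro: continuous_intros\<close>)

text \<open>A finite cover reduces the claim to pairs of intervals. Ping-pong needs it for all large
  \<open>k\<close>, because a power of \<open>F\<close> is used all of whose positive powers must
  displace \<open>C\<close>.\<close>

lemma eventually_image_disjoint:
  fixes F :: "real \<Rightarrow> real"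
  assumes F: "strict_mono F" "surj F" "F x0 = x0" "F x1 = x1"
    and C: "compact C" "C \<subseteq> {x0..x1}" "\<forall>x\<in>C. F x \<noteq> x"
  shows "\<forall>\<^sub>F k in sequentially. (F ^^ k) ` C \<inter> C = {}"
proof -
  obtain P where P: "finite P" "C \<subseteq> (\<Union>(c, d)\<in>P. {c..d})"
    "\<And>c d. (c, d) \<in> P \<Longrightarrow> {c..d} \<subseteq> {x0..x1} \<inter> {x. F x \<noteq> x}"
    using compact_interval_cover[OF C(1,2) open_not_fixed[OF F(1,2)]] C(3) by blast
  have "\<forall>\<^sub>F k in sequentially. \<forall>p\<in>P. \<forall>q\<in>P. (F ^^ k) ` {fst p..snd p} \<inter> {fst q..snd q} = {}"
  proof (intro eventually_ball_finite P(1) ballI)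
    fix p q assume "p \<in> P" "q \<in> P"
    then show "\<forall>\<^sub>F k in sequentially. (F ^^ k) ` {fst p..snd p} \<inter> {fst q..snd q} = {}"
      using P(3)[of "fst p" "snd p"] P(3)[of "fst q" "snd q"]
      by (intro eventually_interval_disjoint[OF F]) auto
  qed
  then show ?thesis
  proof eventually_elim
    case (elim k)
    show ?case
    proof (rule ccontr)
      assume "\<not> ?case"
      then obtain x where x: "x \<in> C" "(F ^^ k) x \<in> C" by auto
      then obtain p q where "p \<in> P" "x \<in> {fst p..snd p}" "q \<in> P" "(F ^^ k) x \<in> {fst q..snd q}"
        using P(2) by (smt (verit, best) UN_E case_prod_beta subsetD)
      then show False using elim by blast
    qed
  qed
qed


text \<open>Equivalently, \<open>B^(-k) a B^m\<close> has no fixed point on the interval. Suppose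
  that \<open>B\<close> pushes the interval up to \<open>v\<close>. If \<open>a v \<le> v\<close>,
  then \<open>a (B^m x)\<close> stays below \<open>v\<close> and is passed by \<open>B^k x\<close>
  for large \<open>k\<close>. If \<open>a v > v\<close>, then \<open>a (B^m x)\<close> is above
  \<open>v\<close> for large \<open>m\<close>, and \<open>B^k x\<close> never is. The bound on
  \<open>k\<close> depends on \<open>m\<close>, hence the nested quantifiers.\<close>

lemma eventually_conjugate_no_coincidence:
  fixes a B :: "real \<Rightarrow> real"
  assumes B: "strict_mono B" "surj B" "B x0 = x0" "B x1 = x1"
    and a: "strict_mono a" "surj a"
    and cd: "{c..d} \<subseteq> {x0..x1}" "\<forall>x\<in>{c..d}. B x \<noteq> x"
  shows "\<forall>\<^sub>F m in sequentially. \<forall>\<^sub>F k in sequentially. \<forall>x\<in>{c..d}. a ((B ^^ m) x) \<noteq> (B ^^ k) x"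
proof (cases "c \<le> d")
  case False
  then show ?thesis by auto
next
  case True
  then have x01: "x0 \<le> c" "d \<le> x1" using cd(1) by auto
  note mono = strict_mono_less_eq[OF strict_mono_funpow(1)[OF B(1,2)]]
  note amono = strict_mono_less_eq[OF a(1)]
  note asmono = strict_mono_less[OF a(1)]
  have abij: "a (finv a y) = y" for y using a(2) by (simp add: surj_f_inv_f)
  from no_fixed_point_cases[OF B(1,2) cd(2)] show ?thesis
  proof
    assume up: "\<forall>x\<in>{c..d}. x < B x"
    obtain v where v: "B v = v" "c < v" "(\<lambda>k. (B ^^ k) c) \<longlonglongrightarrow> v"
      by (rule orbit_converges_up[OF B(1,2,4), of c]) (use True x01 up in auto)
    then have "d < v" using cd(2) True by force
    have lt: "(B ^^ k) x < v" if "x \<in> {c..d}" for k x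
      using strict_mono_less[OF strict_mono_funpow(1)[OF B(1,2)], of k x v] that \<open>d < v\<close>
        funpow_fixed[of B v k, OF v(1)] by auto
    show ?thesis
    proof (cases "a v \<le> v")
      case True
      have "\<forall>\<^sub>F k in sequentially. \<forall>x\<in>{c..d}. a ((B ^^ m) x) \<noteq> (B ^^ k) x" for m
      proof -
        have "a ((B ^^ m) d) < v" using lt[of d m] asmono[of "(B ^^ m) d" v] True \<open>c \<le> d\<close> by auto
        with v(3) have "\<forall>\<^sub>F k in sequentially. a ((B ^^ m) d) < (B ^^ k) c" by (auto dest: order_tendstoD)
        then show ?thesis
        proof eventually_elim
          case (elim k)
          have "a ((B ^^ m) x) < (B ^^ k) x" if "x \<in> {c..d}" for x
            using that elim mono[of k c x] mono[of m x d] amono[of "(B ^^ m) x" "(B ^^ m) d"] by auto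
          then show ?case by (metis less_irrefl)
        qed
      qed
      then show ?thesis by simp
    next
      case False
      then have "finv a v < v" using asmono[of "finv a v" v] abij by simp
      with v(3) have "\<forall>\<^sub>F m in sequentially. finv a v < (B ^^ m) c" by (auto dest: order_tendstoD)
      then show ?thesis
      proof eventually_elim
        case (elim m)
        have "(B ^^ k) x < a ((B ^^ m) x)" if "x \<in> {c..d}" for k x
          using that elim mono[of m c x] asmono[of "finv a v" "(B ^^ m) x"] abij[of v] lt[OF that, of k] by auto
        then show ?case by (intro always_eventually allI ballI) (metis less_irrefl)
      qed
    qed
  next
    assume down: "\<forall>x\<in>{c..d}. B x < x"
    obtain u where u: "B u = u" "u < d" "(\<lambda>k. (B ^^ k) d) \<longlonglongrightarrow> u"
      by (rule orbit_converges_down[OF B(1,2,3), of d]) (use True x01 down in auto)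
    then have "u < c" using cd(2) True by force
    have gt: "u < (B ^^ k) x" if "x \<in> {c..d}" for k x
      using strict_mono_less[OF strict_mono_funpow(1)[OF B(1,2)], of k u x] that \<open>u < c\<close>
        funpow_fixed[of B u k, OF u(1)] by auto
    show ?thesis
    proof (cases "u \<le> a u")
      case True
      have "\<forall>\<^sub>F k in sequentially. \<forall>x\<in>{c..d}. a ((B ^^ m) x) \<noteq> (B ^^ k) x" for m
      proof -
        have "u < a ((B ^^ m) c)" using gt[of c m] asmono[of u "(B ^^ m) c"] True \<open>c \<le> d\<close> by auto
        with u(3) have "\<forall>\<^sub>F k in sequentially. (B ^^ k) d < a ((B ^^ m) c)" by (auto dest: order_tendstoD)
        then show ?thesis
        proof eventually_elim
          case (elim k)
          have "(B ^^ k) x < a ((B ^^ m) x)" if "x \<in> {c..d}" for x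
            using that elim mono[of k x d] mono[of m c x] amono[of "(B ^^ m) c" "(B ^^ m) x"] by auto
          then show ?case by (metis less_irrefl)
        qed
      qed
      then show ?thesis by simp
    next
      case False
      then have "u < finv a u" using asmono[of u "finv a u"] abij by simp
      with u(3) have "\<forall>\<^sub>F m in sequentially. (B ^^ m) d < finv a u" by (auto dest: order_tendstoD)
      then show ?thesis
      proof eventually_elim
        case (elim m)
        have "a ((B ^^ m) x) < (B ^^ k) x" if "x \<in> {c..d}" for k x
          using that elim mono[of m x d] asmono[of "(B ^^ m) x" "finv a u"] abij[of u] gt[OF that, of k] by auto
        then show ?case by (intro always_eventually allI ballI) (metis less_irrefl)
      qed
    qed
  qed
qed

text \<open>
  Here \<open>u\<close> and \<open>v\<close> are the end points of the component of \<open>{x. B x \<noteq> x}\<close> containing the interval: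
  \<open>B ^^ k\<close> pushes the interval to \<open>u\<close>, and \<open>finv B ^^ m\<close> pushes it to \<open>v\<close>.
\<close>

lemma eventually_inverse_conjugate_no_coincidence:
  fixes B :: "real \<Rightarrow> real"
  assumes B: "strict_mono B" "surj B" "B x0 = x0" "B x1 = x1"
    and cd: "{c..d} \<subseteq> {x0..x1}" "\<forall>x\<in>{c..d}. B x \<noteq> x"
  obtains u v where "u \<noteq> v" "\<And>a. strict_mono a \<Longrightarrow> surj a \<Longrightarrow> a v \<noteq> u \<Longrightarrow>
    \<forall>\<^sub>F m in sequentially. \<forall>\<^sub>F k in sequentially. \<forall>x\<in>{c..d}. a ((finv B ^^ m) x) \<noteq> (B ^^ k) x"
proof (cases "c \<le> d")
  case False
  \<comment> \<open>For an empty interval any two distinct numbers do.\<close>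
  then show ?thesis using that[of 0 1] by auto
next
  case True
  then have x01: "x0 \<le> c" "d \<le> x1" using cd(1) by auto
  note bijB = strict_mono_bij[OF B(1,2)]
  define D where "D = finv B"
  have D: "strict_mono D" "surj D" "D x0 = x0" "D x1 = x1"
    using strict_mono_inv_real[OF B(1,2)] bij_inv_eq_iff[OF bijB, of x0 x0]
      bij_inv_eq_iff[OF bijB, of x1 x1] B(3,4) unfolding D_def by metis+
  have D_fixed: "D x = x \<longleftrightarrow> B x = x" for x using bij_inv_eq_iff[OF bijB, of x x] unfolding D_def by metis
  have D_less: "D x < x \<longleftrightarrow> x < B x" "x < D x \<longleftrightarrow> B x < x" for x
    using strict_mono_less[OF B(1), of "D x" x] strict_mono_less[OF B(1), of x "D x"] B(2)
    by (auto simp: D_def surj_f_inv_f)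
  note monoB = strict_mono_less_eq[OF strict_mono_funpow(1)[OF B(1,2)]]
  note monoD = strict_mono_less_eq[OF strict_mono_funpow(1)[OF D(1,2)]]
  note smonoB = strict_mono_less[OF strict_mono_funpow(1)[OF B(1,2)]]
  note smonoD = strict_mono_less[OF strict_mono_funpow(1)[OF D(1,2)]]
  from no_fixed_point_cases[OF B(1,2) cd(2)] show ?thesis
  proof
    assume up: "\<forall>x\<in>{c..d}. x < B x"
    obtain v where v: "B v = v" "c < v" "(\<lambda>k. (B ^^ k) c) \<longlonglongrightarrow> v"
      by (rule orbit_converges_up[OF B(1,2,4), of c]) (use True x01 up in auto)
    obtain u where u: "D u = u" "u < d" "(\<lambda>k. (D ^^ k) d) \<longlonglongrightarrow> u"
      by (rule orbit_converges_down[OF D(1,2,3), of d]) (use True x01 up D_less in auto)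
    have "d < v" using v cd(2) True by force
    have "u < c" using u cd(2) True D_fixed by force
    have lt: "(B ^^ k) x < v" if "x \<in> {c..d}" for k x
      using smonoB[of k x v] that \<open>d < v\<close> funpow_fixed[of B v k, OF v(1)] by auto
    have gt: "u < (D ^^ k) x" if "x \<in> {c..d}" for k x
      using smonoD[of k u x] that \<open>u < c\<close> funpow_fixed[of D u k, OF u(1)] by auto
    show ?thesis
    \<comment> \<open>The two ends are swapped: in this case \<open>B\<close> pushes up to
      \<open>v\<close> and its inverse pushes down to \<open>u\<close>, so the position to be
      excluded is \<open>a u = v\<close>.\<close>
    proof (rule that[of v u])
      show "v \<noteq> u" using \<open>d < v\<close> \<open>u < d\<close> by simp
      fix a :: "real \<Rightarrow> real" assume a: "strict_mono a" "surj a" "a u \<noteq> v"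
      have abij: "a (finv a y) = y" for y using a(2) by (simp add: surj_f_inv_f)
      note amono = strict_mono_less_eq[OF a(1)]
      note asmono = strict_mono_less[OF a(1)]
      show "\<forall>\<^sub>F m in sequentially. \<forall>\<^sub>F k in sequentially. \<forall>x\<in>{c..d}. a ((finv B ^^ m) x) \<noteq> (B ^^ k) x"
        unfolding D_def[symmetric]
      proof (cases "a u < v")
        case True
        then have "u < finv a v" using asmono[of u "finv a v"] abij by simp
        with u(3) have "\<forall>\<^sub>F m in sequentially. (D ^^ m) d < finv a v" by (auto dest: order_tendstoD)
        then show "\<forall>\<^sub>F m in sequentially. \<forall>\<^sub>F k in sequentially. \<forall>x\<in>{c..d}. a ((D ^^ m) x) \<noteq> (B ^^ k) x"
        proof eventually_elim
          case (elim m)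
          then have "a ((D ^^ m) d) < v" using asmono[of "(D ^^ m) d" "finv a v"] abij by simp
          with v(3) have "\<forall>\<^sub>F k in sequentially. a ((D ^^ m) d) < (B ^^ k) c" by (auto dest: order_tendstoD)
          then show ?case
          proof eventually_elim
            case (elim k)
            have "a ((D ^^ m) x) < (B ^^ k) x" if "x \<in> {c..d}" for x
              using that elim monoB[of k c x] monoD[of m x d] amono[of "(D ^^ m) x" "(D ^^ m) d"] by auto
            then show ?case by (metis less_irrefl)
          qed
        qed
      next
        case False
        then have "v < a u" using a(3) by simp
        then have "(B ^^ k) x < a ((D ^^ m) x)" if "x \<in> {c..d}" for k m x
          using lt[OF that, of k] gt[OF that, of m] asmono[of u "(D ^^ m) x"] by linarith
        then show "\<forall>\<^sub>F m in sequentially. \<forall>\<^sub>F k in sequentially. \<forall>x\<in>{c..d}. a ((D ^^ m) x) \<noteq> (B ^^ k) x"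
          by (intro always_eventually allI ballI) (metis less_irrefl)
      qed
    qed
  next
    assume down: "\<forall>x\<in>{c..d}. B x < x"
    obtain u where u: "B u = u" "u < d" "(\<lambda>k. (B ^^ k) d) \<longlonglongrightarrow> u"
      by (rule orbit_converges_down[OF B(1,2,3), of d]) (use True x01 down in auto)
    obtain v where v: "D v = v" "c < v" "(\<lambda>k. (D ^^ k) c) \<longlonglongrightarrow> v"
      by (rule orbit_converges_up[OF D(1,2,4), of c]) (use True x01 down D_less in auto)
    have "d < v" using v cd(2) True D_fixed by force
    have "u < c" using u cd(2) True by force
    have lt: "(D ^^ k) x < v" if "x \<in> {c..d}" for k x
      using smonoD[of k x v] that \<open>d < v\<close> funpow_fixed[of D v k, OF v(1)] by auto
    have gt: "u < (B ^^ k) x" if "x \<in> {c..d}" for k x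
      using smonoB[of k u x] that \<open>u < c\<close> funpow_fixed[of B u k, OF u(1)] by auto
    show ?thesis
    proof (rule that[of u v])
      show "u \<noteq> v" using \<open>d < v\<close> \<open>u < d\<close> by simp
      fix a :: "real \<Rightarrow> real" assume a: "strict_mono a" "surj a" "a v \<noteq> u"
      have abij: "a (finv a y) = y" for y using a(2) by (simp add: surj_f_inv_f)
      note amono = strict_mono_less_eq[OF a(1)]
      note asmono = strict_mono_less[OF a(1)]
      show "\<forall>\<^sub>F m in sequentially. \<forall>\<^sub>F k in sequentially. \<forall>x\<in>{c..d}. a ((finv B ^^ m) x) \<noteq> (B ^^ k) x"
        unfolding D_def[symmetric]
      proof (cases "u < a v")
        case True
        then have "finv a u < v" using asmono[of "finv a u" v] abij by simp
        with v(3) have "\<forall>\<^sub>F m in sequentially. finv a u < (D ^^ m) c" by (auto dest: order_tendstoD)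
        then show "\<forall>\<^sub>F m in sequentially. \<forall>\<^sub>F k in sequentially. \<forall>x\<in>{c..d}. a ((D ^^ m) x) \<noteq> (B ^^ k) x"
        proof eventually_elim
          case (elim m)
          then have "u < a ((D ^^ m) c)" using asmono[of "finv a u" "(D ^^ m) c"] abij by simp
          with u(3) have "\<forall>\<^sub>F k in sequentially. (B ^^ k) d < a ((D ^^ m) c)" by (auto dest: order_tendstoD)
          then show ?case
          proof eventually_elim
            case (elim k)
            have "(B ^^ k) x < a ((D ^^ m) x)" if "x \<in> {c..d}" for x
              using that elim monoB[of k x d] monoD[of m c x] amono[of "(D ^^ m) c" "(D ^^ m) x"] by auto
            then show ?case by (metis less_irrefl)
          qed
        qed
      next
        case False
        then have "a v < u" using a(3) by simp
        then have "a ((D ^^ m) x) < (B ^^ k) x" if "x \<in> {c..d}" for k m x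
          using gt[OF that, of k] lt[OF that, of m] asmono[of "(D ^^ m) x" v] by linarith
        then show "\<forall>\<^sub>F m in sequentially. \<forall>\<^sub>F k in sequentially. \<forall>x\<in>{c..d}. a ((D ^^ m) x) \<noteq> (B ^^ k) x"
          by (intro always_eventually allI ballI) (metis less_irrefl)
      qed
    qed
  qed
qed

lemma funpow_increasing:
  fixes F :: "real \<Rightarrow> real"
  assumes "strict_mono F" "n > 0" "y < F y"
  shows "F y \<le> (F ^^ n) y"
  using assms(2)
proof (induction n rule: nat_induct_non_zero)
  case (Suc n)
  then have "y < (F ^^ n) y" using assms(3) by simp
  then have "F y < F ((F ^^ n) y)" using assms(1) by (simp add: strict_mono_less)
  then show ?case by simp
qed simp

lemma funpow_decreasing:
  fixes F :: "real \<Rightarrow> real"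
  assumes "strict_mono F" "n > 0" "F y < y"
  shows "(F ^^ n) y \<le> F y"
  using assms(2)
proof (induction n rule: nat_induct_non_zero)
  case (Suc n)
  then have "(F ^^ n) y < y" using assms(3) by simp
  then have "F ((F ^^ n) y) < F y" using assms(1) by (simp add: strict_mono_less)
  then show ?case by simp
qed simp

text \<open>At most one exponent is bad. If the orbit of \<open>v\<close> met \<open>u\<close>
  twice, \<open>u\<close> would be periodic and hence fixed, \<open>a\<close> being increasing; then
  a power of \<open>a\<close> would send \<open>u\<close> and \<open>v\<close> to the same
  point.\<close>

lemma eventually_funpow_neq:
  fixes a :: "real \<Rightarrow> real"
  assumes a: "strict_mono a" "surj a" and "u \<noteq> v"
  shows "\<forall>\<^sub>F j in sequentially. (a ^^ j) v \<noteq> u"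
proof (cases "\<exists>i. (a ^^ i) v = u")
  case True
  then obtain i where i: "(a ^^ i) v = u" by blast
  have "(a ^^ j) v \<noteq> u" if "j > i" for j
  proof
    assume j: "(a ^^ j) v = u"
    have "(a ^^ (j - i)) u = u"
      using funpow_add[of "j - i" i a] i j that by simp
    then have "a u = u"
      using funpow_increasing[OF a(1), of "j - i" u] funpow_decreasing[OF a(1), of "j - i" u] that
      by (cases "a u" u rule: linorder_cases) auto
    then have "(a ^^ i) u = (a ^^ i) v" using i funpow_fixed[of a u i] by simp
    then show False
      using strict_mono_eq[OF strict_mono_funpow(1)[OF a], of i u v] assms(3) by simp
  qed
  then show ?thesis by (rule eventually_mono[OF eventually_gt_at_top[of i]])
qed simp

text \<open>The supremum \<open>s\<close> of the orbit of \<open>q\<close> is fixed by the whole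
  group: every element sends it to a point at most \<open>s\<close>, and so does the inverse. If the
  orbit stayed below \<open>p\<close>, this would be a common fixed point in
  \<open>{q..p}\<close>.\<close>

lemma group_moves_past:
  fixes A :: "(real \<Rightarrow> real) set"
  assumes A: "\<And>a. a \<in> A \<Longrightarrow> strict_mono a \<and> surj a"
    and id: "id \<in> A"
    and comp: "\<And>a b. a \<in> A \<Longrightarrow> b \<in> A \<Longrightarrow> a \<circ> b \<in> A"
    and inv: "\<And>a. a \<in> A \<Longrightarrow> finv a \<in> A"
    and qp: "q \<le> p" "\<And>x. x \<in> {q..p} \<Longrightarrow> \<exists>a\<in>A. a x \<noteq> x"
  obtains a where "a \<in> A" "p < a q"
proof (rule ccontr)
  note past = that
  assume "\<not> thesis"
  then have le: "a q \<le> p" if "a \<in> A" for a using past that by force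
  define s where "s = (SUP a\<in>A. a q)"
  have bdd: "bdd_above ((\<lambda>a. a q) ` A)" using le by (auto intro!: bdd_aboveI)
  have upper: "a q \<le> s" if "a \<in> A" for a unfolding s_def using that bdd by (rule cSUP_upper)
  have "s \<le> p" unfolding s_def using id le by (intro cSUP_least) auto
  moreover have "q \<le> s" using upper[OF id] by simp
  moreover have a_le: "a s \<le> s" if "a \<in> A" for a
  proof -
    note a = A[OF that]
    have "s \<le> finv a s" unfolding s_def
    proof (rule cSUP_least)
      fix b assume "b \<in> A"
      then have "a (b q) \<le> s" using upper[OF comp[OF that]] by simp
      then have "a (b q) \<le> a (finv a s)" using a by (simp add: surj_f_inv_f)
      then show "b q \<le> finv a (SUP a\<in>A. a q)"
        using a by (simp add: strict_mono_less_eq s_def)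
    qed (use id in auto)
    then have "a s \<le> a (finv a s)" using a by (simp add: strict_mono_less_eq)
    then show ?thesis using a by (simp add: surj_f_inv_f)
  qed
  moreover have "a s = s" if "a \<in> A" for a
  proof (rule antisym[OF a_le[OF that]])
    have "a (finv a s) \<le> a s"
      using A[OF that] a_le[OF inv[OF that]] by (simp add: strict_mono_less_eq)
    then show "s \<le> a s" using A[OF that] by (simp add: surj_f_inv_f)
  qed
  ultimately show False using qp(2)[of s] by auto
qed

text \<open>Induction on the set of intervals. If \<open>b\<close> displaces the old ones, it
  suffices to find a \<open>w\<close> that displaces them too and satisfies \<open>w c > d\<close>,
  for then \<open>w x \<ge> w c > d \<ge> x\<close> on the new interval. The words start from an
  \<open>a\<close> with \<open>a c > d\<close>. Normalising \<open>b\<close> by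
  \<open>d \<le> b d\<close> ensures that its powers on the left keep points above
  \<open>d\<close>.\<close>

lemma group_displaces_intervals:
  fixes A :: "(real \<Rightarrow> real) set"
  assumes A: "\<And>a. a \<in> A \<Longrightarrow> strict_mono a \<and> surj a \<and> a x0 = x0 \<and> a x1 = x1"
    and id: "id \<in> A"
    and comp: "\<And>a b. a \<in> A \<Longrightarrow> b \<in> A \<Longrightarrow> a \<circ> b \<in> A"
    and inv: "\<And>a. a \<in> A \<Longrightarrow> finv a \<in> A"
    and P: "finite P" "\<And>c d. (c, d) \<in> P \<Longrightarrow> {c..d} \<subseteq> {x0..x1} \<inter> {x. \<exists>a\<in>A. a x \<noteq> x}"
  shows "\<exists>a\<in>A. \<forall>p\<in>P. \<forall>x\<in>{fst p..snd p}. a x \<noteq> x"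
  using P
proof (induction P rule: finite_induct)
  case empty
  then show ?case using id by auto
next
  case (insert p P)
  obtain c d where p: "p = (c, d)" by (cases p)
  obtain b0 where b0: "b0 \<in> A" "\<forall>p\<in>P. \<forall>x\<in>{fst p..snd p}. b0 x \<noteq> x"
    using insert by auto
  show ?case
  proof (cases "c \<le> d")
    case False
    then show ?thesis using b0 p by auto
  next
    case True
    have pw: "a ^^ n \<in> A" if "a \<in> A" for a n
    proof (induction n)
      case 0
      then show ?case using id by (simp only: funpow.simps)
    next
      case (Suc n)
      then show ?case using comp[OF that] by (simp only: funpow.simps)
    qed
    have bij: "bij a" if "a \<in> A" for a using A[OF that] strict_mono_bij by blast
    \<comment> \<open>If \<open>b0\<close> moves \<open>d\<close> down, its inverse moves
      \<open>d\<close> up and has the same fixed points.\<close>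
    have "\<exists>b\<in>A. d \<le> b d \<and> (\<forall>p\<in>P. \<forall>x\<in>{fst p..snd p}. b x \<noteq> x)"
    proof (cases "d \<le> b0 d")
      case False
      have "b0 d < b0 (finv b0 d)" using False bij[OF b0(1)] by (simp add: bij_is_surj surj_f_inv_f)
      then have "d \<le> finv b0 d" using A[OF b0(1)] by (simp add: strict_mono_less)
      moreover have "finv b0 x \<noteq> x" if "b0 x \<noteq> x" for x
        using bij_inv_eq_iff[OF bij[OF b0(1)], of x x] that by metis
      ultimately show ?thesis using inv[OF b0(1)] b0(2) by blast
    qed (use b0 in auto)
    then obtain b where b: "b \<in> A" "d \<le> b d" "\<forall>p\<in>P. \<forall>x\<in>{fst p..snd p}. b x \<noteq> x" by blast
    obtain a where a: "a \<in> A" "d < a c"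
      by (rule group_moves_past[of A c d]) (use A id comp inv True insert.prems[of c d] p in auto)
    define B where "B = finv b"
    have B: "B \<in> A" unfolding B_def by (rule inv[OF b(1)])
    have finvB: "finv B = b" unfolding B_def by (rule inv_inv_eq[OF bij[OF b(1)]])
    have Bnf: "B x \<noteq> x" if "b x \<noteq> x" for x
      using bij_inv_eq_iff[OF bij[OF b(1)], of x x] that unfolding B_def by metis
    have Bnf': "\<forall>x\<in>{fst p..snd p}. B x \<noteq> x" if "p \<in> P" for p using b(3) Bnf that by auto
    have sub: "{fst p..snd p} \<subseteq> {x0..x1}" if "p \<in> P" for p
      using insert.prems[of "fst p" "snd p"] that by auto
    have AB: "strict_mono B" "surj B" "B x0 = x0" "B x1 = x1" using A[OF B] by auto
    have pd: "(b ^^ k) d \<ge> d" for k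
    proof (cases "b d = d")
      case False
      then show ?thesis
        using funpow_increasing[of b k d] A[OF b(1)] b(2) by (cases "k = 0") auto
    qed (simp add: funpow_fixed)
    have big: "d < (b ^^ k) y" if "d < y" for y k
      using strict_mono_less[OF strict_mono_funpow(1), of b k d y] A[OF b(1)] that pd[of k] by simp
    (* As b has no fixed point on the intervals of P, neither b^k a b^(-m) nor b^k a^j b^m has one there
       for large m and k; one of the two moves c past d, according to the sign of b c - c. *)
    have "\<exists>w\<in>A. d < w c \<and> (\<forall>p\<in>P. \<forall>x\<in>{fst p..snd p}. w x \<noteq> x)"
    proof (cases "b c \<le> c")
      case True
      have "\<forall>\<^sub>F m in sequentially. \<forall>p\<in>P. \<forall>\<^sub>F k in sequentially. \<forall>x\<in>{fst p..snd p}. a ((B ^^ m) x) \<noteq> (B ^^ k) x"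
        using A[OF a(1)]
        by (intro eventually_ball_finite insert.hyps ballI
            eventually_conjugate_no_coincidence[OF AB _ _ sub Bnf']) auto
      then obtain m where "\<forall>p\<in>P. \<forall>\<^sub>F k in sequentially. \<forall>x\<in>{fst p..snd p}. a ((B ^^ m) x) \<noteq> (B ^^ k) x"
        using eventually_happens'[OF sequentially_bot] by blast
      then have "\<forall>\<^sub>F k in sequentially. \<forall>p\<in>P. \<forall>x\<in>{fst p..snd p}. a ((B ^^ m) x) \<noteq> (B ^^ k) x"
        by (intro eventually_ball_finite insert.hyps)
      then obtain k where k: "\<forall>p\<in>P. \<forall>x\<in>{fst p..snd p}. a ((B ^^ m) x) \<noteq> (B ^^ k) x"
        using eventually_happens'[OF sequentially_bot] by blast
      have "c \<le> B c"
        using True strict_mono_less_eq[of b c "B c"] A[OF b(1)] by (simp add: B_def surj_f_inv_f)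
      then have "c \<le> (B ^^ m) c"
        using funpow_increasing[of B m c] funpow_fixed[of B c m] AB(1)
        by (cases "m = 0"; cases "B c = c") auto
      then have "a c \<le> a ((B ^^ m) c)" using A[OF a(1)] by (simp add: strict_mono_less_eq)
      then have "d < (b ^^ k) (a ((B ^^ m) c))" using a(2) big by simp
      moreover have "(b ^^ k) \<circ> (a \<circ> (B ^^ m)) \<in> A" using comp pw a(1) b(1) B by blast
      moreover have "\<forall>p\<in>P. \<forall>x\<in>{fst p..snd p}. (b ^^ k) (a ((B ^^ m) x)) \<noteq> x"
        using k funpow_finv_cancel[OF bij[OF b(1)]] by (simp add: B_def)
      ultimately show ?thesis by (intro bexI[of _ "(b ^^ k) \<circ> (a \<circ> (B ^^ m))"]) auto
    next
      case False
      \<comment> \<open>Here \<open>b\<close> moves \<open>c\<close> up, so the right factor has to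
        be \<open>b^m\<close>. On an interval of \<open>P\<close>, \<open>B^k\<close> and
        \<open>b^m\<close> push to opposite ends \<open>u\<close> and \<open>v\<close>, and the
        argument breaks down if the middle letter sends \<open>v\<close> to \<open>u\<close>. A
        suitable power of \<open>a\<close> avoids this on all intervals at once.\<close>
      have "\<exists>uv. \<forall>p\<in>P. fst (uv p) \<noteq> snd (uv p) \<and> (\<forall>a. strict_mono a \<longrightarrow> surj a \<longrightarrow> a (snd (uv p)) \<noteq> fst (uv p) \<longrightarrow>
        (\<forall>\<^sub>F m in sequentially. \<forall>\<^sub>F k in sequentially. \<forall>x\<in>{fst p..snd p}. a ((b ^^ m) x) \<noteq> (B ^^ k) x))"
      proof (rule bchoice, rule ballI)
        fix p assume "p \<in> P"
        show "\<exists>uv. fst uv \<noteq> snd uv \<and> (\<forall>a. strict_mono a \<longrightarrow> surj a \<longrightarrow> a (snd uv) \<noteq> fst uv \<longrightarrow>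
        (\<forall>\<^sub>F m in sequentially. \<forall>\<^sub>F k in sequentially. \<forall>x\<in>{fst p..snd p}. a ((b ^^ m) x) \<noteq> (B ^^ k) x))"
          by (rule eventually_inverse_conjugate_no_coincidence[OF AB sub Bnf', OF \<open>p \<in> P\<close> \<open>p \<in> P\<close>])
            (auto simp: finvB)
      qed
      then obtain uv where uv: "\<And>p. p \<in> P \<Longrightarrow> fst (uv p) \<noteq> snd (uv p)"
        "\<And>p a. p \<in> P \<Longrightarrow> strict_mono a \<Longrightarrow> surj a \<Longrightarrow> a (snd (uv p)) \<noteq> fst (uv p) \<Longrightarrow>
        (\<forall>\<^sub>F m in sequentially. \<forall>\<^sub>F k in sequentially. \<forall>x\<in>{fst p..snd p}. a ((b ^^ m) x) \<noteq> (B ^^ k) x)"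
        by blast
      have "\<forall>\<^sub>F j in sequentially. 0 < j \<and> (\<forall>p\<in>P. (a ^^ j) (snd (uv p)) \<noteq> fst (uv p))"
        using A[OF a(1)] uv(1)
        by (intro eventually_conj eventually_gt_at_top eventually_ball_finite insert.hyps ballI eventually_funpow_neq) auto
      then obtain j where j: "0 < j" "\<forall>p\<in>P. (a ^^ j) (snd (uv p)) \<noteq> fst (uv p)"
        using eventually_happens'[OF sequentially_bot] by blast
      define e where "e = a ^^ j"
      have e: "e \<in> A" unfolding e_def by (rule pw[OF a(1)])
      have "d < e c" using funpow_increasing[of a j c] A[OF a(1)] a(2) True j(1) by (simp add: e_def)
      have "\<forall>\<^sub>F m in sequentially. \<forall>p\<in>P. \<forall>\<^sub>F k in sequentially. \<forall>x\<in>{fst p..snd p}. e ((b ^^ m) x) \<noteq> (B ^^ k) x"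
        using A[OF e] j(2)
        by (intro eventually_ball_finite insert.hyps ballI uv(2)) (auto simp: e_def)
      then obtain m where "\<forall>p\<in>P. \<forall>\<^sub>F k in sequentially. \<forall>x\<in>{fst p..snd p}. e ((b ^^ m) x) \<noteq> (B ^^ k) x"
        using eventually_happens'[OF sequentially_bot] by blast
      then have "\<forall>\<^sub>F k in sequentially. \<forall>p\<in>P. \<forall>x\<in>{fst p..snd p}. e ((b ^^ m) x) \<noteq> (B ^^ k) x"
        by (intro eventually_ball_finite insert.hyps)
      then obtain k where k: "\<forall>p\<in>P. \<forall>x\<in>{fst p..snd p}. e ((b ^^ m) x) \<noteq> (B ^^ k) x"
        using eventually_happens'[OF sequentially_bot] by blast
      have "c \<le> (b ^^ m) c"
        using funpow_increasing[of b m c] A[OF b(1)] False by (cases "m = 0") auto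
      then have "e c \<le> e ((b ^^ m) c)" using A[OF e] by (simp add: strict_mono_less_eq)
      then have "d < (b ^^ k) (e ((b ^^ m) c))" using \<open>d < e c\<close> big by simp
      moreover have "(b ^^ k) \<circ> (e \<circ> (b ^^ m)) \<in> A" using comp pw e b(1) by blast
      moreover have "\<forall>p\<in>P. \<forall>x\<in>{fst p..snd p}. (b ^^ k) (e ((b ^^ m) x)) \<noteq> x"
        using k funpow_finv_cancel[OF bij[OF b(1)]] by (simp add: B_def)
      ultimately show ?thesis by (intro bexI[of _ "(b ^^ k) \<circ> (e \<circ> (b ^^ m))"]) auto
    qed
    then obtain w where w: "w \<in> A" "d < w c" "\<forall>p\<in>P. \<forall>x\<in>{fst p..snd p}. w x \<noteq> x" by blast
    have "w x \<noteq> x" if "x \<in> {c..d}" for x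
      using strict_mono_less_eq[of w c x] A[OF w(1)] w(2) that by auto
    then show ?thesis using w p by (intro bexI[of _ w]) auto
  qed
qed

lemma group_displaces_compact:
  fixes A :: "(real \<Rightarrow> real) set"
  assumes A: "\<And>a. a \<in> A \<Longrightarrow> strict_mono a \<and> surj a \<and> a x0 = x0 \<and> a x1 = x1"
    and id: "id \<in> A"
    and comp: "\<And>a b. a \<in> A \<Longrightarrow> b \<in> A \<Longrightarrow> a \<circ> b \<in> A"
    and inv: "\<And>a. a \<in> A \<Longrightarrow> finv a \<in> A"
    and C: "compact C" "C \<subseteq> {x0..x1}" "\<And>x. x \<in> C \<Longrightarrow> \<exists>a\<in>A. a x \<noteq> x"
  obtains a where "a \<in> A" "\<And>x. x \<in> C \<Longrightarrow> a x \<noteq> x"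
proof -
  have "open (\<Union>a\<in>A. {x. a x \<noteq> x})" using A open_not_fixed by blast
  moreover have eq: "(\<Union>a\<in>A. {x. a x \<noteq> x}) = {x. \<exists>a\<in>A. a x \<noteq> x}" by auto
  ultimately obtain P where P: "finite P" "C \<subseteq> (\<Union>(c, d)\<in>P. {c..d})"
    "\<And>c d. (c, d) \<in> P \<Longrightarrow> {c..d} \<subseteq> {x0..x1} \<inter> {x. \<exists>a\<in>A. a x \<noteq> x}"
    using compact_interval_cover[OF C(1,2), of "{x. \<exists>a\<in>A. a x \<noteq> x}"] C(3) by (metis (mono_tags, lifting) mem_Collect_eq subsetI)
  obtain a where a: "a \<in> A" "\<forall>p\<in>P. \<forall>x\<in>{fst p..snd p}. a x \<noteq> x"
    using group_displaces_intervals[OF A id comp inv P(1,3)] by blast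
  have "a x \<noteq> x" if "x \<in> C" for x
  proof -
    from that P(2) obtain p where "p \<in> P" "x \<in> {fst p..snd p}" by (force simp: case_prod_beta)
    then show ?thesis using a(2) by blast
  qed
  then show ?thesis using that a(1) by blast
qed


section \<open>Ping-pong and common fixed points\<close>

lemma Homeo_subgroupD:
  assumes "subgroup G Homeo_circle"
  shows "f \<in> G \<Longrightarrow> f \<in> carrier Homeo_circle" "id \<in> G"
    "f \<in> G \<Longrightarrow> g \<in> G \<Longrightarrow> f \<circ> g \<in> G" "f \<in> G \<Longrightarrow> finv f \<in> G" "f \<in> G \<Longrightarrow> bij f"
proof -
  show c: "f \<in> G \<Longrightarrow> f \<in> carrier Homeo_circle" for f
    using subgroup.mem_carrier[OF assms] .
  show "id \<in> G" using subgroup.one_closed[OF assms] by simp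
  show "f \<in> G \<Longrightarrow> g \<in> G \<Longrightarrow> f \<circ> g \<in> G" using subgroup.m_closed[OF assms] by simp
  show "f \<in> G \<Longrightarrow> finv f \<in> G" using subgroup.m_inv_closed[OF assms] Homeo_circle_m_inv c by metis
  show "f \<in> G \<Longrightarrow> bij f" using c Homeo_circle_bij by blast
qed

lemma Homeo_subgroup_funpow:
  assumes "subgroup G Homeo_circle" "f \<in> G"
  shows "f ^^ n \<in> G"
proof (induction n)
  case 0
  then show ?case using Homeo_subgroupD(2)[OF assms(1)] by (simp only: funpow.simps)
next
  case (Suc n)
  then show ?case using Homeo_subgroupD(3)[OF assms(1)] assms(2) by (simp only: funpow.simps)
qed

section \<open>Words and free subgroups\<close>

lemma eval_word_sub:
  assumes "group G" "subgroup H G" "fst ` set w \<subseteq> H"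
  shows "eval_word (G\<lparr>carrier := H\<rparr>) w = eval_word G w"
  using assms(3)
proof (induction w)
  case (Cons l w)
  then show ?case
    using group.m_inv_consistent[OF assms(1,2)] by (cases l) auto
qed simp

lemma eval_word_closed:
  assumes "group G" "fst ` set w \<subseteq> carrier G"
  shows "eval_word G w \<in> carrier G"
  using assms(2)
proof (induction w)
  case Nil
  show ?case using assms(1) by (simp add: group.is_monoid)
next
  case (Cons l w)
  then show ?case using assms(1)
    by (cases l) (auto simp: group.is_monoid monoid.m_closed group.inv_closed)
qed

lemma eval_word_hom:
  assumes "group_hom G H \<phi>" "fst ` set w \<subseteq> carrier G"
  shows "eval_word H (map (apfst \<phi>) w) = \<phi> (eval_word G w)"
  using assms(2)
proof (induction w)
  case Nil
  show ?case using group_hom.hom_one[OF assms(1)] by simp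
next
  case (Cons l w)
  have "eval_word G w \<in> carrier G"
    using eval_word_closed[OF group_hom.axioms(1)[OF assms(1)]] Cons by auto
  with Cons show ?case
    using group_hom.hom_mult[OF assms(1)] group_hom.hom_inv[OF assms(1)]
      group.inv_closed[OF group_hom.axioms(1)[OF assms(1)]]
    by (cases l) auto
qed

lemma reduced_word_map:
  assumes "reduced_word w" "inj_on \<phi> (fst ` set w)"
  shows "reduced_word (map (apfst \<phi>) w)"
proof -
  have "successively (\<lambda>x y. (case apfst \<phi> x of (x, b) \<Rightarrow> \<lambda>(y, c). \<not> (x = y \<and> b \<noteq> c)) (apfst \<phi> y)) w"
    using assms(1) unfolding reduced_word_def
  proof (rule successively_mono)
    fix x y assume "x \<in> set w" "y \<in> set w" "(case x of (x, b) \<Rightarrow> \<lambda>(y, c). \<not> (x = y \<and> b \<noteq> c)) y"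
    then show "(case apfst \<phi> x of (x, b) \<Rightarrow> \<lambda>(y, c). \<not> (x = y \<and> b \<noteq> c)) (apfst \<phi> y)"
      using inj_onD[OF assms(2), of "fst x" "fst y"] by (cases x; cases y; force)
  qed
  then show ?thesis by (simp add: reduced_word_def successively_map)
qed

text \<open>The commutator of \<open>a\<close> and \<open>b\<close> is itself a nonempty reduced
  word, so freeness also excludes commutativity.\<close>

lemma free_pair_imp_nonabelian_free_subgroup:
  fixes G (structure)
  assumes G: "group G" and ab: "a \<in> carrier G" "b \<in> carrier G" "a \<noteq> b"
    and free: "\<And>w. w \<noteq> [] \<Longrightarrow> fst ` set w \<subseteq> {a, b} \<Longrightarrow> reduced_word w \<Longrightarrow> eval_word G w \<noteq> \<one>\<^bsub>G\<^esub>"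
  shows "\<not> no_nonabelian_free_subgroups G"
proof -
  interpret group G by (rule G)
  define F where "F = generate G {a, b}"
  have F: "subgroup F G" unfolding F_def by (rule generate_is_subgroup) (use ab in auto)
  have abF: "{a, b} \<subseteq> F" unfolding F_def by (auto intro: generate.incl)
  let ?F = "G\<lparr>carrier := F\<rparr>"
  have "free_basis ?F {a, b}"
    unfolding free_basis_def
  proof (intro conjI allI impI)
    show "{a, b} \<subseteq> carrier ?F" using abF by simp
    show "generate ?F {a, b} = carrier ?F"
      using generate_consistent[OF abF F] by (simp add: F_def)
    fix w assume w: "w \<noteq> [] \<and> fst ` set w \<subseteq> {a, b} \<and> reduced_word w"
    then have "eval_word ?F w = eval_word G w"
      using abF by (intro eval_word_sub[OF G F]) auto
    then show "eval_word ?F w \<noteq> \<one>\<^bsub>?F\<^esub>" using free w by simp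
  qed
  then have "free_group ?F"
    unfolding free_group_def using subgroup_imp_group[OF F] by blast
  moreover have "\<not> comm_group ?F"
  proof
    assume "comm_group ?F"
    then have "a \<otimes>\<^bsub>?F\<^esub> b = b \<otimes>\<^bsub>?F\<^esub> a"
      using abF by (intro comm_monoid.m_comm comm_group.axioms(1)) auto
    then have comm: "a \<otimes> b = b \<otimes> a" by simp
    have "eval_word G [(a, True), (b, True), (a, False), (b, False)] = (a \<otimes> b) \<otimes> (inv a \<otimes> inv b)"
      using ab by (simp add: m_assoc)
    also have "\<dots> = (b \<otimes> a) \<otimes> inv (b \<otimes> a)" using ab by (simp add: comm inv_mult_group)
    also have "\<dots> = \<one>" using ab by simp
    finally show False
      using free[of "[(a, True), (b, True), (a, False), (b, False)]"] ab(3)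
      by (auto simp: reduced_word_def)
  qed
  ultimately show ?thesis using F unfolding no_nonabelian_free_subgroups_def by blast
qed

text \<open>Used in contrapositive form: a basis of a nonabelian free group has two distinct
  elements.\<close>

lemma comm_group_generate_singleton:
  fixes G (structure)
  assumes "group G" "S \<subseteq> carrier G" "\<And>a b. a \<in> S \<Longrightarrow> b \<in> S \<Longrightarrow> a = b" "generate G S = carrier G"
  shows "comm_group G"
proof -
  interpret group G by (rule assms(1))
  show ?thesis
  proof (rule group_comm_groupI)
    fix x y assume xy: "x \<in> carrier G" "y \<in> carrier G"
    consider "S = {}" | a where "S = {a}" using assms(3) by blast
    then show "x \<otimes> y = y \<otimes> x"
    proof cases
      case 1
      then have "x \<in> {\<one>}" "y \<in> {\<one>}" using xy assms(4) generate_empty by blast+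
      then show ?thesis by simp
    next
      case (2 a)
      then have a: "a \<in> carrier G" using assms(2) by auto
      have "carrier G = {a [^] k | k :: int. k \<in> UNIV}"
        using assms(4) generate_pow[OF a] 2 by simp
      with xy obtain i j :: int where "x = a [^] i" "y = a [^] j" by blast
      then show ?thesis using a by (simp add: int_pow_mult[symmetric] add.commute)
    qed
  qed
qed

text \<open>Choose preimages of two distinct basis elements of a nonabelian free subgroup. A
  relation between the preimages would be mapped to a relation between the basis elements, so the
  preimages generate a free group of rank two.\<close>

lemma no_nonabelian_free_subgroups_surj:
  assumes hom: "group_hom G H \<phi>" and surj: "carrier H \<subseteq> \<phi> ` carrier G"
    and G: "no_nonabelian_free_subgroups G"
  shows "no_nonabelian_free_subgroups H"
  unfolding no_nonabelian_free_subgroups_def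
proof
  note grpG = group_hom.axioms(1)[OF hom] and grpH = group_hom.axioms(2)[OF hom]
  assume "\<exists>F. subgroup F H \<and> free_group (H\<lparr>carrier := F\<rparr>) \<and> \<not> comm_group (H\<lparr>carrier := F\<rparr>)"
  then obtain F S where F: "subgroup F H" "group (H\<lparr>carrier := F\<rparr>)"
    "free_basis (H\<lparr>carrier := F\<rparr>) S" "\<not> comm_group (H\<lparr>carrier := F\<rparr>)"
    unfolding free_group_def by blast
  have SF: "S \<subseteq> F" using F(3) by (simp add: free_basis_def)
  obtain a b where ab: "a \<in> S" "b \<in> S" "a \<noteq> b"
    using comm_group_generate_singleton[OF F(2), of S] F(3,4) by (auto simp: free_basis_def)
  have "a \<in> carrier H" "b \<in> carrier H" using ab SF subgroup.subset[OF F(1)] by auto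
  then have "a \<in> \<phi> ` carrier G" "b \<in> \<phi> ` carrier G" using surj by blast+
  then obtain a' b' where ab': "a' \<in> carrier G" "b' \<in> carrier G" "\<phi> a' = a" "\<phi> b' = b"
    by (elim imageE) blast
  have "\<not> no_nonabelian_free_subgroups G"
  proof (rule free_pair_imp_nonabelian_free_subgroup[OF grpG ab'(1,2)])
    show "a' \<noteq> b'" using ab' ab(3) by auto
    fix w assume w: "w \<noteq> []" "fst ` set w \<subseteq> {a', b'}" "reduced_word w"
    let ?w = "map (apfst \<phi>) w"
    have fst_w: "fst ` set ?w = \<phi> ` fst ` set w" by (force simp: image_iff)
    have inj: "inj_on \<phi> (fst ` set w)"
      by (rule inj_on_subset[OF _ w(2)]) (use ab' ab(3) in auto)
    have wS: "fst ` set ?w \<subseteq> S" unfolding fst_w using w(2) ab ab' by auto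
    then have "eval_word (H\<lparr>carrier := F\<rparr>) ?w \<noteq> \<one>\<^bsub>H\<^esub>"
      using F(3) w(1) reduced_word_map[OF w(3) inj] by (simp add: free_basis_def)
    then have "eval_word H ?w \<noteq> \<one>\<^bsub>H\<^esub>"
      using eval_word_sub[OF grpH F(1)] wS SF by (metis order_trans)
    moreover have "eval_word H ?w = \<phi> (eval_word G w)"
      using eval_word_hom[OF hom] w(2) ab' by auto
    ultimately show "eval_word G w \<noteq> \<one>\<^bsub>G\<^esub>" using group_hom.hom_one[OF hom] by auto
  qed
  then show False using G by contradiction
qed

text \<open>The complements of the sets \<open>C s\<close> are the usual ping-pong domains: they are
  pairwise disjoint, do not contain \<open>p\<close>, and every nonzero power of \<open>s\<close>
  maps \<open>C s\<close> into the complement of \<open>C s\<close>. A nonempty reduced word thus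
  sends \<open>p\<close> into the domain of its first letter. The formulation with
  \<open>C s\<close> suits closed sets that cover the circle.\<close>

lemma ping_pong:
  assumes S: "S \<subseteq> carrier Homeo_circle"
    and disj: "\<And>s n. s \<in> S \<Longrightarrow> n > 0 \<Longrightarrow> (s ^^ n) ` C s \<inter> C s = {}"
    and cover: "\<And>s t. s \<in> S \<Longrightarrow> t \<in> S \<Longrightarrow> s \<noteq> t \<Longrightarrow> C s \<union> C t = UNIV"
    and p: "\<And>s. s \<in> S \<Longrightarrow> p \<in> C s"
    and w: "w \<noteq> []" "fst ` set w \<subseteq> S" "reduced_word w"
  shows "eval_word Homeo_circle w \<noteq> id"
proof -
  define L where "L = (\<lambda>(s, e). if e then s else finv s :: circle \<Rightarrow> circle)"
  have bij: "bij s" if "s \<in> S" for s using S that Homeo_circle_bij by blast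
  have eval: "eval_word Homeo_circle (l # w) q = L l (eval_word Homeo_circle w q)" if "fst l \<in> S" for l w q
    using S that by (cases l) (auto simp: L_def Homeo_circle_m_inv)
  have disjL: "(L l ^^ n) ` C (fst l) \<inter> C (fst l) = {}" if l: "fst l \<in> S" "n > 0" for l n
  proof (cases l)
    case (Pair s e)
    show ?thesis
    proof (cases e)
      case False
      have "(finv s ^^ n) x \<notin> C s" if "x \<in> C s" for x
      proof
        assume a: "(finv s ^^ n) x \<in> C s"
        have "(s ^^ n) ((finv s ^^ n) x) = x"
          using funpow_finv_cancel[OF bij, of s n "(finv s ^^ n) x" x] l Pair by simp
        then show False using disj[of s n] a that l Pair by (metis IntI empty_iff fst_conv imageI)
      qed
      then show ?thesis using Pair False by (auto simp: L_def)
    qed (use disj[of s n] l Pair in \<open>simp add: L_def\<close>)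
  qed
  \<comment> \<open>For \<open>n\<close> one takes the length of the run of equal letters at the
    head of the word.\<close>
  have key: "\<exists>n>0. eval_word Homeo_circle (l # w) p \<in> (L l ^^ n) ` C (fst l)"
    if "fst ` set (l # w) \<subseteq> S" "reduced_word (l # w)" for l w
    using that
  proof (induction w arbitrary: l)
    case Nil
    then show ?case using eval[of l "[]" p] p[of "fst l"] by (auto intro!: exI[of _ 1])
  next
    case (Cons m w)
    then obtain n where n: "n > 0" "eval_word Homeo_circle (m # w) p \<in> (L m ^^ n) ` C (fst m)"
      by (force simp: reduced_word_def)
    have l: "fst l \<in> S" and m: "fst m \<in> S" using Cons.prems by auto
    have ev: "eval_word Homeo_circle (l # m # w) p = L l (eval_word Homeo_circle (m # w) p)"
      by (rule eval[OF l])
    show ?case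
    proof (cases "fst l = fst m")
      case True
      then have "l = m" using Cons.prems(2) by (cases l; cases m) (auto simp: reduced_word_def)
      then show ?thesis using n(2) unfolding ev
        by (intro exI[of _ "Suc n"]) auto
    next
      case False
      have "eval_word Homeo_circle (m # w) p \<notin> C (fst m)" using disjL[OF m n(1)] n(2) by blast
      then have "eval_word Homeo_circle (m # w) p \<in> C (fst l)" using cover[OF l m False] by blast
      then show ?thesis unfolding ev by (intro exI[of _ 1]) auto
    qed
  qed
  obtain l w' where lw: "w = l # w'" using w(1) by (cases w) auto
  have l: "fst l \<in> S" using w(2) lw by auto
  have "eval_word Homeo_circle w p \<notin> C (fst l)"
    using key[of l w'] w(2,3) disjL[OF l] unfolding lw by blast
  then show ?thesis using p[OF l] by auto
qed

section \<open>Two elements with disjoint fixed point sets\<close>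

lemma to_circle_funpow:
  assumes "circle_lift f F"
  shows "(f ^^ k) (to_circle x) = to_circle ((F ^^ k) x)"
  by (induction k) (use circle_liftD(4)[OF assms] in auto)

text \<open>\<open>W\<close> is the full preimage of a set on the circle. Since \<open>F\<close>
  fixes \<open>x0\<close> and \<open>x0 + 1\<close>, its powers preserve this period, and
  disjointness can be tested on the compact part of \<open>W\<close> inside it.\<close>

lemma circle_disjoint_powers:
  assumes F: "circle_lift f F" "F x0 = x0"
    and W: "closed W" "\<And>x n. x \<in> W \<Longrightarrow> x + of_int n \<in> W" "\<And>x. x \<in> W \<Longrightarrow> F x \<noteq> x"
  shows "\<forall>\<^sub>F k in sequentially. (f ^^ k) ` (to_circle ` W) \<inter> to_circle ` W = {}"
proof -
  note Fd = circle_liftD[OF F(1)]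
  have x1: "F (x0 + 1) = x0 + 1" using Fd(3) F(2) by simp
  define K where "K = {x0..x0+1} \<inter> W"
  have "\<forall>\<^sub>F k in sequentially. (F ^^ k) ` K \<inter> K = {}"
    by (rule eventually_image_disjoint[OF Fd(1,2) F(2) x1])
      (use W in \<open>auto simp: K_def intro: compact_Int_closed\<close>)
  then show ?thesis
  proof eventually_elim
    case (elim k)
    show ?case
    proof (rule ccontr)
      assume "\<not> ?case"
      then obtain x y where xy: "x \<in> W" "y \<in> W" "(f ^^ k) (to_circle x) = to_circle y" by auto
      obtain z where z: "to_circle x = to_circle z" "x0 \<le> z" "z < x0 + 1"
        using to_circle_cases_interval[of "to_circle x" x0] by blast
      obtain n :: int where "z = x + of_int n"
        using z(1) to_circle_eq_iff[of z x] by (metis Ints_cases add.commute diff_add_cancel)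
      then have "z \<in> K" using W(2) xy(1) z by (auto simp: K_def)
      have "to_circle ((F ^^ k) z) = to_circle y" using xy(3) z(1) to_circle_funpow[OF F(1)] by metis
      then obtain n :: int where "(F ^^ k) z = y + of_int n"
        using to_circle_eq_iff[of "(F ^^ k) z" y] by (metis Ints_cases add.commute diff_add_cancel)
      then have "(F ^^ k) z \<in> W" using W(2) xy(2) by simp
      moreover have "x0 \<le> (F ^^ k) z" "(F ^^ k) z \<le> x0 + 1"
        using strict_mono_less_eq[OF strict_mono_funpow(1)[OF Fd(1,2), of k], of x0 z]
          strict_mono_less_eq[OF strict_mono_funpow(1)[OF Fd(1,2), of k], of z "x0 + 1"] z
          funpow_fixed[of F x0 k, OF F(2)] funpow_fixed[of F "x0 + 1" k, OF x1] by auto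
      ultimately have "(F ^^ k) z \<in> K" by (simp add: K_def)
      then show False using elim \<open>z \<in> K\<close> by blast
    qed
  qed
qed

lemma disjoint_fixed_points_imp_free:
  assumes G: "subgroup G Homeo_circle" and fg: "f \<in> G" "g \<in> G"
    and fix_f: "f p = p" and fix_g: "g q = q" and disj: "\<And>r. f r = r \<Longrightarrow> g r \<noteq> r"
  shows "\<not> no_nonabelian_free_subgroups (Homeo_sub G)"
proof -
  note Gd = Homeo_subgroupD[OF G]
  obtain x0 y0 where x0: "p = to_circle x0" and y0: "q = to_circle y0" by (metis to_circle_cases)
  obtain F where F: "circle_lift f F" "F x0 = x0"
    using obtain_fixing_lift[of f x0] Gd(1) fg fix_f x0 by auto
  obtain H where H: "circle_lift g H" "H y0 = y0"
    using obtain_fixing_lift[of g y0] Gd(1) fg fix_g y0 by auto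
  note Fd = circle_liftD[OF F(1)] and Hd = circle_liftD[OF H(1)]
  (* Comparing displacements gives closed sets covering the circle, each free of the fixed points of
     one of the maps. *)
  define W V where "W = {x. \<bar>H x - x\<bar> \<le> \<bar>F x - x\<bar>}" and "V = {x. \<bar>F x - x\<bar> \<le> \<bar>H x - x\<bar>}"
  have cont: "continuous_on A (\<lambda>x. \<bar>F x - x\<bar>)" "continuous_on A (\<lambda>x. \<bar>H x - x\<bar>)" for A
    using strict_mono_surj_continuous[OF Fd(1,2)] strict_mono_surj_continuous[OF Hd(1,2)]
    by (auto intro!: continuous_intros)
  have closed: "closed W" "closed V"
    unfolding W_def V_def by (intro closed_Collect_le cont)+
  have per: "x + of_int n \<in> W \<longleftrightarrow> x \<in> W" "x + of_int n \<in> V \<longleftrightarrow> x \<in> V" for x n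
    using circle_lift_add_int[OF F(1)] circle_lift_add_int[OF H(1)] by (auto simp: W_def V_def)
  have common: "H x \<noteq> x" if "F x = x" for x
    using disj[of "to_circle x"] circle_lift_fixed_iff[OF F] circle_lift_fixed_iff[OF H] that by metis
  have nf: "x \<in> W \<Longrightarrow> F x \<noteq> x" "x \<in> V \<Longrightarrow> H x \<noteq> x" for x
    using common[of x] by (auto simp: W_def V_def)
  have "\<forall>\<^sub>F k in sequentially. (f ^^ k) ` (to_circle ` W) \<inter> to_circle ` W = {} \<and>
    (g ^^ k) ` (to_circle ` V) \<inter> to_circle ` V = {}"
    using per nf by (intro eventually_conj circle_disjoint_powers[OF F closed(1)]
        circle_disjoint_powers[OF H closed(2)]) auto
  then obtain N where N: "\<And>k. k \<ge> N \<Longrightarrow> (f ^^ k) ` (to_circle ` W) \<inter> to_circle ` W = {} \<and>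
    (g ^^ k) ` (to_circle ` V) \<inter> to_circle ` V = {}"
    unfolding eventually_sequentially by blast
  \<comment> \<open>Every positive power of \<open>a\<close> is a power of \<open>f\<close> with
    exponent at least \<open>N\<close>, and likewise for \<open>b\<close> and
    \<open>g\<close>.\<close>
  define a b where "a = f ^^ Suc N" and "b = g ^^ Suc N"
  have ab: "a \<in> G" "b \<in> G" unfolding a_def b_def by (intro Homeo_subgroup_funpow[OF G] fg)+
  have UN: "to_circle ` W \<union> to_circle ` V = UNIV"
  proof -
    have "W \<union> V = UNIV" by (auto simp: W_def V_def)
    then show ?thesis by (metis image_Un surjI to_circle_cases UNIV_I image_iff subsetI top.extremum_unique)
  qed
  \<comment> \<open>The displacement of \<open>F\<close> vanishes at \<open>x0\<close> and that of
    \<open>H\<close> at \<open>y0\<close>, so they balance somewhere in between. The balanced point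
    lies in both \<open>W\<close> and \<open>V\<close>; it is the base point for ping-pong and also
    shows \<open>a \<noteq> b\<close>.\<close>
  have "\<exists>z. \<bar>H z - z\<bar> - \<bar>F z - z\<bar> = 0"
  proof (cases "x0 \<le> y0")
    case True
    then show ?thesis
      using IVT2'[of "\<lambda>z. \<bar>H z - z\<bar> - \<bar>F z - z\<bar>" y0 0 x0] F(2) H(2)
        continuous_on_diff[OF cont(2,1), of "{x0..y0}"] by auto
  next
    case False
    then show ?thesis
      using IVT'[of "\<lambda>z. \<bar>H z - z\<bar> - \<bar>F z - z\<bar>" y0 0 x0] F(2) H(2)
        continuous_on_diff[OF cont(2,1), of "{y0..x0}"] by auto
  qed
  then obtain z where "\<bar>H z - z\<bar> - \<bar>F z - z\<bar> = 0" by blast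
  then have z: "z \<in> W" "z \<in> V" by (simp_all add: W_def V_def)
  have powa: "(a ^^ n) ` (to_circle ` W) \<inter> to_circle ` W = {}" if "n > 0" for n
    using N[of "Suc N * n"] that unfolding a_def funpow_mult by (cases n) auto
  have powb: "(b ^^ n) ` (to_circle ` V) \<inter> to_circle ` V = {}" if "n > 0" for n
    using N[of "Suc N * n"] that unfolding b_def funpow_mult by (cases n) auto
  have "a \<noteq> b"
  proof
    assume "a = b"
    then have "a (to_circle z) \<in> a ` to_circle ` W" "a (to_circle z) \<in> b ` to_circle ` V"
      using z by blast+
    moreover have "a ` to_circle ` W \<inter> to_circle ` W = {}" "b ` to_circle ` V \<inter> to_circle ` V = {}"
      using powa[of 1] powb[of 1] by simp_all
    ultimately have "a (to_circle z) \<notin> to_circle ` W" "a (to_circle z) \<notin> to_circle ` V"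
      by (metis disjoint_iff)+
    then show False using UN by blast
  qed
  show ?thesis
  proof (rule free_pair_imp_nonabelian_free_subgroup)
    show "group (Homeo_sub G)"
      using group.subgroup_imp_group[OF group_Homeo_circle G] .
    show "a \<in> carrier (Homeo_sub G)" "b \<in> carrier (Homeo_sub G)" "a \<noteq> b"
      using ab \<open>a \<noteq> b\<close> by auto
    fix w assume w: "w \<noteq> []" "fst ` set w \<subseteq> {a, b}" "reduced_word w"
    have "eval_word (Homeo_sub G) w = eval_word Homeo_circle w"
      using w(2) ab by (intro eval_word_sub[OF group_Homeo_circle G]) auto
    moreover have "eval_word Homeo_circle w \<noteq> id"
    proof (rule ping_pong[OF _ _ _ _ w])
      show "{a, b} \<subseteq> carrier Homeo_circle" using ab Gd(1) by auto
      let ?C = "\<lambda>s. to_circle ` (if s = a then W else V)"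
      show "(s ^^ n) ` ?C s \<inter> ?C s = {}" if "s \<in> {a, b}" "n > 0" for s n
        using that powa[of n] powb[of n] \<open>a \<noteq> b\<close> by (elim insertE) (simp_all del: image_image)
      show "?C s \<union> ?C t = UNIV" if "s \<in> {a, b}" "t \<in> {a, b}" "s \<noteq> t" for s t
        using that UN by auto
      show "to_circle z \<in> ?C s" if "s \<in> {a, b}" for s using z by auto
    qed
    ultimately show "eval_word (Homeo_sub G) w \<noteq> \<one>\<^bsub>Homeo_sub G\<^esub>" by simp
  qed
qed


section \<open>Common fixed points of families\<close>

lemma finite_common_fixed_point:
  assumes G: "subgroup G Homeo_circle" and free: "no_nonabelian_free_subgroups (Homeo_sub G)"
    and S: "finite S" "S \<subseteq> {f \<in> G. \<exists>q. f q = q}"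
  shows "\<exists>p. \<forall>f\<in>S. f p = p"
  using S
proof (induction S rule: finite_induct)
  case (insert g S)
  note Gd = Homeo_subgroupD[OF G]
  define K where "K = {p. \<forall>f\<in>S. f p = p}"
  show ?case
  proof (rule ccontr)
    assume contra: "\<nexists>p. \<forall>f\<in>insert g S. f p = p"
    obtain p where p: "\<forall>f\<in>S. f p = p" using insert by auto
    obtain x0 where "p = to_circle x0" by (rule to_circle_cases)
    then have x0: "to_circle x0 \<in> K" using p by (simp add: K_def)
    obtain q where q: "g q = q" and g: "g \<in> G" using insert.prems by auto
    obtain y0 where y0: "q = to_circle y0" by (rule to_circle_cases)
    obtain H where H: "circle_lift g H" "H y0 = y0"
      using obtain_fixing_lift[of g y0] Gd(1)[OF g] q y0 by auto
    \<comment> \<open>The lifts are normalised at \<open>x0\<close>, so that they form a group and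
      fix both ends of the period from \<open>x0\<close> to \<open>x0 + 1\<close>.\<close>
    define A where "A = {F. F x0 = x0 \<and> (\<exists>f\<in>G. (\<forall>p\<in>K. f p = p) \<and> circle_lift f F)}"
    define C where "C = {x \<in> {x0..x0 + 1}. H x = x}"
    obtain F where F: "F \<in> A" "\<And>x. x \<in> C \<Longrightarrow> F x \<noteq> x"
    proof (rule group_displaces_compact[of A x0 "x0 + 1" C])
      show "strict_mono F \<and> surj F \<and> F x0 = x0 \<and> F (x0 + 1) = x0 + 1" if "F \<in> A" for F
        using that circle_liftD(1,2)[of _ F] circle_liftD(3)[of _ F x0] by (auto simp: A_def)
      have "circle_lift id id" using circle_lift_id by (simp add: id_def)
      then show "id \<in> A" using Gd(2) by (auto simp: A_def intro: bexI[of _ id])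
      show "F \<circ> F' \<in> A" if "F \<in> A" "F' \<in> A" for F F'
      proof -
        obtain f f' where ff: "f \<in> G" "\<forall>p\<in>K. f p = p" "circle_lift f F"
          "f' \<in> G" "\<forall>p\<in>K. f' p = p" "circle_lift f' F'"
          using \<open>F \<in> A\<close> \<open>F' \<in> A\<close> by (auto simp: A_def)
        have "(F \<circ> F') x0 = x0" using that by (simp add: A_def)
        moreover have "\<forall>p\<in>K. (f \<circ> f') p = p" using ff by simp
        ultimately show ?thesis
          unfolding A_def using Gd(3)[OF ff(1,4)] circle_lift_compose[OF ff(3,6)] by blast
      qed
      show "finv F \<in> A" if "F \<in> A" for F
      proof -
        obtain f where f: "f \<in> G" "\<forall>p\<in>K. f p = p" "circle_lift f F" "F x0 = x0"
          using \<open>F \<in> A\<close> by (auto simp: A_def)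
        have "finv F x0 = x0" using bij_inv_eq_iff[OF circle_liftD(5)[OF f(3)], of x0 x0] f(4) by simp
        moreover have "\<forall>p\<in>K. finv f p = p"
          using f(2) bij_inv_eq_iff[OF Gd(5)[OF f(1)]] by metis
        ultimately show ?thesis
          unfolding A_def using Gd(4)[OF f(1)] circle_lift_inv[OF f(3) Gd(5)[OF f(1)]] by blast
      qed
      have "C = {x0..x0 + 1} - {x. H x \<noteq> x}" by (auto simp: C_def)
      then show "compact C"
        using open_not_fixed[OF circle_liftD(1,2)[OF H(1)]] by (simp add: compact_diff)
      show "C \<subseteq> {x0..x0 + 1}" by (auto simp: C_def)
      show "\<exists>F\<in>A. F x \<noteq> x" if "x \<in> C" for x
      proof -
        have "g (to_circle x) = to_circle x"
          using that circle_lift_fixed_iff[OF H] by (simp add: C_def)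
        \<comment> \<open>No fixed point of \<open>g\<close> lies in \<open>K\<close>, so some
          member of \<open>S\<close> moves \<open>x\<close>; it fixes \<open>K\<close> pointwise by
          the definition of \<open>K\<close>.\<close>
        then obtain f where f: "f \<in> S" "f (to_circle x) \<noteq> to_circle x" using contra by auto
        then have "f \<in> G" "\<forall>p\<in>K. f p = p" using insert.prems by (auto simp: K_def)
        moreover obtain F where F: "circle_lift f F" "F x0 = x0"
          using obtain_fixing_lift[of f x0] Gd(1)[OF \<open>f \<in> G\<close>] x0 f(1) by (auto simp: K_def)
        moreover have "F x \<noteq> x" using circle_lift_fixed_iff[OF F] f(2) by simp
        ultimately show ?thesis by (auto simp: A_def)
      qed
    qed blast
    obtain f where f: "f \<in> G" "\<forall>p\<in>K. f p = p" "circle_lift f F" "F x0 = x0"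
      using F(1) by (auto simp: A_def)
    have "g r \<noteq> r" if "f r = r" for r
    proof
      assume "g r = r"
      obtain x where x: "r = to_circle x" "x0 \<le> x" "x < x0 + 1" by (rule to_circle_cases_interval)
      then have "x \<in> C" using \<open>g r = r\<close> circle_lift_fixed_iff[OF H] by (simp add: C_def)
      then show False using F(2) circle_lift_fixed_iff[OF f(3,4)] that x(1) by simp
    qed
    then have "\<not> no_nonabelian_free_subgroups (Homeo_sub G)"
      using disjoint_fixed_points_imp_free[OF G f(1) g, of "to_circle x0" q] f(2) x0 q by blast
    then show False using free by contradiction
  qed
qed simp

theorem common_fixed_point:
  assumes G: "subgroup G Homeo_circle" and free: "no_nonabelian_free_subgroups (Homeo_sub G)"
  obtains p where "\<And>f. f \<in> G \<Longrightarrow> \<exists>q. f q = q \<Longrightarrow> f p = p"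
proof -
  define G0 where "G0 = {f \<in> G. \<exists>q. f q = q}"
  define Z where "Z = (\<lambda>f. {x :: real. f (to_circle x) = to_circle x})"
  have "{0..1} \<inter> (\<Inter>f\<in>G0. Z f) \<noteq> {}"
  proof (rule compact_imp_fip_image)
    fix f assume "f \<in> G0"
    then obtain q where f: "f \<in> G" "f q = q" by (auto simp: G0_def)
    obtain y where "q = to_circle y" by (rule to_circle_cases)
    then obtain F where F: "circle_lift f F" "F y = y"
      using obtain_fixing_lift[of f y] Homeo_subgroupD(1)[OF G f(1)] f(2) by auto
    have "Z f = - {x. F x \<noteq> x}" using circle_lift_fixed_iff[OF F] by (auto simp: Z_def)
    then show "closed (Z f)"
      using open_not_fixed[OF circle_liftD(1,2)[OF F(1)]] by (simp add: closed_Compl)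
  next
    fix S assume S: "finite S" "S \<subseteq> G0"
    then obtain p where p: "\<forall>f\<in>S. f p = p"
      using finite_common_fixed_point[OF G free, of S] by (auto simp: G0_def)
    obtain x where x: "p = to_circle x" "0 \<le> x" "x < 0 + 1" by (rule to_circle_cases_interval)
    then have "x \<in> {0..1} \<inter> (\<Inter>f\<in>S. Z f)" using p by (auto simp: Z_def)
    then show "{0..1} \<inter> (\<Inter>f\<in>S. Z f) \<noteq> {}" by blast
  qed simp
  then obtain x where "\<forall>f\<in>G0. f (to_circle x) = to_circle x" by (auto simp: Z_def)
  then show ?thesis using that[of "to_circle x"] by (auto simp: G0_def)
qed


section \<open>Rotation numbers\<close>

text \<open>Up to an error \<open>m\<close>, \<open>a (m * n)\<close> is \<open>m\<close> times
  \<open>a n\<close>; exchanging the roles gives an error \<open>n\<close>. Dividing by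
  \<open>m n\<close> compares the two quotients up to \<open>1/m + 1/n\<close>, so they form a
  Cauchy sequence.\<close>

lemma quasi_additive_convergent:
  fixes a :: "nat \<Rightarrow> real"
  assumes quasi: "\<And>m n. \<bar>a (m + n) - a m - a n\<bar> \<le> 1"
  shows "convergent (\<lambda>n. a n / real n)"
proof -
  have mult: "\<bar>a (m * n) - real m * a n\<bar> \<le> real m" if "m > 0" for m n
    using that
  proof (induction m rule: nat_induct_non_zero)
    case (Suc m)
    then show ?case using quasi[of n "m * n"] by (simp add: algebra_simps)
  qed simp
  have close: "\<bar>a m / real m - a n / real n\<bar> \<le> 1 / real m + 1 / real n" if "m > 0" "n > 0" for m n
  proof -
    have half: "\<bar>a (m * n) / (real m * real n) - a n / real n\<bar> \<le> 1 / real n"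
      if "m > 0" "n > 0" for m n
    proof -
      have "a (m * n) / (real m * real n) - a n / real n = (a (m * n) - real m * a n) / (real m * real n)"
        using that by (simp add: field_simps)
      then have "\<bar>a (m * n) / (real m * real n) - a n / real n\<bar> = \<bar>a (m * n) - real m * a n\<bar> / (real m * real n)"
        by (simp add: abs_divide abs_mult)
      also have "\<dots> \<le> real m / (real m * real n)"
        using mult[OF that(1), of n] by (intro divide_right_mono) auto
      also have "\<dots> = 1 / real n" using that by simp
      finally show ?thesis .
    qed
    show ?thesis using half[OF that] half[OF that(2,1)] by (simp add: mult.commute)
  qed
  have "Cauchy (\<lambda>n. a n / real n)"
  proof (rule metric_CauchyI)
    fix e :: real assume "e > 0"
    obtain N :: nat where N: "2 / e < real N" using reals_Archimedean2 by blast
    then have "N > 0" using \<open>e > 0\<close> by (cases N) (auto simp: field_simps)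
    show "\<exists>M. \<forall>m\<ge>M. \<forall>n\<ge>M. dist (a m / real m) (a n / real n) < e"
    proof (intro exI allI impI)
      fix m n assume mn: "m \<ge> N" "n \<ge> N"
      have "1 / real k < e / 2" if "k \<ge> N" for k
      proof -
        have "2 / e < real k" using N that by linarith
        moreover have "0 < real k" using that \<open>N > 0\<close> by simp
        ultimately show ?thesis using \<open>e > 0\<close> by (simp add: field_simps)
      qed
      from this[OF mn(1)] this[OF mn(2)] show "dist (a m / real m) (a n / real n) < e"
        using close[of m n] mn \<open>N > 0\<close> by (simp add: dist_real_def)
    qed
  qed
  then show ?thesis by (rule Cauchy_convergent)
qed

lemma circle_lift_funpow:
  assumes "circle_lift f F"
  shows "circle_lift (f ^^ n) (F ^^ n)"
proof (induction n)
  case 0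
  then show ?case using circle_lift_id by (simp add: id_def)
next
  case (Suc n)
  then show ?case using circle_lift_compose[OF assms] by (simp only: funpow.simps)
qed

text \<open>The displacement has period 1, so \<open>x\<close> may be replaced by a point
  \<open>z\<close> with \<open>y \<le> z < y + 1\<close>. Then \<open>z - y\<close> and
  \<open>F z - F y\<close> both lie in the half-open unit interval.\<close>

lemma circle_lift_displacement_close:
  assumes "circle_lift f F"
  shows "\<bar>(F x - x) - (F y - y)\<bar> \<le> 1"
proof -
  define k where "k = \<lfloor>x - y\<rfloor>"
  define z where "z = x - of_int k"
  have z: "y \<le> z" "z < y + 1" unfolding z_def k_def by linarith+
  have "F x = F z + of_int k" using circle_lift_add_int[OF assms, of z k] by (simp add: z_def)
  moreover have "F y \<le> F z" "F z < F y + 1"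
    using z circle_liftD(1,3)[OF assms] by (metis strict_mono_less_eq, metis strict_mono_less)
  ultimately show ?thesis using z by (simp add: z_def)
qed

text \<open>Poincare's translation number. It belongs to a particular lift and changes by an integer
  with it; \<open>Rot\<close> is its class modulo 1.\<close>

definition translation_number :: "(real \<Rightarrow> real) \<Rightarrow> real"
  where "translation_number F = lim (\<lambda>n. (F ^^ n) 0 / real n)"

lemma tendsto_bounded_over_n:
  fixes a :: "nat \<Rightarrow> real"
  assumes "\<And>n. \<bar>a n\<bar> \<le> C"
  shows "(\<lambda>n. a n / real n) \<longlonglongrightarrow> 0"
proof (rule Lim_null_comparison)
  show "\<forall>\<^sub>F n in sequentially. norm (a n / real n) \<le> C / real n"
    using assms by (intro always_eventually allI) (simp add: divide_right_mono)
  show "(\<lambda>n. C / real n) \<longlonglongrightarrow> 0" by (rule lim_const_over_n)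
qed

lemma translation_number_tendsto:
  assumes "circle_lift f F"
  shows "(\<lambda>n. (F ^^ n) x / real n) \<longlonglongrightarrow> translation_number F"
proof -
  have "\<bar>(F ^^ (m + n)) 0 - (F ^^ m) 0 - (F ^^ n) 0\<bar> \<le> 1" for m n
    using circle_lift_displacement_close[OF circle_lift_funpow[OF assms, of m], of "(F ^^ n) 0" 0]
    by (simp add: funpow_add algebra_simps)
  then have "convergent (\<lambda>n. (F ^^ n) 0 / real n)" by (rule quasi_additive_convergent)
  then have lim: "(\<lambda>n. (F ^^ n) 0 / real n) \<longlonglongrightarrow> translation_number F"
    unfolding translation_number_def by (simp add: convergent_LIMSEQ_iff)
  have "\<bar>(F ^^ n) x - (F ^^ n) 0\<bar> \<le> 1 + \<bar>x\<bar>" for n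
    using circle_lift_displacement_close[OF circle_lift_funpow[OF assms, of n], of x 0] by simp
  then have "(\<lambda>n. ((F ^^ n) x - (F ^^ n) 0) / real n) \<longlonglongrightarrow> 0" by (rule tendsto_bounded_over_n)
  from tendsto_add[OF this lim] show ?thesis by (simp add: diff_divide_distrib)
qed

lemma translation_number_eqI:
  assumes "circle_lift f F" "(\<lambda>n. (F ^^ n) x / real n) \<longlonglongrightarrow> t"
  shows "translation_number F = t"
  using LIMSEQ_unique[OF translation_number_tendsto[OF assms(1)] assms(2)] .

lemma translation_number_shift:
  assumes F: "circle_lift f F"
  shows "translation_number (\<lambda>x. F x + of_int k) = translation_number F + of_int k"
proof (rule translation_number_eqI[OF circle_lift_shift[OF F]])
  have pow: "((\<lambda>x. F x + of_int k) ^^ n) x = (F ^^ n) x + real n * of_int k" for n x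
  proof (induction n)
    case (Suc n)
    then show ?case
      using circle_lift_add_int[OF F, of "(F ^^ n) x" "int n * k"] by (simp add: algebra_simps)
  qed simp
  have "(\<lambda>n. (F ^^ n) 0 / real n + of_int k) \<longlonglongrightarrow> translation_number F + of_int k"
    by (intro tendsto_add translation_number_tendsto[OF F] tendsto_const)
  moreover have "\<forall>\<^sub>F n in sequentially. (F ^^ n) 0 / real n + of_int k =
      ((\<lambda>x. F x + of_int k) ^^ n) 0 / real n"
    using eventually_gt_at_top[of 0] by eventually_elim (simp add: pow field_simps)
  ultimately show "(\<lambda>n. ((\<lambda>x. F x + of_int k) ^^ n) 0 / real n) \<longlonglongrightarrow> translation_number F + of_int k"
    by (rule Lim_transform_eventually)
qed

lemma Rot_eq_translation_number:
  assumes F: "circle_lift f F"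
  shows "Rot f = to_circle (translation_number F)"
proof -
  have "is_lift f (SOME F. is_lift f F)" by (rule someI[of "is_lift f"]) (rule circle_lift_imp_is_lift[OF F])
  then obtain k :: int where "(SOME F. is_lift f F) = (\<lambda>x. F x + of_int k)"
    using is_lift_eq_plus_int[OF F] by blast
  then have "Rot f = to_circle (translation_number (\<lambda>x. F x + of_int k))"
    by (simp add: Rot_def translation_number_def)
  then show ?thesis by (simp add: translation_number_shift[OF F] to_circle_plus)
qed

lemma Rot_fixed_point:
  assumes "f \<in> carrier Homeo_circle" "f p = p"
  shows "Rot f = 0"
proof -
  obtain x where x: "p = to_circle x" by (rule to_circle_cases)
  obtain F where F: "circle_lift f F" "F x = x"
    using obtain_fixing_lift[of f x] assms x by auto
  have "translation_number F = 0"
  proof (rule translation_number_eqI[OF F(1)])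
    show "(\<lambda>n. (F ^^ n) x / real n) \<longlonglongrightarrow> 0"
      using funpow_fixed[of F x, OF F(2)] lim_const_over_n by simp
  qed
  then show ?thesis using Rot_eq_translation_number[OF F(1)] by (simp add: zero_circle_def)
qed

lemma circle_lift_displacement_bounded_below:
  assumes F: "circle_lift f F" and nf: "\<And>x. F x \<noteq> x"
  obtains \<delta> where "\<delta> > 0" "\<And>x. \<delta> \<le> \<bar>F x - x\<bar>"
proof -
  have "continuous_on {0..1} (\<lambda>x. \<bar>F x - x\<bar>)"
    using strict_mono_surj_continuous[OF circle_liftD(1,2)[OF F]] by (intro continuous_intros)
  then obtain m where m: "\<forall>x\<in>{0..1}. \<bar>F m - m\<bar> \<le> \<bar>F x - x\<bar>"
    using continuous_attains_inf[of "{0..1::real}" "\<lambda>x. \<bar>F x - x\<bar>"] by auto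
  show ?thesis
  proof (rule that)
    show "0 < \<bar>F m - m\<bar>" using nf[of m] by simp
    fix x :: real
    have "F x = F (x - of_int \<lfloor>x\<rfloor>) + of_int \<lfloor>x\<rfloor>"
      using circle_lift_add_int[OF F, of "x - of_int \<lfloor>x\<rfloor>" "\<lfloor>x\<rfloor>"] by simp
    moreover have "x - of_int \<lfloor>x\<rfloor> \<in> {0..1}" by (simp, linarith)
    ultimately show "\<bar>F m - m\<bar> \<le> \<bar>F x - x\<bar>" using bspec[OF m, of "x - of_int \<lfloor>x\<rfloor>"] by (simp add: algebra_simps)
  qed
qed

text \<open>Some lift has translation number exactly 0. If it had no fixed point, its displacement
  would have constant sign and, by periodicity, be bounded away from 0; its orbits would then drift
  linearly.\<close>

lemma Rot_eq_0_imp_fixed_point: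
  assumes f: "f \<in> carrier Homeo_circle" and Rot: "Rot f = 0"
  obtains p where "f p = p"
proof -
  obtain F' where F': "circle_lift f F'" using f by (rule Homeo_circle_obtain_lift)
  then have "translation_number F' \<in> \<int>"
    using Rot Rot_eq_translation_number by (simp add: to_circle_eq_0_iff)
  then obtain k :: int where k: "translation_number F' = of_int k" by (auto elim: Ints_cases)
  define F where "F = (\<lambda>x. F' x + of_int (- k))"
  have F: "circle_lift f F" unfolding F_def by (rule circle_lift_shift[OF F'])
  have tn: "translation_number F = 0"
    unfolding F_def using translation_number_shift[OF F', of "- k"] k by simp
  note Fd = circle_liftD[OF F]
  have "\<exists>x. F x = x"
  proof (rule ccontr)
    assume "\<nexists>x. F x = x"
    then have nf: "F x \<noteq> x" for x by blast
    obtain \<delta> where \<delta>: "\<delta> > 0" "\<And>x. \<delta> \<le> \<bar>F x - x\<bar>"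
      by (rule circle_lift_displacement_bounded_below[OF F]) (use nf in auto)
    have lim: "(\<lambda>n. \<bar>(F ^^ n) 0 / real n\<bar>) \<longlonglongrightarrow> 0"
      using tendsto_rabs[OF translation_number_tendsto[OF F, of 0]] tn by simp
    have sgn: "(\<forall>x. x < F x) \<or> (\<forall>x. F x < x)"
    proof (rule ccontr)
      assume "\<not> ?thesis"
      then obtain x y where xy: "\<not> x < F x" "\<not> F y < y" by blast
      have "\<forall>z\<in>{min x y..max x y}. F z \<noteq> z" using nf by blast
      from no_fixed_point_cases[OF Fd(1,2) this] show False using xy by auto
    qed
    have "real n * \<delta> \<le> \<bar>(F ^^ n) 0\<bar>" for n
      using sgn
    proof
      assume up: "\<forall>x. x < F x"
      have "real n * \<delta> \<le> (F ^^ n) 0"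
      proof (induction n)
        case (Suc n)
        then show ?case using \<delta>(2)[of "(F ^^ n) 0"] up[rule_format, of "(F ^^ n) 0"]
          by (simp add: algebra_simps)
      qed simp
      then show ?thesis by linarith
    next
      assume down: "\<forall>x. F x < x"
      have "(F ^^ n) 0 \<le> - (real n * \<delta>)"
      proof (induction n)
        case (Suc n)
        then show ?case using \<delta>(2)[of "(F ^^ n) 0"] down[rule_format, of "(F ^^ n) 0"]
          by (simp add: algebra_simps)
      qed simp
      then show ?thesis by linarith
    qed
    then have "\<delta> \<le> \<bar>(F ^^ n) 0 / real n\<bar>" if "n > 0" for n
      using that by (simp add: field_simps)
    then have "\<forall>\<^sub>F n in sequentially. \<delta> \<le> \<bar>(F ^^ n) 0 / real n\<bar>"
      using eventually_gt_at_top[of 0] by (rule eventually_mono[rotated])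
    then have "\<delta> \<le> 0" using lim by (intro tendsto_lowerbound) auto
    then show False using \<delta>(1) by simp
  qed
  then obtain x where "F x = x" ..
  then show ?thesis using that[of "to_circle x"] Fd(4)[of x] by simp
qed

lemma Rot_eq_0_iff:
  "f \<in> carrier Homeo_circle \<Longrightarrow> Rot f = 0 \<longleftrightarrow> (\<exists>p. f p = p)"
  by (meson Rot_eq_0_imp_fixed_point Rot_fixed_point)

text \<open>The power of \<open>A \<circ> B\<close> is reached from \<open>A^n B^n\<close>, and
  leads to \<open>B^n A^n\<close>, by exchanging adjacent letters \<open>A B\<close> for
  \<open>B A\<close>. Each exchange moves the value in the direction of \<open>R\<close>, since
  \<open>A\<close> and \<open>B\<close> are monotone. \<open>R\<close> stands for either
  \<open>\<le>\<close> or \<open>\<ge>\<close>, according to which of the two products is smaller on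
  \<open>Y\<close>.\<close>

lemma Hoelder_sandwich:
  assumes R: "\<And>x. R x x" "\<And>x y z. R x y \<Longrightarrow> R y z \<Longrightarrow> R x z"
    and mono: "\<And>x y. R x y \<Longrightarrow> R (A x) (A y)" "\<And>x y. R x y \<Longrightarrow> R (B x) (B y)"
    and Y: "\<And>x. x \<in> Y \<Longrightarrow> A x \<in> Y" "\<And>x. x \<in> Y \<Longrightarrow> B x \<in> Y"
    and AB: "\<And>x. x \<in> Y \<Longrightarrow> R (A (B x)) (B (A x))"
    and x: "x \<in> Y"
  shows "R ((A ^^ n) ((B ^^ n) x)) (((A \<circ> B) ^^ n) x)" "R (((A \<circ> B) ^^ n) x) ((B ^^ n) ((A ^^ n) x))"
proof -
  have AnX: "(A ^^ n) y \<in> Y" and BnX: "(B ^^ n) y \<in> Y" if "y \<in> Y" for n y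
    by (induction n) (use that Y in auto)
  have monon: "R ((A ^^ n) y) ((A ^^ n) z)" "R ((B ^^ n) y) ((B ^^ n) z)" if "R y z" for n y z
    by (induction n) (use that mono in auto)
  have AnB: "R ((A ^^ n) (B y)) (B ((A ^^ n) y))" if "y \<in> Y" for n y
  proof (induction n)
    case (Suc n)
    from R(2)[OF mono(1)[OF Suc] AB[OF AnX[OF that]]] show ?case by simp
  qed (simp add: R)
  have ABn: "R (A ((B ^^ n) y)) ((B ^^ n) (A y))" if "y \<in> Y" for n y
  proof (induction n)
    case (Suc n)
    from R(2)[OF AB[OF BnX[OF that]] mono(2)[OF Suc]] show ?case by simp
  qed (simp add: R)
  show "R ((A ^^ n) ((B ^^ n) x)) (((A \<circ> B) ^^ n) x)"
  proof (induction n)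
    case (Suc n)
    have "R (A ((A ^^ n) (B ((B ^^ n) x)))) (A (B ((A ^^ n) ((B ^^ n) x))))"
      by (rule mono(1)[OF AnB[OF BnX[OF x]]])
    moreover have "R (A (B ((A ^^ n) ((B ^^ n) x)))) (A (B (((A \<circ> B) ^^ n) x)))"
      by (rule mono(1)[OF mono(2)[OF Suc]])
    ultimately show ?case unfolding funpow.simps comp_apply by (rule R(2))
  qed (simp add: R)
  show "R (((A \<circ> B) ^^ n) x) ((B ^^ n) ((A ^^ n) x))"
  proof (induction n)
    case (Suc n)
    have "R (A (B (((A \<circ> B) ^^ n) x))) (A (B ((B ^^ n) ((A ^^ n) x))))"
      by (rule mono(1)[OF mono(2)[OF Suc]])
    moreover have "R (A ((B ^^ Suc n) ((A ^^ n) x))) ((B ^^ Suc n) (A ((A ^^ n) x)))"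
      by (rule ABn[OF AnX[OF x]])
    ultimately show ?case unfolding funpow.simps comp_apply by (rule R(2))
  qed (simp add: R)
qed

definition common_fixed_lifts :: "(circle \<Rightarrow> circle) set \<Rightarrow> real set"
  where "common_fixed_lifts G = {x. \<forall>f\<in>G. (\<exists>q. f q = q) \<longrightarrow> f (to_circle x) = to_circle x}"

text \<open>Conjugation by an element of \<open>G\<close> permutes the elements of \<open>G\<close>
  that have fixed points.\<close>

lemma common_fixed_lifts_invariant:
  assumes G: "subgroup G Homeo_circle" and f: "f \<in> G" "circle_lift f F"
    and x: "x \<in> common_fixed_lifts G"
  shows "F x \<in> common_fixed_lifts G"
  unfolding common_fixed_lifts_def
proof (intro CollectI ballI impI)
  note Gd = Homeo_subgroupD[OF G]
  have ff: "f (finv f y) = y" for y using Gd(5)[OF f(1)] by (simp add: bij_is_surj surj_f_inv_f)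
  have ff': "finv f (f y) = y" for y using Gd(5)[OF f(1)] by (simp add: bij_is_inj)
  fix h assume h: "h \<in> G" "\<exists>q. h q = q"
  then obtain q where q: "h q = q" by blast
  have "finv f \<circ> h \<circ> f \<in> G" using Gd(3,4) f(1) h(1) by blast
  moreover have "(finv f \<circ> h \<circ> f) (finv f q) = finv f q" by (simp add: ff q)
  ultimately have "(finv f \<circ> h \<circ> f) (to_circle x) = to_circle x"
    using x unfolding common_fixed_lifts_def by blast
  then have "h (f (to_circle x)) = f (to_circle x)" by (metis comp_apply ff)
  then show "h (to_circle (F x)) = to_circle (F x)" by (simp add: circle_liftD(4)[OF f(2)])
qed

text \<open>If \<open>A\<close> and \<open>B\<close> compared differently at two points,
  \<open>finv A \<circ> B\<close> would have a fixed point by the intermediate value theorem. The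
  circle map lifted by it would then fix every common fixed point, a contradiction at
  \<open>y\<close>. This substitutes for the freeness of the action in Hoelder's argument.\<close>

lemma common_fixed_lifts_order:
  assumes G: "subgroup G Homeo_circle" and ab: "a \<in> G" "b \<in> G" "circle_lift a A" "circle_lift b B"
    and xy: "x \<in> common_fixed_lifts G" "y \<in> common_fixed_lifts G" "A x \<le> B x"
  shows "A y \<le> B y"
proof (rule ccontr)
  note Gd = Homeo_subgroupD[OF G]
  note Ad = circle_liftD[OF ab(3)]
  assume "\<not> A y \<le> B y"
  define C where "C = finv A \<circ> B"
  have AC: "A (C z) = B z" for z using Ad(2) by (simp add: C_def surj_f_inv_f)
  have C: "circle_lift (finv a \<circ> b) C"
    unfolding C_def by (intro circle_lift_compose circle_lift_inv ab Gd(5))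
  note Cd = circle_liftD[OF C]
  have "A x \<le> A (C x)" "A (C y) < A y" using AC xy(3) \<open>\<not> A y \<le> B y\<close> by auto
  then have C_le: "x \<le> C x" "C y < y"
    by (simp_all add: strict_mono_less_eq[OF Ad(1)] strict_mono_less[OF Ad(1)])
  have "\<exists>z. C z = z"
  proof (rule ccontr)
    assume "\<nexists>z. C z = z"
    then have "\<forall>z\<in>{min x y..max x y}. C z \<noteq> z" by blast
    from no_fixed_point_cases[OF Cd(1,2) this] show False
    proof
      assume "\<forall>z\<in>{min x y..max x y}. z < C z"
      then show False using C_le(2) by (auto dest: bspec[of _ _ y])
    next
      assume "\<forall>z\<in>{min x y..max x y}. C z < z"
      then show False using C_le(1) by (auto dest: bspec[of _ _ x])
    qed
  qed
  then obtain z where z: "C z = z" ..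
  then have "(finv a \<circ> b) (to_circle z) = to_circle z" using Cd(4) by metis
  moreover have "finv a \<circ> b \<in> G" using Gd(3,4) ab by blast
  ultimately have "(finv a \<circ> b) (to_circle y) = to_circle y"
    using xy(2) unfolding common_fixed_lifts_def by blast
  then have "C y = y" using circle_lift_fixed_iff[OF C z] by simp
  then show False using C_le(2) by simp
qed

text \<open>The orbit of \<open>x0\<close> under \<open>A \<circ> B\<close> is caught between
  \<open>A^n B^n x0\<close> and \<open>B^n A^n x0\<close>. Both differ from
  \<open>A^n x0 + B^n x0\<close> by an amount bounded independently of \<open>n\<close>, which
  disappears after division by \<open>n\<close>.\<close>

theorem Rot_comp:
  assumes G: "subgroup G Homeo_circle"
    and p: "\<And>f. f \<in> G \<Longrightarrow> \<exists>q. f q = q \<Longrightarrow> f p = p"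
    and ab: "a \<in> G" "b \<in> G"
  shows "Rot (a \<circ> b) = Rot a + Rot b"
proof -
  note Gd = Homeo_subgroupD[OF G]
  obtain A where A: "circle_lift a A" using Gd(1)[OF ab(1)] by (rule Homeo_circle_obtain_lift)
  obtain B where B: "circle_lift b B" using Gd(1)[OF ab(2)] by (rule Homeo_circle_obtain_lift)
  note AB = circle_lift_compose[OF A B] and BA = circle_lift_compose[OF B A]
  define Y where "Y = common_fixed_lifts G"
  obtain x0 where "p = to_circle x0" by (rule to_circle_cases)
  then have x0: "x0 \<in> Y" using p by (auto simp: Y_def common_fixed_lifts_def)
  have XA: "A x \<in> Y" and XB: "B x \<in> Y" if "x \<in> Y" for x
    using common_fixed_lifts_invariant[OF G] ab A B that by (auto simp: Y_def)
  have mono: "A x \<le> A y" "B x \<le> B y" if "x \<le> y" for x y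
    using that circle_liftD(1)[OF A] circle_liftD(1)[OF B] by (simp_all add: strict_mono_less_eq)
  have bound: "\<bar>((A \<circ> B) ^^ n) x0 - (A ^^ n) x0 - (B ^^ n) x0\<bar> \<le> 1 + \<bar>x0\<bar>" for n
  proof -
    have AnBn: "\<bar>(A ^^ n) ((B ^^ n) x0) - (B ^^ n) x0 - ((A ^^ n) x0 - x0)\<bar> \<le> 1"
      by (rule circle_lift_displacement_close[OF circle_lift_funpow[OF A]])
    have BnAn: "\<bar>(B ^^ n) ((A ^^ n) x0) - (A ^^ n) x0 - ((B ^^ n) x0 - x0)\<bar> \<le> 1"
      by (rule circle_lift_displacement_close[OF circle_lift_funpow[OF B]])
    show ?thesis
    proof (cases "A (B x0) \<le> B (A x0)")
      case True
      then have le: "A (B x) \<le> B (A x)" if "x \<in> Y" for x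
        using common_fixed_lifts_order[OF G Gd(3)[OF ab] Gd(3)[OF ab(2,1)] AB BA, of x0 x] x0 that
        by (simp add: Y_def)
      have "(A ^^ n) ((B ^^ n) x0) \<le> ((A \<circ> B) ^^ n) x0" "((A \<circ> B) ^^ n) x0 \<le> (B ^^ n) ((A ^^ n) x0)"
        by (rule Hoelder_sandwich[where R = "(\<le>)" and Y = Y]; use mono XA XB le x0 in auto)+
      then show ?thesis using AnBn BnAn by linarith
    next
      case False
      then have ge: "A (B x) \<ge> B (A x)" if "x \<in> Y" for x
        using common_fixed_lifts_order[OF G Gd(3)[OF ab(2,1)] Gd(3)[OF ab] BA AB, of x0 x] x0 that
        by (simp add: Y_def)
      have "((A \<circ> B) ^^ n) x0 \<le> (A ^^ n) ((B ^^ n) x0)" "(B ^^ n) ((A ^^ n) x0) \<le> ((A \<circ> B) ^^ n) x0"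
        by (rule Hoelder_sandwich[where R = "(\<ge>)" and Y = Y]; use mono XA XB ge x0 in auto)+
      then show ?thesis using AnBn BnAn by linarith
    qed
  qed
  have "translation_number (A \<circ> B) = translation_number A + translation_number B"
  proof (rule translation_number_eqI[OF AB])
    have "(\<lambda>n. (((A \<circ> B) ^^ n) x0 - (A ^^ n) x0 - (B ^^ n) x0) / real n) \<longlonglongrightarrow> 0"
      using bound by (rule tendsto_bounded_over_n)
    from tendsto_add[OF tendsto_add[OF this translation_number_tendsto[OF A, of x0]] translation_number_tendsto[OF B, of x0]]
    show "(\<lambda>n. ((A \<circ> B) ^^ n) x0 / real n) \<longlonglongrightarrow> translation_number A + translation_number B"
      by (simp add: diff_divide_distrib)
  qed
  then show ?thesis
    by (simp add: Rot_eq_translation_number[OF AB] Rot_eq_translation_number[OF A]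
        Rot_eq_translation_number[OF B] to_circle_plus)
qed


section \<open>Components of the complement of the fixed point set\<close>

text \<open>\<open>nontrivial\<close> ensures that \<open>Fx\<close> is not the whole circle.
  Without a component in its complement, the elements of \<open>T\<close> could not be told apart by
  their action on components.\<close>

locale circle_group_kernel =
  fixes G :: "(circle \<Rightarrow> circle) set"
  assumes G: "subgroup G Homeo_circle"
    and common: "\<exists>p. \<forall>f\<in>G. (\<exists>q. f q = q) \<longrightarrow> f p = p"
    and nontrivial: "\<exists>f\<in>G. (\<exists>q. f q = q) \<and> f \<noteq> id"
begin

lemmas G_simps = Homeo_subgroupD[OF G]

lemma finv_apply [simp]: "f \<in> G \<Longrightarrow> f (finv f p) = p" "f \<in> G \<Longrightarrow> finv f (f p) = p"
  using G_simps(5)[of f] by (simp_all add: bij_is_surj surj_f_inv_f bij_is_inj)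

lemma Rot_comp_G: "a \<in> G \<Longrightarrow> b \<in> G \<Longrightarrow> Rot (a \<circ> b) = Rot a + Rot b"
  using common Rot_comp[OF G] by blast

lemma Rot_id [simp]: "Rot id = 0"
  using Rot_fixed_point[of id undefined] G_simps(1,2) by simp

lemma Rot_finv: "a \<in> G \<Longrightarrow> Rot (finv a) = - Rot a"
proof -
  assume a: "a \<in> G"
  have "finv a \<circ> a = id" using a by (simp add: fun_eq_iff)
  then have "Rot (finv a) + Rot a = 0" using Rot_comp_G[OF G_simps(4)[OF a] a] by simp
  then show ?thesis by (simp add: eq_neg_iff_add_eq_0)
qed

definition ker :: "(circle \<Rightarrow> circle) set"
  where "ker = {f \<in> G. Rot f = 0}"

lemma ker_iff: "f \<in> ker \<longleftrightarrow> f \<in> G \<and> (\<exists>q. f q = q)"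
  using G_simps(1) Rot_eq_0_iff by (auto simp: ker_def)

lemma ker_comp: "f \<in> ker \<Longrightarrow> g \<in> ker \<Longrightarrow> f \<circ> g \<in> ker"
  using Rot_comp_G G_simps(3) by (simp add: ker_def)

lemma ker_finv: "f \<in> ker \<Longrightarrow> finv f \<in> ker"
  using Rot_finv G_simps(4) by (simp add: ker_def)

lemma id_in_ker: "id \<in> ker"
  using G_simps(2) by (simp add: ker_def)

lemma subgroup_ker: "subgroup ker Homeo_circle"
  using ker_comp ker_finv id_in_ker G_simps(1)
  by unfold_locales (auto simp: ker_def Homeo_circle_m_inv)

lemma coset_ker: "f \<in> G \<Longrightarrow> g \<in> G \<Longrightarrow> Rot f = Rot g \<Longrightarrow> finv f \<circ> g \<in> ker"
  using Rot_comp_G G_simps(3,4) Rot_finv by (simp add: ker_def)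

definition Fx :: "circle set"
  where "Fx = {p. \<forall>f\<in>ker. f p = p}"

definition Y :: "real set"
  where "Y = {x. to_circle x \<in> Fx}"

lemma Y_eq: "Y = common_fixed_lifts G"
  by (auto simp: Y_def Fx_def common_fixed_lifts_def ker_iff)

lemma Y_add_int: "x + of_int n \<in> Y \<longleftrightarrow> x \<in> Y"
  by (simp add: Y_def to_circle_plus)

lemma Y_lift: "f \<in> G \<Longrightarrow> circle_lift f F \<Longrightarrow> F x \<in> Y \<longleftrightarrow> x \<in> Y"
proof
  assume f: "f \<in> G" "circle_lift f F"
  then show "F x \<in> Y" if "x \<in> Y" using common_fixed_lifts_invariant[OF G] that by (simp add: Y_eq)
  show "x \<in> Y" if "F x \<in> Y"
  proof -
    have "finv F (F x) \<in> Y"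
      using common_fixed_lifts_invariant[OF G G_simps(4)[OF f(1)] circle_lift_inv[OF f(2) G_simps(5)[OF f(1)]]] that
      by (simp add: Y_eq)
    then show ?thesis using circle_liftD(5)[OF f(2)] by (simp add: bij_is_inj)
  qed
qed

lemma Fx_invariant [simp]: "f \<in> G \<Longrightarrow> f p \<in> Fx \<longleftrightarrow> p \<in> Fx"
proof -
  assume f: "f \<in> G"
  obtain F where F: "circle_lift f F" using Homeo_circle_obtain_lift[OF G_simps(1)[OF f]] .
  obtain x where x: "p = to_circle x" by (rule to_circle_cases)
  show ?thesis using Y_lift[OF f F, of x] circle_liftD(4)[OF F, of x] by (simp add: Y_def x)
qed

lemma Y_nonempty: obtains y where "y \<in> Y"
proof -
  obtain p where "\<forall>f\<in>G. (\<exists>q. f q = q) \<longrightarrow> f p = p" using common by blast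
  then have "p \<in> Fx" unfolding Fx_def using ker_iff by blast
  moreover obtain y where "p = to_circle y" by (rule to_circle_cases)
  ultimately show ?thesis using that by (simp add: Y_def)
qed

lemma ker_fixing_lift:
  assumes "f \<in> ker"
  obtains F where "circle_lift f F" "\<And>y. y \<in> Y \<Longrightarrow> F y = y"
proof -
  obtain y0 where y0: "y0 \<in> Y" by (rule Y_nonempty)
  then obtain F where F: "circle_lift f F" "F y0 = y0"
    using obtain_fixing_lift[of f y0] assms G_simps(1) by (auto simp: Y_def Fx_def ker_def)
  have "F y = y" if "y \<in> Y" for y
    using circle_lift_fixed_iff[OF F] that assms by (simp add: Y_def Fx_def)
  then show ?thesis using that F(1) by blast
qed

lemma closed_Y: "closed Y"
proof -
  have "closed {x. f (to_circle x) = to_circle x}" if "f \<in> ker" for f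
  proof -
    obtain y0 where y0: "y0 \<in> Y" by (rule Y_nonempty)
    obtain F where F: "circle_lift f F" "\<And>y. y \<in> Y \<Longrightarrow> F y = y" using ker_fixing_lift[OF \<open>f \<in> ker\<close>] by blast
    have "{x. f (to_circle x) = to_circle x} = - {x. F x \<noteq> x}"
      using circle_lift_fixed_iff[OF F(1) F(2)[OF y0]] by auto
    then show ?thesis using open_not_fixed[OF circle_liftD(1,2)[OF F(1)]] by (simp add: closed_Compl)
  qed
  then have "closed (\<Inter>f\<in>ker. {x. f (to_circle x) = to_circle x})" by blast
  moreover have "(\<Inter>f\<in>ker. {x. f (to_circle x) = to_circle x}) = Y" by (auto simp: Y_def Fx_def)
  ultimately show ?thesis by simp
qed

text \<open>Two points are near iff they lie in the same component of the complement of \<open>Fx\<close>.\<close>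

definition near :: "circle \<Rightarrow> circle \<Rightarrow> bool"
  where "near p q \<longleftrightarrow> (\<exists>x y. p = to_circle x \<and> q = to_circle y \<and> {min x y..max x y} \<inter> Y = {})"

lemma near_not_Fx: "near p q \<Longrightarrow> p \<notin> Fx" "near p q \<Longrightarrow> q \<notin> Fx"
proof -
  assume "near p q"
  then obtain x y where xy: "p = to_circle x" "q = to_circle y" "{min x y..max x y} \<inter> Y = {}"
    by (auto simp: near_def)
  moreover have "x \<in> {min x y..max x y}" "y \<in> {min x y..max x y}" by auto
  ultimately have "x \<notin> Y" "y \<notin> Y" by blast+
  then show "p \<notin> Fx" "q \<notin> Fx" using xy by (simp_all add: Y_def)
qed

lemma near_refl: "p \<notin> Fx \<Longrightarrow> near p p"
proof -
  assume p: "p \<notin> Fx"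
  obtain x where "p = to_circle x" by (rule to_circle_cases)
  then show ?thesis using p by (auto simp: near_def Y_def intro!: exI[of _ x])
qed

lemma near_sym: "near p q \<Longrightarrow> near q p"
  unfolding near_def by (metis max.commute min.commute)

lemma near_trans:
  assumes "near p q" "near q s"
  shows "near p s"
proof -
  obtain x y where xy: "p = to_circle x" "q = to_circle y" "{min x y..max x y} \<inter> Y = {}"
    using assms(1) by (auto simp: near_def)
  obtain y' z where yz: "q = to_circle y'" "s = to_circle z" "{min y' z..max y' z} \<inter> Y = {}"
    using assms(2) by (auto simp: near_def)
  obtain n :: int where n: "y = y' + of_int n"
    using xy(2) yz(1) to_circle_eq_iff[of y y'] by (metis Ints_cases add.commute diff_add_cancel)
  have "s = to_circle (z + of_int n)" using yz(2) by (simp add: to_circle_plus)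
  moreover have "w \<notin> Y" if w: "w \<in> {min x (z + of_int n)..max x (z + of_int n)}" for w
  proof (cases "w \<in> {min x y..max x y}")
    case False
    then have "w + of_int (- n) \<in> {min y' z..max y' z}" using w n by (auto simp: min_def max_def split: if_splits)
    then have "w + of_int (- n) \<notin> Y" using yz(3) by blast
    then show ?thesis using Y_add_int[of w "- n"] by simp
  qed (use xy(3) in blast)
  ultimately show ?thesis using xy(1) unfolding near_def by blast
qed

lemma near_image:
  assumes f: "f \<in> G" and "near p q"
  shows "near (f p) (f q)"
proof -
  obtain F where F: "circle_lift f F" using Homeo_circle_obtain_lift[OF G_simps(1)[OF f]] .
  note Fd = circle_liftD[OF F]
  obtain x y where xy: "p = to_circle x" "q = to_circle y" "{min x y..max x y} \<inter> Y = {}"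
    using assms(2) by (auto simp: near_def)
  have "w \<notin> Y" if w: "w \<in> {min (F x) (F y)..max (F x) (F y)}" for w
  proof -
    obtain v where v: "w = F v" using Fd(2) by (metis surjD)
    then have "v \<in> {min x y..max x y}"
      using w strict_mono_less_eq[OF Fd(1)] by (auto simp: min_def max_def split: if_splits)
    then have "v \<notin> Y" using xy(3) by blast
    then show ?thesis using Y_lift[OF f F] v by simp
  qed
  moreover have "f p = to_circle (F x)" "f q = to_circle (F y)" using xy Fd(4) by simp_all
  ultimately show ?thesis unfolding near_def by blast
qed

text \<open>An increasing lift that fixes \<open>Y\<close> pointwise cannot carry a point across a
  point of \<open>Y\<close>.\<close>

lemma ker_near:
  assumes f: "f \<in> ker" and p: "p \<notin> Fx"
  shows "near p (f p)"
proof -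
  obtain F where F: "circle_lift f F" "\<And>y. y \<in> Y \<Longrightarrow> F y = y" using ker_fixing_lift[OF f] by blast
  obtain x where x: "p = to_circle x" by (rule to_circle_cases)
  have "w \<notin> Y" if w: "w \<in> {min x (F x)..max x (F x)}" for w
  proof
    assume "w \<in> Y"
    then have "F w = w" by (rule F(2))
    moreover have "w \<noteq> x" using \<open>w \<in> Y\<close> x p by (auto simp: Y_def)
    ultimately show False
      using w strict_mono_less[OF circle_liftD(1)[OF F(1)], of x w] strict_mono_less[OF circle_liftD(1)[OF F(1)], of w x]
      by (auto simp: min_def max_def split: if_splits)
  qed
  moreover have "f p = to_circle (F x)" using x circle_liftD(4)[OF F(1)] by simp
  ultimately show ?thesis using x unfolding near_def by blast
qed

text \<open>The first point \<open>z\<close> of \<open>Y\<close> to the right of \<open>x\<close> is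
  also the first to the right of \<open>F x\<close>. Since \<open>F\<close> permutes
  \<open>Y\<close> and preserves the order, it fixes \<open>z\<close>.\<close>

lemma lift_gap_fixed_point:
  assumes g: "g \<in> G" and F: "circle_lift g F" and x: "x \<le> F x" "{x..F x} \<inter> Y = {}"
  shows "\<exists>q. g q = q"
proof -
  note Fd = circle_liftD[OF F]
  define S where "S = Y \<inter> {x..}"
  define z where "z = Inf S"
  have "closed S" unfolding S_def using closed_Y by (intro closed_Int closed_atLeast)
  moreover have "S \<noteq> {}"
  proof -
    obtain y where y: "y \<in> Y" by (rule Y_nonempty)
    have "y + of_int \<lceil>x - y\<rceil> \<in> S" using y Y_add_int by (simp add: S_def) linarith
    then show ?thesis by blast
  qed
  moreover have bdd: "bdd_below S" by (auto simp: S_def)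
  ultimately have "z \<in> S" unfolding z_def by (intro closed_contains_Inf)
  then have z: "z \<in> Y" "x \<le> z" by (auto simp: S_def)
  have least: "z \<le> w" if "w \<in> Y" "x \<le> w" for w
    unfolding z_def using that bdd by (intro cInf_lower) (auto simp: S_def)
  have "F x < z" using x z by (metis IntI atLeastAtMost_iff empty_iff not_le)
  have "z \<le> F z"
    using least[of "F z"] Y_lift[OF g F] z x(1) strict_mono_less_eq[OF Fd(1), of x z] by auto
  have Fz: "F (finv F z) = z" using Fd(2) by (simp add: surj_f_inv_f)
  have "x \<le> finv F z" using \<open>F x < z\<close> strict_mono_less_eq[OF Fd(1), of x "finv F z"] Fz by simp
  then have "z \<le> finv F z" using least Y_lift[OF g F, of "finv F z"] z(1) Fz by simp
  then have "F z \<le> z" using strict_mono_less_eq[OF Fd(1), of z "finv F z"] Fz by simp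
  then have "F z = z" using \<open>z \<le> F z\<close> by simp
  then have "g (to_circle z) = to_circle z" using Fd(4)[of z] by simp
  then show ?thesis by blast
qed

text \<open>This is the freeness of the action on components: an element carrying a component to
  itself fixes its end points.\<close>

lemma near_imp_ker:
  assumes g: "g \<in> G" and "near p (g p)"
  shows "g \<in> ker"
proof -
  obtain x y where xy: "p = to_circle x" "g p = to_circle y" "{min x y..max x y} \<inter> Y = {}"
    using assms(2) by (auto simp: near_def)
  obtain F' where F': "circle_lift g F'" using Homeo_circle_obtain_lift[OF G_simps(1)[OF g]] .
  have "to_circle (F' x) = to_circle y" using circle_liftD(4)[OF F', of x] xy by simp
  then obtain n :: int where n: "y = F' x + of_int n"
    using to_circle_eq_iff[of y "F' x"] by (metis Ints_cases add.commute diff_add_cancel)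
  define F where "F = (\<lambda>x. F' x + of_int n)"
  have F: "circle_lift g F" unfolding F_def by (rule circle_lift_shift[OF F'])
  have y: "y = F x" by (simp add: F_def n)
  have "\<exists>q. g q = q"
  proof (cases "x \<le> y")
    case True
    then show ?thesis using lift_gap_fixed_point[OF g F, of x] xy(3) y by simp
  next
    case False
    have "finv F y = x" using circle_liftD(5)[OF F] y by (simp add: bij_is_inj)
    then obtain q where "finv g q = q"
      using lift_gap_fixed_point[OF G_simps(4)[OF g] circle_lift_inv[OF F G_simps(5)[OF g]], of y] xy(3) False
      by (auto simp: min_def max_def)
    then have "g q = q" using finv_apply(1)[OF g, of q] by simp
    then show ?thesis ..
  qed
  then show ?thesis using g by (simp add: ker_iff)
qed

section \<open>The rotation group \<open>T\<close> and the indexing of the components\<close>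

definition T :: "circle set"
  where "T = Rot ` G"

text \<open>The value \<open>id\<close> at 0 gives \<open>r 0 d = d\<close>, so the fundamental
  domain itself is the slice of index 0.\<close>

definition r :: "circle \<Rightarrow> circle \<Rightarrow> circle"
  where "r t = (if t = 0 then id else SOME g. g \<in> G \<and> Rot g = t)"

lemma r_0 [simp]: "r 0 = id" by (simp add: r_def)

lemma r_T: "t \<in> T \<Longrightarrow> r t \<in> G" "t \<in> T \<Longrightarrow> Rot (r t) = t"
proof -
  assume "t \<in> T"
  then have "\<exists>g. g \<in> G \<and> Rot g = t" by (auto simp: T_def)
  from someI_ex[OF this] have "r t \<in> G \<and> Rot (r t) = t" using G_simps(2) by (simp add: r_def)
  then show "r t \<in> G" "Rot (r t) = t" by auto
qed

lemma T_closed: "0 \<in> T" "s \<in> T \<Longrightarrow> t \<in> T \<Longrightarrow> s + t \<in> T" "s \<in> T \<Longrightarrow> - s \<in> T" "s \<in> T \<Longrightarrow> t \<in> T \<Longrightarrow> s - t \<in> T"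
  "g \<in> G \<Longrightarrow> Rot g \<in> T"
proof -
  show zero: "0 \<in> T" using G_simps(2) by (auto simp: T_def intro!: image_eqI[of _ _ id])
  show add: "s + t \<in> T" if "s \<in> T" "t \<in> T" for s t
    using that Rot_comp_G[of "r s" "r t"] r_T G_simps(3)[of "r s" "r t"]
    by (auto simp: T_def intro!: image_eqI[of _ _ "r s \<circ> r t"])
  show neg: "- s \<in> T" if "s \<in> T" for s
    using that Rot_finv[of "r s"] r_T G_simps(4)[of "r s"]
    by (auto simp: T_def intro!: image_eqI[of _ _ "finv (r s)"])
  show "s \<in> T \<Longrightarrow> t \<in> T \<Longrightarrow> s - t \<in> T" using add[of s "- t"] neg[of t] by simp
  show "g \<in> G \<Longrightarrow> Rot g \<in> T" by (simp add: T_def)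
qed

definition orb :: "circle \<Rightarrow> circle \<Rightarrow> bool"
  where "orb p q \<longleftrightarrow> (\<exists>g\<in>G. near (g p) q)"

lemma orb_sym: "orb p q \<Longrightarrow> orb q p"
  unfolding orb_def by (metis G_simps(4) finv_apply(2) near_image near_sym)

lemma orb_trans:
  assumes "orb p q" "orb q s"
  shows "orb p s"
proof -
  obtain g h where gh: "g \<in> G" "near (g p) q" "h \<in> G" "near (h q) s"
    using assms by (auto simp: orb_def)
  have "near ((h \<circ> g) p) s" using near_trans[OF near_image[OF gh(3,2)] gh(4)] by simp
  then show ?thesis unfolding orb_def using G_simps(3)[OF gh(3,1)] by blast
qed

definition orb_rep :: "circle \<Rightarrow> circle"
  where "orb_rep p = (SOME c. orb p c)"

text \<open>The choice depends only on the predicate \<open>orb p\<close>, which is the same for all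
  points of a class.\<close>

lemma orb_rep_eq: "orb p q \<Longrightarrow> orb_rep p = orb_rep q"
proof -
  assume "orb p q"
  then have "orb p = orb q" using orb_sym orb_trans by blast
  then show ?thesis by (simp add: orb_rep_def)
qed

lemma orb_orb_rep: "p \<notin> Fx \<Longrightarrow> orb p (orb_rep p)"
proof -
  assume "p \<notin> Fx"
  then have "orb p p" unfolding orb_def using near_refl G_simps(2) by (intro bexI[of _ id]) simp_all
  then show ?thesis unfolding orb_rep_def by (rule someI)
qed

text \<open>
  The index in \<open>T\<close> of the component of \<open>p\<close>, relative to the chosen component of its \<open>G\<close>-orbit.
\<close>

definition tau :: "circle \<Rightarrow> circle"
  where "tau p = (SOME t. \<exists>g\<in>G. Rot g = t \<and> near (g (orb_rep p)) p)"

text \<open>Two elements carrying \<open>orb_rep p\<close> into the component of \<open>p\<close>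
  differ by one that preserves the component of \<open>orb_rep p\<close>. That one lies in
  \<open>ker\<close>, so the two have the same rotation number.\<close>

lemma tau_eqI:
  assumes g: "g \<in> G" "near (g (orb_rep p)) p"
  shows "tau p = Rot g"
proof -
  have "\<exists>t. \<exists>g\<in>G. Rot g = t \<and> near (g (orb_rep p)) p" using g by blast
  from someI_ex[OF this] obtain h where h: "h \<in> G" "Rot h = tau p" "near (h (orb_rep p)) p"
    unfolding tau_def by blast
  let ?c = "orb_rep p"
  have "near (g ?c) (h ?c)" using near_trans[OF g(2) near_sym[OF h(3)]] .
  from near_image[OF G_simps(4)[OF g(1)] this] have "near ?c ((finv g \<circ> h) ?c)" using g(1) by simp
  then have "finv g \<circ> h \<in> ker" using near_imp_ker G_simps(3,4) g(1) h(1) by blast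
  then have "- Rot g + Rot h = 0"
    using Rot_comp_G[OF G_simps(4)[OF g(1)] h(1)] Rot_finv[OF g(1)] by (simp add: ker_def)
  then show ?thesis using h(2) by (simp add: add_eq_0_iff)
qed

lemma tau_image:
  assumes g: "g \<in> G" and p: "p \<notin> Fx"
  shows "tau (g p) = Rot g + tau p"
proof -
  have "orb (orb_rep p) p" using orb_sym[OF orb_orb_rep[OF p]] .
  then obtain h where h: "h \<in> G" "near (h (orb_rep p)) p" by (auto simp: orb_def)
  have "orb p (g p)" unfolding orb_def using near_refl[of "g p"] g p by (intro bexI[of _ g]) simp_all
  then have "orb_rep (g p) = orb_rep p" using orb_rep_eq by simp
  then have "near ((g \<circ> h) (orb_rep (g p))) (g p)" using near_image[OF g h(2)] by simp
  then have "tau (g p) = Rot (g \<circ> h)" using tau_eqI G_simps(3) g h(1) by blast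
  then show ?thesis using tau_eqI[OF h] Rot_comp_G[OF g h(1)] by simp
qed

lemma tau_T: "p \<notin> Fx \<Longrightarrow> tau p \<in> T"
proof -
  assume p: "p \<notin> Fx"
  then obtain h where "h \<in> G" "near (h (orb_rep p)) p"
    using orb_sym[OF orb_orb_rep[OF p]] by (auto simp: orb_def)
  then show ?thesis using tau_eqI T_closed(5) by simp
qed

lemma tau_near:
  assumes "near p q"
  shows "tau p = tau q"
proof -
  have p: "p \<notin> Fx" using near_not_Fx(1)[OF assms] .
  then obtain h where h: "h \<in> G" "near (h (orb_rep p)) p"
    using orb_sym[OF orb_orb_rep[OF p]] by (auto simp: orb_def)
  have "orb p q" unfolding orb_def using assms G_simps(2) by (intro bexI[of _ id]) simp_all
  then have "orb_rep q = orb_rep p" using orb_rep_eq by simp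
  then show ?thesis using tau_eqI[OF h] tau_eqI[OF h(1), of q] near_trans[OF h(2) assms] by simp
qed

text \<open>Each element of the coset has a lift that agrees with \<open>F0\<close> on
  \<open>Y\<close>, and these lifts are pasted. Points of the line without a point of
  \<open>Y\<close> between them are moved by the same lift; all others are separated by a point of
  \<open>Y\<close>, where the lifts agree.\<close>

lemma patch_Homeo:
  assumes g0: "g0 \<in> G" and s: "\<And>p. s p \<in> G" "\<And>p. Rot (s p) = Rot g0"
    and near: "\<And>p q. near p q \<Longrightarrow> s p = s q"
  shows "(\<lambda>p. s p p) \<in> carrier Homeo_circle"
proof -
  obtain F0 where F0: "circle_lift g0 F0" using Homeo_circle_obtain_lift[OF G_simps(1)[OF g0]] .
  note F0d = circle_liftD[OF F0]
  have F0c: "F0 (finv F0 y) = y" "finv F0 (F0 y) = y" for y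
    using F0d(2,5) by (simp_all add: surj_f_inv_f bij_is_inj)
  have "\<exists>F. circle_lift f F \<and> (\<forall>y\<in>Y. F y = F0 y)" if f: "f \<in> G" "Rot f = Rot g0" for f
  proof -
    obtain H where H: "circle_lift (finv g0 \<circ> f) H" "\<And>y. y \<in> Y \<Longrightarrow> H y = y"
      by (rule ker_fixing_lift[OF coset_ker[OF g0 f(1)]]) (use f in auto)
    have "g0 \<circ> (finv g0 \<circ> f) = f" using g0 by (simp add: fun_eq_iff)
    then have "circle_lift f (F0 \<circ> H)" using circle_lift_compose[OF F0 H(1)] by simp
    then show ?thesis using H(2) by (intro exI[of _ "F0 \<circ> H"]) simp
  qed
  then obtain L where L: "\<And>f. f \<in> G \<Longrightarrow> Rot f = Rot g0 \<Longrightarrow> circle_lift f (L f) \<and> (\<forall>y\<in>Y. L f y = F0 y)"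
    by metis
  define E where "E = (\<lambda>x. L (s (to_circle x)))"
  have lift: "circle_lift (s (to_circle x)) (E x)" and EY: "\<And>y. y \<in> Y \<Longrightarrow> E x y = F0 y" for x
    using L[OF s] by (auto simp: E_def)
  have E_near: "E x = E y" if "{x..y} \<inter> Y = {}" "x \<le> y" for x y
  proof -
    have "near (to_circle x) (to_circle y)" 
      unfolding near_def using that by (intro exI[of _ x] exI[of _ y]) (simp add: min_def max_def)
    then show ?thesis by (simp add: E_def near)
  qed
  define F where "F = (\<lambda>x. E x x)"
  have "circle_lift (\<lambda>p. s p p) F"
    unfolding circle_lift_def
  proof (intro conjI allI)
    show "strict_mono F"
    proof (rule strict_monoI)
      fix x y :: real assume "x < y"
      note Ex = circle_liftD(1)[OF lift[of x]] and Ey = circle_liftD(1)[OF lift[of y]]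
      show "F x < F y"
      proof (cases "{x..y} \<inter> Y = {}")
        case True
        then show ?thesis using E_near[of x y] \<open>x < y\<close> strict_mono_less[OF Ey] by (simp add: F_def)
      next
        case False
        then obtain z where z: "z \<in> Y" "x \<le> z" "z \<le> y" by auto
        have "E x x \<le> F0 z" "F0 z \<le> E y y"
          using strict_mono_less_eq[OF Ex, of x z] strict_mono_less_eq[OF Ey, of z y] EY z by auto
        \<comment> \<open>The separating point may coincide with \<open>x\<close> or with
          \<open>y\<close>, but not with both.\<close>
        moreover have "E x x < F0 z \<or> F0 z < E y y"
          using strict_mono_less[OF Ex, of x z] strict_mono_less[OF Ey, of z y] EY z \<open>x < y\<close> by force
        ultimately show ?thesis unfolding F_def by linarith
      qed
    qed
    show "surj F"
    proof -
      have "\<exists>x. F x = y" for y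
      proof -
        \<comment> \<open>The preimage \<open>x'\<close> of \<open>y\<close> under \<open>F0\<close>
          serves to find the right component. As \<open>finv ?f \<circ> g0\<close> lies in
          \<open>ker\<close> and carries the class of \<open>x'\<close> to that of \<open>x\<close>,
          the point \<open>x\<close> is moved by the lift \<open>E x'\<close> as well, unless it
          lies in \<open>Y\<close>, where all lifts agree.\<close>
        define x' where "x' = finv F0 y"
        define x where "x = finv (E x') y"
        have Ex: "E x' x = y" unfolding x_def using circle_liftD(2)[OF lift] by (simp add: surj_f_inv_f)
        show ?thesis
        proof (cases "x \<in> Y")
          case True
          then have "F x = E x' x" using EY by (simp add: F_def)
          then show ?thesis using Ex by blast
        next
          case False
          let ?f = "s (to_circle x')"
          have sG: "?f \<in> G" by (rule s)
          have hK: "finv ?f \<circ> g0 \<in> ker" using coset_ker[OF s(1) g0] s(2) by simp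
          have "?f (to_circle x) = to_circle y" using circle_liftD(4)[OF lift[of x'], of x] Ex by simp
          moreover have "g0 (to_circle x') = to_circle y" using F0d(4)[of x'] F0c by (simp add: x'_def)
          ultimately have h: "(finv ?f \<circ> g0) (to_circle x') = to_circle x"
            using finv_apply(2)[OF sG, of "to_circle x"] by simp
          have "to_circle x' \<notin> Fx"
            using False Fx_invariant[of "finv ?f \<circ> g0" "to_circle x'"] hK h by (simp add: Y_def ker_def)
          then have "near (to_circle x') (to_circle x)" using ker_near[OF hK] h by metis
          then have "E x' = E x" using near by (simp add: E_def)
          then show ?thesis using Ex by (auto simp: F_def)
        qed
      qed
      then show ?thesis by (metis surjI)
    qed
    fix x
    have "to_circle (x + 1) = to_circle x" by (simp add: to_circle_eq_iff)
    then show "F (x + 1) = F x + 1"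
      using circle_liftD(3)[OF lift[of x], of x] by (simp add: F_def E_def)
    show "to_circle (F x) = s (to_circle x) (to_circle x)"
      using circle_liftD(4)[OF lift[of x], of x] by (simp add: F_def)
  qed
  then show ?thesis by (rule circle_lift_imp_Homeo)
qed

end


section \<open>Coordinates on the complement\<close>

context circle_group_kernel
begin

lemma ker_Fx: "h \<in> ker \<Longrightarrow> p \<in> Fx \<Longrightarrow> h p = p"
  by (simp add: Fx_def)

lemma coset_Fx:
  assumes "f \<in> G" "g \<in> G" "Rot f = Rot g" "p \<in> Fx"
  shows "f p = g p"
proof -
  have "(finv f \<circ> g) p = p" using ker_Fx[OF coset_ker[OF assms(1-3)] assms(4)] .
  then show ?thesis using finv_apply(1)[OF assms(1), of "g p"] by simp
qed

text \<open>
  The fundamental domain \<open>D\<close> is the union of the chosen components, one for each orbit.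
  Every point outside \<open>Fx\<close> is \<open>r t d\<close> for unique \<open>t \<in> T\<close> and \<open>d \<in> D\<close>; all maps below are
  computed in these coordinates.
\<close>

definition D :: "circle set"
  where "D = {p. p \<notin> Fx \<and> tau p = 0}"

lemma coord [simp]:
  assumes "t \<in> T" "d \<in> D"
  shows "r t d \<notin> Fx" "tau (r t d) = t" "finv (r t) (r t d) = d"
  using assms r_T[OF assms(1)] tau_image[of "r t" d] by (auto simp: D_def)

lemma obtain_coord:
  assumes "p \<notin> Fx"
  obtains t d where "t \<in> T" "d \<in> D" "p = r t d"
proof -
  have t: "tau p \<in> T" by (rule tau_T[OF assms])
  note rG = r_T(1)[OF t]
  have "finv (r (tau p)) p \<notin> Fx" using Fx_invariant[OF G_simps(4)[OF rG]] assms by simp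
  moreover have "tau (finv (r (tau p)) p) = 0"
    using tau_image[OF G_simps(4)[OF rG] assms] Rot_finv[OF rG] r_T(2)[OF t] by simp
  ultimately have "finv (r (tau p)) p \<in> D" by (simp add: D_def)
  then show ?thesis using that[OF t] rG by simp
qed

lemma coord_ext:
  assumes "\<And>p. p \<in> Fx \<Longrightarrow> \<phi> p = \<psi> p" "\<And>t d. t \<in> T \<Longrightarrow> d \<in> D \<Longrightarrow> \<phi> (r t d) = \<psi> (r t d)"
  shows "\<phi> = \<psi>"
proof
  fix p show "\<phi> p = \<psi> p"
  proof (cases "p \<in> Fx")
    case False
    then obtain t d where "t \<in> T" "d \<in> D" "p = r t d" by (rule obtain_coord)
    then show ?thesis using assms(2) by simp
  qed (rule assms(1))
qed

lemma coord_in_D: "t \<in> T \<Longrightarrow> d \<in> D \<Longrightarrow> r t d \<in> D \<longleftrightarrow> t = 0"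
  unfolding D_def by simp (simp add: D_def)

lemma coord_inj: "t \<in> T \<Longrightarrow> d \<in> D \<Longrightarrow> d' \<in> D \<Longrightarrow> r t d = r t d' \<longleftrightarrow> d = d'"
  by (metis coord(3))

lemma ker_D: "h \<in> ker \<Longrightarrow> d \<in> D \<Longrightarrow> h d \<in> D"
  using tau_image[of h d] by (simp add: D_def ker_def)

lemma D_nonempty: obtains d where "d \<in> D"
proof -
  obtain f where f: "f \<in> G" "\<exists>q. f q = q" "f \<noteq> id" using nontrivial by blast
  then obtain p where "f p \<noteq> p" by (auto simp: fun_eq_iff)
  moreover have "f \<in> ker" using f by (simp add: ker_iff)
  ultimately have "p \<notin> Fx" by (auto simp: Fx_def)
  then show ?thesis using obtain_coord that by blast
qed

text \<open>In coordinates, \<open>r t d\<close> goes to \<open>r (q + t) d\<close>. The map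
  \<open>r q\<close> itself would not do, because \<open>r\<close> need not be additive. On every
  component \<open>kappa q\<close> is given by some element of the coset of \<open>r q\<close>, so
  the pieces fit together with \<open>r q\<close> on \<open>Fx\<close>.\<close>

definition kappa :: "circle \<Rightarrow> circle \<Rightarrow> circle"
  where "kappa q p = (if p \<in> Fx then r q p else r (q + tau p) (finv (r (tau p)) p))"

lemma kappa_coord [simp]: "t \<in> T \<Longrightarrow> d \<in> D \<Longrightarrow> kappa q (r t d) = r (q + t) d"
  by (simp add: kappa_def)

lemma kappa_Fx: "p \<in> Fx \<Longrightarrow> kappa q p = r q p"
  by (simp add: kappa_def)

lemma kappa_Fx_in: "q \<in> T \<Longrightarrow> p \<in> Fx \<Longrightarrow> kappa q p \<in> Fx"
  by (simp add: kappa_def r_T)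

lemma kappa_Homeo:
  assumes q: "q \<in> T"
  shows "kappa q \<in> carrier Homeo_circle"
proof -
  define s where "s = (\<lambda>p. if p \<in> Fx then r q else r (q + tau p) \<circ> finv (r (tau p)))"
  have "(\<lambda>p. s p p) \<in> carrier Homeo_circle"
  proof (rule patch_Homeo[of "r q" s])
    show "r q \<in> G" by (rule r_T[OF q])
    fix p
    show "s p \<in> G"
      using r_T(1) T_closed(2)[OF q] tau_T[of p] G_simps(3,4) q by (simp add: s_def)
    show "Rot (s p) = Rot (r q)"
    proof (cases "p \<in> Fx")
      case False
      note t = tau_T[OF False]
      show ?thesis
        using False Rot_comp_G[OF r_T(1)[OF T_closed(2)[OF q t]] G_simps(4)[OF r_T(1)[OF t]]]
          Rot_finv[OF r_T(1)[OF t]] r_T(2) T_closed(2)[OF q t] t q by (simp add: s_def)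
    qed (simp add: s_def)
  next
    fix p p' assume "near p p'"
    then show "s p = s p'" using tau_near near_not_Fx by (simp add: s_def)
  qed
  moreover have "(\<lambda>p. s p p) = kappa q" by (auto simp: s_def kappa_def)
  ultimately show ?thesis by simp
qed

text \<open>On \<open>Fx\<close> the failure of \<open>r\<close> to be additive is invisible, since
  \<open>r (s + t)\<close> and \<open>r s \<circ> r t\<close> lie in one coset of
  \<open>ker\<close>. Elsewhere only indices are added.\<close>

lemma kappa_add:
  assumes "s \<in> T" "t \<in> T"
  shows "kappa (s + t) = kappa s \<circ> kappa t"
proof (rule coord_ext)
  fix p assume p: "p \<in> Fx"
  have "r (s + t) p = (r s \<circ> r t) p"
    using coset_Fx[OF r_T(1)[OF T_closed(2)[OF assms]] G_simps(3)[OF r_T(1)[OF assms(1)] r_T(1)[OF assms(2)]] _ p]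
      Rot_comp_G[OF r_T(1)[OF assms(1)] r_T(1)[OF assms(2)]] r_T(2) assms T_closed(2)[OF assms] by simp
  then show "kappa (s + t) p = (kappa s \<circ> kappa t) p"
    using p kappa_Fx_in[OF assms(2) p] by (simp add: kappa_Fx)
qed (simp add: assms T_closed add.assoc)

lemma kappa_0: "kappa 0 = id"
  by (rule coord_ext) (simp_all add: kappa_Fx)

lemma kappa_inj: "inj_on kappa T"
proof (rule inj_onI)
  fix s t assume st: "s \<in> T" "t \<in> T" "kappa s = kappa t"
  obtain d where d: "d \<in> D" by (rule D_nonempty)
  have "kappa s (r 0 d) = kappa t (r 0 d)" using st(3) by simp
  then have "r s d = r t d" using kappa_coord[OF T_closed(1) d] by (simp del: r_0)
  then have "tau (r s d) = tau (r t d)" by (rule arg_cong)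
  then show "s = t" using coord(2)[OF st(1) d] coord(2)[OF st(2) d] by metis
qed

section \<open>The factor supported on the fundamental domain\<close>

definition eta :: "(circle \<Rightarrow> circle) \<Rightarrow> circle \<Rightarrow> circle"
  where "eta h p = (if p \<in> D then h p else p)"

lemma eta_Homeo:
  assumes h: "h \<in> ker"
  shows "eta h \<in> carrier Homeo_circle"
proof -
  define s where "s = (\<lambda>p. if p \<in> D then h else id)"
  have "(\<lambda>p. s p p) \<in> carrier Homeo_circle"
  proof (rule patch_Homeo[of id s])
    show "id \<in> G" by (rule G_simps)
    fix p show "s p \<in> G" "Rot (s p) = Rot id"
      using h G_simps(2) by (auto simp: s_def ker_def)
  next
    fix p p' assume "near p p'"
    then show "s p = s p'" using tau_near[of p p'] near_not_Fx[of p p'] by (simp add: s_def D_def)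
  qed
  moreover have "(\<lambda>p. s p p) = eta h" by (auto simp: s_def eta_def)
  ultimately show ?thesis by simp
qed

lemma eta_comp:
  assumes "g \<in> ker" "h \<in> ker"
  shows "eta (g \<circ> h) = eta g \<circ> eta h"
  using ker_D[OF assms(2)] by (auto simp: eta_def fun_eq_iff)

lemma Rot_eta: "h \<in> ker \<Longrightarrow> Rot (eta h) = 0"
proof -
  assume h: "h \<in> ker"
  obtain y where "y \<in> Y" by (rule Y_nonempty)
  then have "eta h (to_circle y) = to_circle y" by (simp add: eta_def D_def Y_def)
  then show ?thesis by (rule Rot_fixed_point[OF eta_Homeo[OF h]])
qed

text \<open>A quotient of \<open>ker\<close>, in which elements with the same restriction to
  \<open>D\<close> are identified. It need not be contained in \<open>G\<close>.\<close>

definition H0 :: "(circle \<Rightarrow> circle) set"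
  where "H0 = eta ` ker"

definition Q :: "(circle \<Rightarrow> circle) set"
  where "Q = kappa ` T"

lemma group_hom_eta: "group_hom (Homeo_sub ker) Homeo_circle eta"
proof -
  have "group (Homeo_sub ker)" by (rule group.subgroup_imp_group[OF group_Homeo_circle subgroup_ker])
  moreover have "eta \<in> hom (Homeo_sub ker) Homeo_circle"
    using eta_Homeo eta_comp by (simp add: hom_def)
  ultimately show ?thesis using group_Homeo_circle by (simp add: group_hom_def group_hom_axioms_def)
qed

lemma subgroup_H0: "subgroup H0 Homeo_circle"
  using group_hom.img_is_subgroup[OF group_hom_eta] by (simp add: H0_def)

lemma group_circle_group: "group circle_group"
proof (rule groupI)
  fix x assume "x \<in> carrier circle_group"
  show "\<exists>y\<in>carrier circle_group. y \<otimes>\<^bsub>circle_group\<^esub> x = \<one>\<^bsub>circle_group\<^esub>"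
    by (rule bexI[of _ "- x"]) (simp_all add: circle_group_def)
qed (simp_all add: circle_group_def add.assoc)

lemma subgroup_T: "subgroup T circle_group"
proof -
  have inv: "inv\<^bsub>circle_group\<^esub> t = - t" for t
    by (rule group.inv_equality[OF group_circle_group]) (simp_all add: circle_group_def)
  show ?thesis
  proof
    show "inv\<^bsub>circle_group\<^esub> t \<in> T" if "t \<in> T" for t
      unfolding inv by (rule T_closed(3)[OF that])
  qed (simp_all add: circle_group_def T_closed)
qed

lemma group_hom_kappa: "group_hom (circle_group\<lparr>carrier := T\<rparr>) Homeo_circle kappa"
proof -
  have "group (circle_group\<lparr>carrier := T\<rparr>)"
    by (rule group.subgroup_imp_group[OF group_circle_group subgroup_T])
  moreover have "kappa \<in> hom (circle_group\<lparr>carrier := T\<rparr>) Homeo_circle"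
    using kappa_Homeo kappa_add by (simp add: hom_def circle_group_def)
  ultimately show ?thesis using group_Homeo_circle by (simp add: group_hom_def group_hom_axioms_def)
qed

lemma subgroup_Q: "subgroup Q Homeo_circle"
  using group_hom.img_is_subgroup[OF group_hom_kappa] by (simp add: Q_def)

lemmas H0_simps = Homeo_subgroupD[OF subgroup_H0]
lemmas Q_simps = Homeo_subgroupD[OF subgroup_Q]

lemma kappa_Q: "t \<in> T \<Longrightarrow> kappa t \<in> Q"
  by (simp add: Q_def)

lemma finv_kappa:
  assumes "t \<in> T"
  shows "finv (kappa t) = kappa (- t)"
proof (rule inv_unique_comp)
  show "kappa t \<circ> kappa (- t) = id" "kappa (- t) \<circ> kappa t = id"
    using kappa_add[OF assms T_closed(3)[OF assms]] kappa_add[OF T_closed(3)[OF assms] assms]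
    by (simp_all add: kappa_0)
qed

lemma H0_D:
  assumes "h \<in> H0"
  shows "d \<in> D \<Longrightarrow> h d \<in> D" "p \<notin> D \<Longrightarrow> h p = p"
  using assms ker_D by (auto simp: H0_def eta_def)

section \<open>The base group acting on the circle\<close>

definition H0_families :: "((circle \<Rightarrow> circle) \<Rightarrow> circle \<Rightarrow> circle) set"
  where "H0_families = (\<Pi>\<^sub>E k\<in>Q. H0)"

lemma H0_familiesD: "f \<in> H0_families \<Longrightarrow> k \<in> Q \<Longrightarrow> f k \<in> H0"
  by (auto simp: H0_families_def)

text \<open>The action of the base group of the wreath product on the circle.\<close>

definition beta :: "((circle \<Rightarrow> circle) \<Rightarrow> circle \<Rightarrow> circle) \<Rightarrow> circle \<Rightarrow> circle"
  where "beta f p = (if p \<in> Fx then p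
    else r (tau p) (f (kappa (tau p)) (finv (r (tau p)) p)))"

lemma beta_coord [simp]: "t \<in> T \<Longrightarrow> d \<in> D \<Longrightarrow> beta f (r t d) = r t (f (kappa t) d)"
  by (simp add: beta_def)

lemma beta_Fx [simp]: "p \<in> Fx \<Longrightarrow> beta f p = p"
  by (simp add: beta_def)

text \<open>In the slice of index \<open>t\<close> the map is a conjugate by \<open>r t\<close> of
  an element of \<open>ker\<close>, and so again an element of \<open>ker\<close>. All these
  elements fix \<open>Fx\<close> pointwise; infinitely many factors can therefore act at once, as
  the unrestricted product requires.\<close>

lemma beta_Homeo:
  assumes f: "f \<in> H0_families"
  shows "beta f \<in> carrier Homeo_circle"
proof -
  \<comment> \<open>A member of \<open>H0\<close> is known to agree with an element of
    \<open>ker\<close> only on \<open>D\<close>; patching needs the element itself.\<close>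
  have "\<exists>h\<in>ker. \<forall>d\<in>D. f (kappa t) d = h d" if "t \<in> T" for t
  proof -
    have "f (kappa t) \<in> H0" by (rule H0_familiesD[OF f kappa_Q[OF that]])
    then show ?thesis by (auto simp: H0_def eta_def)
  qed
  then obtain e where e: "\<And>t. t \<in> T \<Longrightarrow> e t \<in> ker" "\<And>t d. t \<in> T \<Longrightarrow> d \<in> D \<Longrightarrow> f (kappa t) d = e t d"
    by metis
  define s where "s = (\<lambda>p. if p \<in> Fx then id else r (tau p) \<circ> (e (tau p) \<circ> finv (r (tau p))))"
  have s: "s p \<in> G \<and> Rot (s p) = Rot id" for p
  proof (cases "p \<in> Fx")
    case False
    note t = tau_T[OF False]
    have eG: "e (tau p) \<in> G" "Rot (e (tau p)) = 0" using e(1)[OF t] by (simp_all add: ker_def)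
    note rG = r_T(1)[OF t]
    show ?thesis using False G_simps(3)[OF rG G_simps(3)[OF eG(1) G_simps(4)[OF rG]]]
        Rot_comp_G[OF rG G_simps(3)[OF eG(1) G_simps(4)[OF rG]]] Rot_comp_G[OF eG(1) G_simps(4)[OF rG]]
        Rot_finv[OF rG] eG(2) by (simp add: s_def)
  qed (use G_simps(2) in \<open>simp add: s_def\<close>)
  have "(\<lambda>p. s p p) \<in> carrier Homeo_circle"
  proof (rule patch_Homeo[of id s])
    fix p p' assume "near p p'"
    then show "s p = s p'" using tau_near[of p p'] near_not_Fx[of p p'] by (simp add: s_def)
  qed (use s G_simps(2) in auto)
  moreover have "(\<lambda>p. s p p) = beta f"
    by (rule coord_ext) (simp_all add: s_def e)
  ultimately show ?thesis by simp
qed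

lemma beta_mult:
  assumes "f \<in> H0_families" "g \<in> H0_families"
  shows "beta (\<lambda>k\<in>Q. f k \<circ> g k) = beta f \<circ> beta g"
  by (rule coord_ext) (simp_all add: kappa_Q H0_D(1)[OF H0_familiesD[OF assms(2)]])

text \<open>With \<open>k = kappa q\<close>, both sides send \<open>r t d\<close> to
  \<open>r (q + t) (f (kappa t) d)\<close>. This is the relation of the semidirect product, from
  which the multiplicativity of \<open>Phi\<close> follows.\<close>

lemma kappa_beta:
  assumes f: "f \<in> H0_families" and k: "k \<in> Q"
  shows "k \<circ> beta f = beta (\<lambda>t\<in>Q. f (finv k \<circ> t)) \<circ> k"
proof -
  obtain q where q: "q \<in> T" "k = kappa q" using k by (auto simp: Q_def)
  have *: "finv k \<circ> kappa (q + t) = kappa t" if "t \<in> T" for t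
    using kappa_add[OF T_closed(3)[OF q(1)] T_closed(2)[OF q(1) that]] finv_kappa[OF q(1)] q(2) by simp
  show ?thesis
  proof (rule coord_ext)
    fix t d assume td: "t \<in> T" "d \<in> D"
    have fd: "f (kappa t) d \<in> D" by (rule H0_D(1)[OF H0_familiesD[OF f kappa_Q[OF td(1)]] td(2)])
    have "(k \<circ> beta f) (r t d) = r (q + t) (f (kappa t) d)"
      using td fd by (simp add: q(2))
    also have "\<dots> = (beta (\<lambda>t\<in>Q. f (finv k \<circ> t)) \<circ> k) (r t d)"
      using td T_closed(2)[OF q(1) td(1)] *[OF td(1)] kappa_Q[OF T_closed(2)[OF q(1) td(1)]] q(2) by simp
    finally show "(k \<circ> beta f) (r t d) = (beta (\<lambda>t\<in>Q. f (finv k \<circ> t)) \<circ> k) (r t d)" .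
  qed (use q kappa_Fx_in in simp)
qed

lemma translate_families:
  assumes f: "f \<in> H0_families" and k: "k \<in> Q"
  shows "(\<lambda>t\<in>Q. f (finv k \<circ> t)) \<in> H0_families"
  using H0_familiesD[OF f Q_simps(3)[OF Q_simps(4)[OF k]]] by (auto simp: H0_families_def)

lemma mult_families:
  assumes "f \<in> H0_families" "g \<in> H0_families"
  shows "(\<lambda>k\<in>Q. f k \<circ> g k) \<in> H0_families"
  using H0_simps(3) H0_familiesD[OF assms(1)] H0_familiesD[OF assms(2)] by (auto simp: H0_families_def)

text \<open>The index of the image of a point of \<open>D\<close> recovers \<open>q\<close>, hence
  \<open>k\<close>. After cancelling \<open>k\<close>, the action on the slice of index
  \<open>t\<close> recovers \<open>f (kappa t)\<close> on \<open>D\<close>, and off \<open>D\<close>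
  every member of \<open>H0\<close> is the identity.\<close>

lemma beta_kappa_inj:
  assumes f: "f \<in> H0_families" "f' \<in> H0_families" and k: "k \<in> Q" "k' \<in> Q"
    and eq: "beta f \<circ> k = beta f' \<circ> k'"
  shows "f = f' \<and> k = k'"
proof -
  obtain q q' where q: "q \<in> T" "k = kappa q" "q' \<in> T" "k' = kappa q'" using k by (auto simp: Q_def)
  obtain d where d: "d \<in> D" by (rule D_nonempty)
  have val: "(beta g \<circ> kappa s) (r 0 d) = r s (g (kappa s) d)" "g (kappa s) d \<in> D"
    if "s \<in> T" "g \<in> H0_families" for s g
    using that d kappa_coord[OF T_closed(1) d, of s] H0_D(1)[OF H0_familiesD[OF that(2) kappa_Q[OF that(1)]] d]
    by simp_all
  have "r q (f (kappa q) d) = r q' (f' (kappa q') d)"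
    using eq val(1)[OF q(1) f(1)] val(1)[OF q(3) f(2)] q by metis
  then have "q = q'" using coord(2) val(2) q f by metis
  then have kk: "k = k'" using q by simp
  have "beta f = beta f'"
    using eq kk Q_simps(5)[OF k(1)] by (metis bij_is_surj fun.map_comp surj_fun_eq UNIV_I o_apply surjD ext)
  have "f j = f' j" for j
  proof (cases "j \<in> Q")
    case True
    then obtain t where t: "t \<in> T" "j = kappa t" by (auto simp: Q_def)
    show ?thesis
    proof
      fix p
      show "f j p = f' j p"
      proof (cases "p \<in> D")
        case True
        then have "beta f (r t p) = beta f' (r t p)" using \<open>beta f = beta f'\<close> by simp
        then have "r t (f j p) = r t (f' j p)" using t True by simp
        then show ?thesis
          using coord_inj[OF t(1)] H0_D(1)[OF H0_familiesD[OF _ \<open>j \<in> Q\<close>] True] f by blast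
      next
        case False
        then show ?thesis
          using H0_D(2)[OF H0_familiesD[OF f(1) \<open>j \<in> Q\<close>]] H0_D(2)[OF H0_familiesD[OF f(2) \<open>j \<in> Q\<close>]] by simp
      qed
    qed
  next
    case False
    then show ?thesis using f by (auto simp: H0_families_def PiE_def extensional_def)
  qed
  then show ?thesis using kk by auto
qed

text \<open>This is the Kaloujnine--Krasner formula, with respect to the section \<open>r\<close> of \<open>Rot\<close>.\<close>

lemma G_decomposition:
  assumes g: "g \<in> G"
  shows "\<exists>f\<in>H0_families. \<exists>k\<in>Q. g = beta f \<circ> k"
proof -
  \<comment> \<open>Since \<open>g\<close> raises indices by \<open>Rot g\<close>, it carries the
    slice of index \<open>s - Rot g\<close> to that of index \<open>s\<close>; this is the map it
    induces on the coordinate in \<open>D\<close>.\<close>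
  define u where "u = (\<lambda>s. finv (r s) \<circ> (g \<circ> r (s - Rot g)))"
  have uker: "u s \<in> ker" if s: "s \<in> T" for s
  proof -
    have s': "s - Rot g \<in> T" by (rule T_closed(4)[OF s T_closed(5)[OF g]])
    have "Rot (g \<circ> r (s - Rot g)) = Rot (r s)"
      using Rot_comp_G[OF g r_T(1)[OF s']] r_T(2)[OF s'] r_T(2)[OF s] by simp
    then show ?thesis
      unfolding u_def using coset_ker[OF r_T(1)[OF s] G_simps(3)[OF g r_T(1)[OF s']]] by simp
  qed
  define f where "f = (\<lambda>k\<in>Q. eta (u (inv_into T kappa k)))"
  have f_kappa: "f (kappa s) = eta (u s)" if "s \<in> T" for s
    using that kappa_Q[OF that] inv_into_f_f[OF kappa_inj that] by (simp add: f_def)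
  have "f k \<in> H0" if "k \<in> Q" for k
  proof -
    from that obtain t where "t \<in> T" "k = kappa t" by (auto simp: Q_def)
    then show ?thesis using f_kappa uker by (simp add: H0_def)
  qed
  then have fB: "f \<in> H0_families" by (auto simp: H0_families_def f_def)
  have RG: "Rot g \<in> T" by (rule T_closed(5)[OF g])
  have "g = beta f \<circ> kappa (Rot g)"
  proof (rule coord_ext)
    fix p assume p: "p \<in> Fx"
    have "r (Rot g) p = g p" using coset_Fx[OF r_T(1)[OF RG] g r_T(2)[OF RG] p] .
    then show "g p = (beta f \<circ> kappa (Rot g)) p" using p g by (simp add: kappa_Fx)
  next
    fix t d assume td: "t \<in> T" "d \<in> D"
    let ?s = "Rot g + t"
    have s: "?s \<in> T" by (rule T_closed(2)[OF RG td(1)])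
    have "(beta f \<circ> kappa (Rot g)) (r t d) = r ?s (eta (u ?s) d)"
      using td s f_kappa by simp
    also have "eta (u ?s) d = finv (r ?s) (g (r t d))" using td by (simp add: eta_def u_def)
    also have "r ?s (finv (r ?s) (g (r t d))) = g (r t d)" using r_T(1)[OF s] by simp
    finally show "g (r t d) = (beta f \<circ> kappa (Rot g)) (r t d)" by simp
  qed
  then show ?thesis using fB kappa_Q[OF RG] by blast
qed

end


section \<open>Embeddings of the wreath product\<close>

text \<open>One interval factor is enough, so the index set is \<open>{0}\<close>.\<close>

lemma Homeo_interval_mon_product:
  assumes "\<phi> \<in> mon H Homeo_interval"
  shows "(\<lambda>h. \<lambda>_\<in>{0 :: nat}. \<phi> h) \<in> mon H (product_group {0} (\<lambda>_. Homeo_interval))"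
  using assms by (auto simp: mon_def hom_def inj_on_def fun_eq_iff restrict_def split: if_splits)

text \<open>Cut open at the fixed point \<open>p\<close>, the circle becomes an interval of length 1
  on which the lifts fixing \<open>x0\<close> act. Each element has exactly one such lift, so the
  assignment is multiplicative.\<close>

lemma mon_Homeo_interval:
  assumes H: "subgroup H Homeo_circle" and p: "\<And>h. h \<in> H \<Longrightarrow> h p = p"
  obtains \<phi> where "\<phi> \<in> mon (Homeo_sub H) Homeo_interval"
proof -
  note Hd = Homeo_subgroupD[OF H]
  obtain x0 where x0: "p = to_circle x0" by (rule to_circle_cases)
  have "\<exists>F. circle_lift h F \<and> F x0 = x0" if "h \<in> H" for h
    using obtain_fixing_lift[of h x0] Hd(1)[OF that] p[OF that] x0 by metis
  then obtain L where L: "\<And>h. h \<in> H \<Longrightarrow> circle_lift h (L h)" "\<And>h. h \<in> H \<Longrightarrow> L h x0 = x0"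
    by metis
  have L1: "L h (x0 + 1) = x0 + 1" if "h \<in> H" for h
    using circle_liftD(3)[OF L(1)[OF that], of x0] L(2)[OF that] by simp
  have L_range: "L h (x0 + y) - x0 \<in> {0..1} \<longleftrightarrow> y \<in> {0..1}" if "h \<in> H" for h y
    using strict_mono_less_eq[OF circle_liftD(1)[OF L(1)[OF that]], of x0 "x0 + y"]
      strict_mono_less_eq[OF circle_liftD(1)[OF L(1)[OF that]], of "x0 + y" "x0 + 1"]
      L(2)[OF that] L1[OF that] by auto
  define \<phi> where "\<phi> = (\<lambda>h. \<lambda>y\<in>{0..1}. L h (x0 + y) - x0)"
  have "\<phi> h \<in> carrier Homeo_interval" if h: "h \<in> H" for h
  proof -
    note Lh = circle_liftD[OF L(1)[OF h]]
    have smono: "strict_mono_on {0..1} (\<phi> h)"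
      using strict_mono_less[OF Lh(1)] by (auto simp: \<phi>_def strict_mono_on_def)
    have "continuous_on {0..1} (\<lambda>y. L h (x0 + y) - x0)"
      by (intro continuous_intros continuous_on_compose2[OF strict_mono_surj_continuous[OF Lh(1,2), of UNIV]]) auto
    then have cont: "continuous_on {0..1} (\<phi> h)"
      by (rule continuous_on_eq) (simp add: \<phi>_def)
    have "\<phi> h ` {0..1} = {0..1}"
    proof
      show "\<phi> h ` {0..1} \<subseteq> {0..1}" using L_range[OF h] by (auto simp: \<phi>_def simp del: atLeastAtMost_iff)
      show "{0..1} \<subseteq> \<phi> h ` {0..1}"
      proof
        fix z :: real assume z: "z \<in> {0..1}"
        obtain w where w: "L h w = x0 + z" using Lh(2) by (metis surjD)
        then have "L h (x0 + (w - x0)) - x0 = z" by simp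
        then have "w - x0 \<in> {0..1}" using L_range[OF h, of "w - x0"] z by metis
        then show "z \<in> \<phi> h ` {0..1}"
          using w by (intro image_eqI[of _ _ "w - x0"]) (auto simp: \<phi>_def)
      qed
    qed
    then have "\<exists>g. homeomorphism {0..1} {0..1} (\<phi> h) g"
      using homeomorphism_compact[OF compact_Icc cont] strict_mono_on_imp_inj_on[OF smono] by metis
    then show ?thesis using smono by (simp add: Homeo_interval_def \<phi>_def)
  qed
  moreover have "\<phi> (g \<circ> h) = compose {0..1} (\<phi> g) (\<phi> h)" if gh: "g \<in> H" "h \<in> H" for g h
  proof -
    have "L (g \<circ> h) = L g \<circ> L h"
      by (rule circle_lift_unique[OF L(1)[OF Hd(3)[OF gh]] circle_lift_compose[OF L(1)[OF gh(1)] L(1)[OF gh(2)]], of x0])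
        (simp add: L gh Hd(3))
    then show ?thesis
      using L_range[OF gh(2)] by (auto simp: \<phi>_def compose_def fun_eq_iff)
  qed
  moreover have "g = h" if gh: "g \<in> H" "h \<in> H" "\<phi> g = \<phi> h" for g h
  proof
    fix q
    obtain x where x: "q = to_circle x" "x0 \<le> x" "x < x0 + 1" by (rule to_circle_cases_interval)
    have "\<phi> g (x - x0) = \<phi> h (x - x0)" using gh(3) by simp
    then have "L g x = L h x" using x by (simp add: \<phi>_def)
    then show "g q = h q" using circle_liftD(4)[OF L(1)[OF gh(1)], of x] circle_liftD(4)[OF L(1)[OF gh(2)], of x] x(1) by simp
  qed
  ultimately have "\<phi> \<in> mon (Homeo_sub H) Homeo_interval"
    by (auto simp: mon_def hom_def inj_on_def Homeo_interval_def)
  then show ?thesis by (rule that)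
qed

context circle_group_kernel
begin

text \<open>The images of the component of \<open>d\<close> under the elements \<open>r t\<close>
  are nonempty, open and pairwise disjoint; the sets \<open>U t\<close> are their preimages in the
  line.\<close>

lemma countable_T: "countable T"
proof -
  obtain d where d: "d \<in> D" by (rule D_nonempty)
  define U where "U = (\<lambda>t. {x. near (r t d) (to_circle x)})"
  have U_tau: "tau (to_circle x) = t" if "x \<in> U t" "t \<in> T" for x t
    using tau_near[of "r t d" "to_circle x"] that d by (simp add: U_def)
  have ne: "U t \<noteq> {}" if "t \<in> T" for t
  proof -
    obtain x where "r t d = to_circle x" by (rule to_circle_cases)
    then have "x \<in> U t" using near_refl[OF coord(1)[OF that d]] by (simp add: U_def)
    then show ?thesis by blast
  qed
  have "open (U t)" for t
  proof (rule openI)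
    fix x assume x: "x \<in> U t"
    then have "x \<in> - Y" using near_not_Fx(2) by (auto simp: U_def Y_def)
    then obtain e where e: "e > 0" "ball x e \<subseteq> - Y"
      using closed_Y by (metis open_Compl open_contains_ball)
    have "y \<in> U t" if y: "y \<in> ball x e" for y
    proof -
      have "z \<in> ball x e" if "z \<in> {min x y..max x y}" for z
        using that y by (auto simp: dist_real_def min_def max_def split: if_splits)
      then have "{min x y..max x y} \<inter> Y = {}" using e(2) by blast
      then have "near (to_circle x) (to_circle y)" unfolding near_def by blast
      then show ?thesis using x near_trans by (auto simp: U_def)
    qed
    then show "\<exists>e>0. ball x e \<subseteq> U t" using e(1) by blast
  qed
  moreover have "disjoint (U ` T)"
  proof (rule pairwiseI)
    fix V W assume VW: "V \<in> U ` T" "W \<in> U ` T" "V \<noteq> W"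
    then obtain s t where "s \<in> T" "V = U s" "t \<in> T" "W = U t" by blast
    then show "disjnt V W" using U_tau VW(3) unfolding disjnt_iff by metis
  qed
  ultimately have "countable (U ` T)" by (intro countable_disjoint_open_subsets) auto
  moreover have "inj_on U T"
  proof (rule inj_onI)
    fix s t assume st: "s \<in> T" "t \<in> T" "U s = U t"
    obtain x where "x \<in> U s" using ne[OF st(1)] by blast
    then show "s = t" using U_tau st by metis
  qed
  ultimately show ?thesis by (rule countable_image_inj_on)
qed

lemma group_G: "group (Homeo_sub G)"
  and group_ker: "group (Homeo_sub ker)"
  and group_H0: "group (Homeo_sub H0)"
  and group_Q: "group (Homeo_sub Q)"
  using group.subgroup_imp_group[OF group_Homeo_circle] G subgroup_ker subgroup_H0 subgroup_Q by auto

text \<open>\<open>H0\<close> is a quotient of \<open>ker\<close>, and the property passes to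
  subgroups and to quotients.\<close>

lemma H0_no_free:
  assumes "no_nonabelian_free_subgroups (Homeo_sub G)"
  shows "no_nonabelian_free_subgroups (Homeo_sub H0)"
proof (rule no_nonabelian_free_subgroups_surj)
  show "group_hom (Homeo_sub ker) (Homeo_sub H0) eta"
    using group_hom.homh[OF group_hom_eta] group_ker group_H0
    by (auto simp: group_hom_def group_hom_axioms_def hom_def H0_def)
  show "carrier (Homeo_sub H0) \<subseteq> eta ` carrier (Homeo_sub ker)" by (simp add: H0_def)
  have "subgroup F (Homeo_sub G)" if "subgroup F (Homeo_sub ker)" for F
  proof -
    have "subgroup F Homeo_circle"
      using group.incl_subgroup[OF group_Homeo_circle subgroup_ker that] .
    moreover have "F \<subseteq> G" using subgroup.subset[OF that] by (auto simp: ker_def)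
    ultimately show ?thesis using group.subgroup_incl[OF group_Homeo_circle _ G] by blast
  qed
  then show "no_nonabelian_free_subgroups (Homeo_sub ker)"
    using assms unfolding no_nonabelian_free_subgroups_def by auto
qed

lemma Q_iso_T: "Homeo_sub Q \<cong> circle_group\<lparr>carrier := T\<rparr>"
proof -
  have "kappa \<in> iso (circle_group\<lparr>carrier := T\<rparr>) (Homeo_sub Q)"
    using group_hom.homh[OF group_hom_kappa] kappa_inj by (auto simp: iso_def hom_def bij_betw_def Q_def)
  then have "circle_group\<lparr>carrier := T\<rparr> \<cong> Homeo_sub Q" by (rule is_isoI)
  then show ?thesis
    using group.iso_sym group.subgroup_imp_group[OF group_circle_group subgroup_T] by blast
qed

lemma ker_Rot_Int: "ker_Rot \<inter> G = ker"
  using G_simps(1) by (auto simp: ker_Rot_def ker_def)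

text \<open>The first isomorphism theorem for \<open>kappa \<circ> Rot\<close>; its kernel is that
  of \<open>Rot\<close> because \<open>kappa\<close> is injective on \<open>T\<close>.\<close>

lemma Q_iso_quotient: "Homeo_sub Q \<cong> Homeo_sub G Mod (ker_Rot \<inter> G)"
proof -
  have kR: "kappa (Rot (a \<circ> b)) = kappa (Rot a) \<circ> kappa (Rot b)" if "a \<in> G" "b \<in> G" for a b
    using Rot_comp_G[OF that] kappa_add[OF T_closed(5) T_closed(5), OF that] by simp
  have hom: "group_hom (Homeo_sub G) (Homeo_sub Q) (kappa \<circ> Rot)"
    using group_G group_Q kR kappa_Q T_closed(5)
    by (simp add: group_hom_def group_hom_axioms_def hom_def)
  have "kappa (Rot g) = id \<longleftrightarrow> Rot g = 0" if "g \<in> G" for g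
    using inj_onD[OF kappa_inj, of "Rot g" 0] kappa_0 T_closed(1) T_closed(5)[OF that] by auto
  then have "kernel (Homeo_sub G) (Homeo_sub Q) (kappa \<circ> Rot) = ker_Rot \<inter> G"
    unfolding ker_Rot_Int by (auto simp: kernel_def ker_def)
  moreover have "(kappa \<circ> Rot) ` carrier (Homeo_sub G) = carrier (Homeo_sub Q)"
    by (simp add: Q_def T_def image_comp)
  ultimately have "Homeo_sub G Mod (ker_Rot \<inter> G) \<cong> Homeo_sub Q"
    using is_isoI[OF group_hom.FactGroup_iso_set[OF hom]] by simp
  moreover have "group (Homeo_sub G Mod (ker_Rot \<inter> G))"
    using normal.factorgroup_is_group[OF group_hom.normal_kernel[OF hom]]
      \<open>kernel (Homeo_sub G) (Homeo_sub Q) (kappa \<circ> Rot) = ker_Rot \<inter> G\<close> by simp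
  ultimately show ?thesis by (rule group.iso_sym[rotated])
qed

section \<open>The wreath products and the map \<open>Phi\<close>\<close>

lemma Q_translate:
  assumes "k \<in> Q"
  shows "translate (Homeo_sub Q) k f = (\<lambda>t\<in>Q. f (finv k \<circ> t))"
proof -
  have "inv\<^bsub>Homeo_sub Q\<^esub> k = finv k"
    using group.m_inv_consistent[OF group_Homeo_circle subgroup_Q assms] Homeo_circle_m_inv[OF Q_simps(1)[OF assms]]
    by simp
  then show ?thesis by (simp add: translate_def)
qed

lemma wreath_carrier: "carrier (wreath (Homeo_sub H0) (Homeo_sub Q)) = H0_families \<times> Q"
  by (simp add: wreath_def semidirect_def H0_families_def)

lemma wreath_mult:
  assumes "k \<in> Q"
  shows "(f, k) \<otimes>\<^bsub>wreath (Homeo_sub H0) (Homeo_sub Q)\<^esub> (f', k') =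
    (\<lambda>i\<in>Q. f i \<circ> (\<lambda>t\<in>Q. f' (finv k \<circ> t)) i, k \<circ> k')"
  using assms by (simp add: wreath_def semidirect_def Q_translate)

definition finite_families :: "((circle \<Rightarrow> circle) \<Rightarrow> circle \<Rightarrow> circle) set"
  where "finite_families = {f \<in> H0_families. finite {k \<in> Q. f k \<noteq> id}}"

lemma finite_familiesI:
  "f \<in> H0_families \<Longrightarrow> {k \<in> Q. f k \<noteq> id} \<subseteq> S \<Longrightarrow> finite S \<Longrightarrow> f \<in> finite_families"
  using finite_subset by (auto simp: finite_families_def)

lemma finite_familiesD:
  "f \<in> finite_families \<Longrightarrow> f \<in> H0_families" "f \<in> finite_families \<Longrightarrow> finite {k \<in> Q. f k \<noteq> id}"
  by (simp_all add: finite_families_def)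

lemma restricted_wreath_carrier:
  "carrier (restricted_wreath (Homeo_sub H0) (Homeo_sub Q)) = finite_families \<times> Q"
  using group_H0
  by (simp add: restricted_wreath_def semidirect_def carrier_sum_group finite_families_def H0_families_def)

lemma restricted_wreath_mult:
  "x \<otimes>\<^bsub>restricted_wreath (Homeo_sub H0) (Homeo_sub Q)\<^esub> y = x \<otimes>\<^bsub>wreath (Homeo_sub H0) (Homeo_sub Q)\<^esub> y"
  by (simp add: restricted_wreath_def wreath_def semidirect_def)

definition Phi :: "((circle \<Rightarrow> circle) \<Rightarrow> circle \<Rightarrow> circle) \<times> (circle \<Rightarrow> circle) \<Rightarrow> circle \<Rightarrow> circle"
  where "Phi = (\<lambda>(f, k). beta f \<circ> k)"

lemma wreath_closed:
  assumes "f \<in> H0_families" "k \<in> Q" "f' \<in> H0_families" "k' \<in> Q"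
  shows "(f, k) \<otimes>\<^bsub>wreath (Homeo_sub H0) (Homeo_sub Q)\<^esub> (f', k') \<in> H0_families \<times> Q"
  using assms mult_families[OF assms(1) translate_families[OF assms(3,2)]] Q_simps(3)
  by (simp add: wreath_mult)

lemma Phi_mult:
  assumes "f \<in> H0_families" "k \<in> Q" "f' \<in> H0_families" "k' \<in> Q"
  shows "Phi ((f, k) \<otimes>\<^bsub>wreath (Homeo_sub H0) (Homeo_sub Q)\<^esub> (f', k')) = Phi (f, k) \<circ> Phi (f', k')"
proof -
  let ?g = "\<lambda>t\<in>Q. f' (finv k \<circ> t)"
  have "Phi ((f, k) \<otimes>\<^bsub>wreath (Homeo_sub H0) (Homeo_sub Q)\<^esub> (f', k')) = beta (\<lambda>i\<in>Q. f i \<circ> ?g i) \<circ> (k \<circ> k')"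
    using assms(2) by (simp add: wreath_mult Phi_def)
  also have "\<dots> = beta f \<circ> (beta ?g \<circ> k) \<circ> k'"
    unfolding beta_mult[OF assms(1) translate_families[OF assms(3,2)]] by (simp only: comp_assoc)
  also have "\<dots> = beta f \<circ> (k \<circ> beta f') \<circ> k'" by (simp only: kappa_beta[OF assms(3,2)])
  finally show ?thesis by (simp only: Phi_def case_prod_conv comp_assoc)
qed

lemma Phi_Homeo: "f \<in> H0_families \<Longrightarrow> k \<in> Q \<Longrightarrow> Phi (f, k) \<in> carrier Homeo_circle"
  using Homeo_circle_comp[OF beta_Homeo Q_simps(1)] by (simp add: Phi_def)

lemma Phi_inj: "inj_on Phi (H0_families \<times> Q)"
  by (rule inj_onI) (use beta_kappa_inj in \<open>auto simp: Phi_def\<close>)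

lemma Phi_mon: "Phi \<in> mon (wreath (Homeo_sub H0) (Homeo_sub Q)) Homeo_circle"
  using Phi_inj Phi_Homeo Phi_mult by (auto simp: mon_def hom_def wreath_carrier)

lemma trivial_family:
  "(\<lambda>_\<in>Q. id) \<in> finite_families" "beta (\<lambda>_\<in>Q. id) = id"
proof -
  show "(\<lambda>_\<in>Q. id) \<in> finite_families"
    using H0_simps(2) by (auto simp: finite_families_def H0_families_def intro: rev_finite_subset[of "{}"])
  show "beta (\<lambda>_\<in>Q. id) = id" by (rule coord_ext) (simp_all add: kappa_Q)
qed

text \<open>\<open>h\<close> is supported on \<open>D\<close>, the slice of index 0. Conjugation by
  \<open>j = kappa q\<close> moves the support to the slice of index \<open>q\<close>, where the map
  acts by \<open>h\<close> on the coordinate in \<open>D\<close>.\<close>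

lemma single_family:
  assumes h: "h \<in> H0" and j: "j \<in> Q"
  shows "(\<lambda>k\<in>Q. if k = j then h else id) \<in> finite_families"
    "beta (\<lambda>k\<in>Q. if k = j then h else id) = j \<circ> (h \<circ> finv j)"
proof -
  show "(\<lambda>k\<in>Q. if k = j then h else id) \<in> finite_families"
    using h H0_simps(2) by (auto simp: finite_families_def H0_families_def intro: rev_finite_subset[of "{j}"])
  obtain q where q: "q \<in> T" "j = kappa q" using j by (auto simp: Q_def)
  have finv_j: "finv j = kappa (- q)" using finv_kappa q by simp
  have jj: "j (finv j p) = p" for p using Q_simps(5)[OF j] by (simp add: bij_is_surj surj_f_inv_f)
  show "beta (\<lambda>k\<in>Q. if k = j then h else id) = j \<circ> (h \<circ> finv j)"
  proof (rule coord_ext)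
    fix p assume p: "p \<in> Fx"
    then have "finv j p \<in> Fx" unfolding finv_j using kappa_Fx_in T_closed(3) q by simp
    then have "h (finv j p) = finv j p" using H0_D(2)[OF h] by (simp add: D_def)
    then show "beta (\<lambda>k\<in>Q. if k = j then h else id) p = (j \<circ> (h \<circ> finv j)) p" using p jj by simp
  next
    fix t d assume td: "t \<in> T" "d \<in> D"
    have t': "- q + t \<in> T" using T_closed q td by simp
    show "beta (\<lambda>k\<in>Q. if k = j then h else id) (r t d) = (j \<circ> (h \<circ> finv j)) (r t d)"
    proof (cases "t = q")
      case True
      have hd: "h d \<in> D" by (rule H0_D(1)[OF h td(2)])
      have "(j \<circ> (h \<circ> finv j)) (r t d) = kappa q (r 0 (h d))"
        using td finv_j True q by simp
      also have "\<dots> = r q (h d)" using kappa_coord[OF T_closed(1) hd] by (simp del: r_0)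
      finally show ?thesis using td True q kappa_Q by simp
    next
      case False
      then have "kappa t \<noteq> j" using inj_onD[OF kappa_inj] td q by blast
      moreover have "r (- q + t) d \<notin> D" using coord_in_D[OF t' td(2)] False by (simp add: neg_eq_iff_add_eq_0[symmetric])
      then have "h (r (- q + t) d) = r (- q + t) d" by (rule H0_D(2)[OF h])
      ultimately show ?thesis using td t' finv_j q kappa_Q by simp
    qed
  qed
qed

section \<open>The subgroup generated by \<open>H0\<close> and \<open>Q\<close>\<close>

lemma finite_families_translate:
  assumes f: "f \<in> finite_families" and k: "k \<in> Q"
  shows "(\<lambda>t\<in>Q. f (finv k \<circ> t)) \<in> finite_families"
proof -
  have "{t \<in> Q. (\<lambda>t\<in>Q. f (finv k \<circ> t)) t \<noteq> id} \<subseteq> (\<lambda>t. k \<circ> t) ` {t \<in> Q. f t \<noteq> id}"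
  proof
    fix t assume t: "t \<in> {t \<in> Q. (\<lambda>t\<in>Q. f (finv k \<circ> t)) t \<noteq> id}"
    have "k \<circ> (finv k \<circ> t) = t"
      using Q_simps(5)[OF k] by (auto simp: fun_eq_iff bij_is_surj surj_f_inv_f)
    moreover have "finv k \<circ> t \<in> Q" using Q_simps(3,4) k t by simp
    ultimately show "t \<in> (\<lambda>t. k \<circ> t) ` {t \<in> Q. f t \<noteq> id}"
      using t by (intro image_eqI[of _ _ "finv k \<circ> t"]) auto
  qed
  then show ?thesis
    by (rule finite_familiesI[OF translate_families[OF finite_familiesD(1)[OF f] k]])
      (intro finite_imageI finite_familiesD(2)[OF f])
qed

lemma finite_families_mult:
  assumes "f \<in> finite_families" "g \<in> finite_families"
  shows "(\<lambda>k\<in>Q. f k \<circ> g k) \<in> finite_families"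
proof -
  have "{k \<in> Q. (\<lambda>k\<in>Q. f k \<circ> g k) k \<noteq> id} \<subseteq> {k \<in> Q. f k \<noteq> id} \<union> {k \<in> Q. g k \<noteq> id}" by auto
  then show ?thesis
    by (rule finite_familiesI[OF mult_families[OF assms[THEN finite_familiesD(1)]]])
      (intro finite_UnI assms[THEN finite_familiesD(2)])
qed

lemma finite_families_finv:
  assumes f: "f \<in> finite_families"
  shows "(\<lambda>k\<in>Q. finv (f k)) \<in> finite_families" "finv (beta f) = beta (\<lambda>k\<in>Q. finv (f k))"
proof -
  let ?g = "\<lambda>k\<in>Q. finv (f k)"
  have fB: "f \<in> H0_families" using f by (simp add: finite_families_def)
  have gB: "?g \<in> H0_families" using H0_simps(4) H0_familiesD[OF fB] by (auto simp: H0_families_def)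
  have "{k \<in> Q. ?g k \<noteq> id} \<subseteq> {k \<in> Q. f k \<noteq> id}" by (auto simp: inv_id)
  then show "?g \<in> finite_families" by (rule finite_familiesI[OF gB _ finite_familiesD(2)[OF f]])
  have bij: "bij (f k)" if "k \<in> Q" for k using H0_simps(5) H0_familiesD[OF fB that] by simp
  have "(\<lambda>k\<in>Q. f k \<circ> ?g k) = (\<lambda>_\<in>Q. id)" "(\<lambda>k\<in>Q. ?g k \<circ> f k) = (\<lambda>_\<in>Q. id)"
    using bij by (auto simp: fun_eq_iff restrict_def bij_is_surj surj_f_inv_f bij_is_inj)
  then have "beta f \<circ> beta ?g = id" "beta ?g \<circ> beta f = id"
    using beta_mult[OF fB gB] beta_mult[OF gB fB] trivial_family(2) by simp_all
  then show "finv (beta f) = beta ?g" by (rule inv_unique_comp)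
qed

lemma subgroup_Phi_image: "subgroup (Phi ` (finite_families \<times> Q)) Homeo_circle"
proof
  have sub: "f \<in> H0_families" if "f \<in> finite_families" for f using that by (simp add: finite_families_def)
  show "Phi ` (finite_families \<times> Q) \<subseteq> carrier Homeo_circle" using Phi_Homeo sub by auto
  show "\<one>\<^bsub>Homeo_circle\<^esub> \<in> Phi ` (finite_families \<times> Q)"
    using trivial_family Q_simps(2) by (auto simp: Phi_def intro!: image_eqI[of _ _ "(\<lambda>_\<in>Q. id, id)"])
  fix x assume "x \<in> Phi ` (finite_families \<times> Q)"
  then obtain f k where fk: "f \<in> finite_families" "k \<in> Q" "x = beta f \<circ> k" by (auto simp: Phi_def)
  show "x \<otimes>\<^bsub>Homeo_circle\<^esub> y \<in> Phi ` (finite_families \<times> Q)" if y: "y \<in> Phi ` (finite_families \<times> Q)" for y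
  proof -
    obtain f' k' where fk': "f' \<in> finite_families" "k' \<in> Q" "y = beta f' \<circ> k'"
      using y by (auto simp: Phi_def)
    have "x \<circ> y = Phi ((f, k) \<otimes>\<^bsub>wreath (Homeo_sub H0) (Homeo_sub Q)\<^esub> (f', k'))"
      using Phi_mult[OF sub[OF fk(1)] fk(2) sub[OF fk'(1)] fk'(2)] fk(3) fk'(3) by (simp add: Phi_def)
    moreover have "(f, k) \<otimes>\<^bsub>wreath (Homeo_sub H0) (Homeo_sub Q)\<^esub> (f', k') \<in> finite_families \<times> Q"
      using finite_families_mult[OF fk(1) finite_families_translate[OF fk'(1) fk(2)]] Q_simps(3) fk(2) fk'(2)
      by (simp add: wreath_mult)
    ultimately show ?thesis by (metis Homeo_circle_simps(1) imageI)
  qed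
  show "inv\<^bsub>Homeo_circle\<^esub> x \<in> Phi ` (finite_families \<times> Q)"
  proof -
    let ?g = "\<lambda>k\<in>Q. finv (f k)"
    note g = finite_families_finv[OF fk(1)]
    have "x \<in> carrier Homeo_circle" using fk Phi_Homeo sub by (auto simp: Phi_def)
    then have "inv\<^bsub>Homeo_circle\<^esub> x = finv (beta f \<circ> k)" using fk(3) by (simp add: Homeo_circle_m_inv)
    also have "\<dots> = finv k \<circ> beta ?g"
      using o_inv_distrib[OF Homeo_circle_bij[OF beta_Homeo[OF sub[OF fk(1)]]] Q_simps(5)[OF fk(2)]] g(2) by simp
    \<comment> \<open>Inversion leaves the factor from \<open>Q\<close> on the left; commuting it to
      the right restores the form of a value of \<open>Phi\<close>.\<close>
    also have "\<dots> = beta (\<lambda>t\<in>Q. ?g (finv (finv k) \<circ> t)) \<circ> finv k"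
      by (rule kappa_beta[OF sub[OF g(1)] Q_simps(4)[OF fk(2)]])
    finally show ?thesis
      using finite_families_translate[OF g(1) Q_simps(4)[OF fk(2)]] Q_simps(4)[OF fk(2)]
      by (auto simp: Phi_def intro!: image_eqI[of _ _ "(\<lambda>t\<in>Q. ?g (finv (finv k) \<circ> t), finv k)"])
  qed
qed

text \<open>The factor at \<open>j\<close> is split off as the conjugate
  \<open>j \<circ> (f j \<circ> finv j)\<close>. The induction runs over a finite set containing the
  support, so an index with trivial factor does no harm.\<close>

lemma beta_finite_in_generate:
  assumes "finite S" "f \<in> H0_families" "{k \<in> Q. f k \<noteq> id} \<subseteq> S"
  shows "beta f \<in> generate Homeo_circle (H0 \<union> Q)"
  using assms
proof (induction S arbitrary: f rule: finite_induct)
  case empty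
  then have "f = (\<lambda>_\<in>Q. id)" by (auto simp: H0_families_def fun_eq_iff PiE_def extensional_def)
  then have "beta f = \<one>\<^bsub>Homeo_circle\<^esub>" using trivial_family(2) by (simp only: Homeo_circle_simps)
  then show ?case by (simp only: generate.one)
next
  case (insert j S)
  show ?case
  proof (cases "j \<in> Q")
    case False
    then show ?thesis using insert by blast
  next
    case True
    define f1 where "f1 = (\<lambda>k\<in>Q. if k = j then id else f k)"
    let ?f2 = "\<lambda>k\<in>Q. if k = j then f j else id"
    have fj: "f j \<in> H0" by (rule H0_familiesD[OF insert.prems(1) True])
    have f1: "f1 \<in> H0_families"
      using H0_simps(2) H0_familiesD[OF insert.prems(1)] by (auto simp: f1_def H0_families_def)
    have f2: "?f2 \<in> H0_families" using single_family(1)[OF fj True] by (simp add: finite_families_def)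
    have "beta f1 \<in> generate Homeo_circle (H0 \<union> Q)"
      using insert.prems(2) by (intro insert.IH f1) (auto simp: f1_def)
    moreover have "j \<circ> (f j \<circ> finv j) \<in> generate Homeo_circle (H0 \<union> Q)"
    proof -
      have "j \<in> generate Homeo_circle (H0 \<union> Q)" "f j \<in> generate Homeo_circle (H0 \<union> Q)"
        "finv j \<in> generate Homeo_circle (H0 \<union> Q)"
        using True fj Q_simps(4) by (auto intro: generate.incl)
      then show ?thesis using generate.eng[of _ Homeo_circle] by simp
    qed
    moreover have "f = (\<lambda>k\<in>Q. f1 k \<circ> ?f2 k)"
    proof
      fix k show "f k = (\<lambda>k\<in>Q. f1 k \<circ> ?f2 k) k"
        using insert.prems(1) by (cases "k \<in> Q") (auto simp: f1_def H0_families_def PiE_def extensional_def)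
    qed
    then have "beta f = beta f1 \<circ> (j \<circ> (f j \<circ> finv j))"
      using beta_mult[OF f1 f2] single_family(2)[OF fj True] by simp
    ultimately show ?thesis
      using generate.eng[of "beta f1" Homeo_circle] by (metis Homeo_circle_simps(1))
  qed
qed

lemma Phi_image_eq_generate: "Phi ` (finite_families \<times> Q) = generate Homeo_circle (H0 \<union> Q)"
proof
  show "Phi ` (finite_families \<times> Q) \<subseteq> generate Homeo_circle (H0 \<union> Q)"
  proof
    fix x assume "x \<in> Phi ` (finite_families \<times> Q)"
    then obtain f k where fk: "f \<in> finite_families" "k \<in> Q" "x = beta f \<circ> k" by (auto simp: Phi_def)
    have "beta f \<in> generate Homeo_circle (H0 \<union> Q)"
      using beta_finite_in_generate[of "{k \<in> Q. f k \<noteq> id}" f] fk(1) by (simp add: finite_families_def)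
    moreover have "k \<in> generate Homeo_circle (H0 \<union> Q)" using fk(2) by (auto intro: generate.incl)
    ultimately show "x \<in> generate Homeo_circle (H0 \<union> Q)"
      using generate.eng[of "beta f" Homeo_circle] fk(3) by simp
  qed
  have "h \<in> Phi ` (finite_families \<times> Q)" if h: "h \<in> H0" for h
  proof -
    \<comment> \<open>\<open>H0\<close> is the factor of index \<open>id\<close> in the base
      group.\<close>
    have "beta (\<lambda>k\<in>Q. if k = id then h else id) = h"
      using single_family(2)[OF h Q_simps(2)] by (simp add: inv_id)
    then show ?thesis using single_family(1)[OF h Q_simps(2)] Q_simps(2)
      by (auto simp: Phi_def intro!: image_eqI[of _ _ "(\<lambda>k\<in>Q. if k = id then h else id, id)"])
  qed
  moreover have "k \<in> Phi ` (finite_families \<times> Q)" if k: "k \<in> Q" for k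
    using k trivial_family by (auto simp: Phi_def intro!: image_eqI[of _ _ "(\<lambda>_\<in>Q. id, k)"])
  ultimately show "generate Homeo_circle (H0 \<union> Q) \<subseteq> Phi ` (finite_families \<times> Q)"
    by (intro group.generate_subgroup_incl[OF group_Homeo_circle _ subgroup_Phi_image]) blast
qed

lemma Phi_iso:
  "Phi \<in> iso (restricted_wreath (Homeo_sub H0) (Homeo_sub Q))
    (subgroup_generated Homeo_circle (H0 \<union> Q))"
proof -
  have "H0 \<union> Q \<subseteq> carrier Homeo_circle" using H0_simps(1) Q_simps(1) by blast
  then have carrier: "carrier (subgroup_generated Homeo_circle (H0 \<union> Q)) = Phi ` (finite_families \<times> Q)"
    by (simp add: carrier_subgroup_generated Phi_image_eq_generate Int_absorb1)
  have sub: "finite_families \<subseteq> H0_families" by (auto simp: finite_families_def)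
  have "inj_on Phi (finite_families \<times> Q)"
    using Phi_inj by (rule inj_on_subset) (use sub in auto)
  moreover have "Phi \<in> hom (restricted_wreath (Homeo_sub H0) (Homeo_sub Q)) (subgroup_generated Homeo_circle (H0 \<union> Q))"
    using Phi_mult[OF subsetD[OF sub] _ subsetD[OF sub]]
    by (auto simp: hom_def restricted_wreath_carrier restricted_wreath_mult carrier)
  ultimately show ?thesis
    by (simp add: iso_def bij_betw_def restricted_wreath_carrier carrier)
qed

text \<open>\<open>\<iota>\<close> chooses preimages under \<open>Phi\<close>. It is multiplicative
  because \<open>Phi\<close> is multiplicative and injective.\<close>

lemma embedding_G:
  obtains \<iota> where "\<iota> \<in> mon (Homeo_sub G) (wreath (Homeo_sub H0) (Homeo_sub Q))" "\<And>g. g \<in> G \<Longrightarrow> Phi (\<iota> g) = g"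
proof -
  have "\<exists>x\<in>H0_families \<times> Q. Phi x = g" if "g \<in> G" for g
    using G_decomposition[OF that] by (auto simp: Phi_def)
  then obtain \<iota> where \<iota>: "\<And>g. g \<in> G \<Longrightarrow> \<iota> g \<in> H0_families \<times> Q" "\<And>g. g \<in> G \<Longrightarrow> Phi (\<iota> g) = g"
    by metis
  have "\<iota> (g \<circ> h) = \<iota> g \<otimes>\<^bsub>wreath (Homeo_sub H0) (Homeo_sub Q)\<^esub> \<iota> h" if gh: "g \<in> G" "h \<in> G" for g h
  proof (rule inj_onD[OF Phi_inj])
    obtain f k f' k' where fk: "\<iota> g = (f, k)" "\<iota> h = (f', k')" by fastforce
    have m: "f \<in> H0_families" "k \<in> Q" "f' \<in> H0_families" "k' \<in> Q" using \<iota>(1) gh fk by (metis SigmaE2)+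
    show "Phi (\<iota> (g \<circ> h)) = Phi (\<iota> g \<otimes>\<^bsub>wreath (Homeo_sub H0) (Homeo_sub Q)\<^esub> \<iota> h)"
      unfolding fk Phi_mult[OF m] using \<iota>(2) gh fk G_simps(3)[OF gh] by metis
    show "\<iota> g \<otimes>\<^bsub>wreath (Homeo_sub H0) (Homeo_sub Q)\<^esub> \<iota> h \<in> H0_families \<times> Q"
      unfolding fk by (rule wreath_closed[OF m])
  qed (use \<iota>(1) G_simps(3)[OF gh] in simp)
  moreover have "inj_on \<iota> G" using \<iota>(2) by (rule inj_on_inverseI)
  ultimately have "\<iota> \<in> mon (Homeo_sub G) (wreath (Homeo_sub H0) (Homeo_sub Q))"
    using \<iota>(1) by (simp add: mon_def hom_def wreath_carrier)
  then show ?thesis using \<iota>(2) by (rule that)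
qed

lemma H0_interval_embedding:
  "\<exists>(N :: nat set) \<phi>. \<phi> \<in> mon (Homeo_sub H0) (product_group N (\<lambda>_. Homeo_interval))"
proof -
  obtain y where "y \<in> Y" by (rule Y_nonempty)
  then have fixed: "h (to_circle y) = to_circle y" if "h \<in> H0" for h
    using that by (auto simp: H0_def eta_def D_def Y_def)
  obtain \<phi> where "\<phi> \<in> mon (Homeo_sub H0) Homeo_interval"
    by (rule mon_Homeo_interval[of H0 "to_circle y"]) (use subgroup_H0 fixed in auto)
  then show ?thesis using Homeo_interval_mon_product by blast
qed

end

text \<open>Here \<open>Rot\<close> is a homomorphism to an abelian group. The quotient of
  \<open>a \<circ> b\<close> by \<open>b \<circ> a\<close> has rotation number 0, hence a fixed
  point, hence is the identity.\<close>

lemma comm_group_if_free_action: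
  assumes G: "subgroup G Homeo_circle" and free: "\<And>f. f \<in> G \<Longrightarrow> \<exists>q. f q = q \<Longrightarrow> f = id"
  shows "comm_group (Homeo_sub G)"
proof -
  note Gd = Homeo_subgroupD[OF G]
  have "a \<circ> b = b \<circ> a" if ab: "a \<in> G" "b \<in> G" for a b
  proof -
    \<comment> \<open>Any point, here \<open>undefined\<close>, is a common fixed point of the
      elements having fixed points, since the identity is the only one.\<close>
    have Rot: "Rot (f \<circ> g) = Rot f + Rot g" if "f \<in> G" "g \<in> G" for f g
      using Rot_comp[OF G, of undefined] free that by force
    let ?c = "finv (b \<circ> a)"
    have c: "?c \<in> G" using Gd(3,4) ab by blast
    have "bij (b \<circ> a)" using Gd(3,5) ab by blast
    then have cc: "?c \<circ> (b \<circ> a) = id" "(b \<circ> a) \<circ> ?c = id"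
      by (rule inv_o_cancel[OF bij_is_inj], rule surj_iff[THEN iffD1, OF bij_is_surj])
    have "Rot (?c \<circ> (a \<circ> b)) = Rot (?c \<circ> (b \<circ> a))"
      using Rot[OF c] Rot[OF ab] Rot[OF ab(2,1)] Gd(3) ab by (simp add: add.commute)
    also have "\<dots> = 0" unfolding cc by (rule Rot_fixed_point[of id undefined]) (use Gd in auto)
    finally obtain q where "(?c \<circ> (a \<circ> b)) q = q"
      using Rot_eq_0_imp_fixed_point Gd(1,3) c ab by metis
    then have "?c \<circ> (a \<circ> b) = id" using free Gd(3) c ab by blast
    then have "(b \<circ> a) \<circ> (?c \<circ> (a \<circ> b)) = b \<circ> a" by simp
    then show ?thesis unfolding comp_assoc[symmetric, of "b \<circ> a"] cc by simp
  qed
  then show ?thesis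
    using group.group_comm_groupI[OF group.subgroup_imp_group[OF group_Homeo_circle G]] by simp
qed

theorem theorem1p1:
  fixes G :: "(circle \<Rightarrow> circle) set"
  assumes "subgroup G Homeo_circle"
    and "no_nonabelian_free_subgroups (Homeo_sub G)"
  shows "comm_group (Homeo_sub G) \<or>
    (\<exists>H0 Q \<iota>.
      subgroup H0 Homeo_circle \<and> subgroup Q Homeo_circle \<and>
      \<iota> \<in> mon (Homeo_sub G) (wreath (Homeo_sub H0) (Homeo_sub Q)) \<and>
      (\<forall>h\<in>H0. Rot h = 0) \<and>
      (\<exists>(N :: nat set) \<phi>. \<phi> \<in> mon (Homeo_sub H0) (product_group N (\<lambda>_. Homeo_interval))) \<and>
      no_nonabelian_free_subgroups (Homeo_sub H0) \<and>
      Homeo_sub Q \<cong> Homeo_sub G Mod (ker_Rot \<inter> G) \<and>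
      (\<exists>R. subgroup R circle_group \<and> countable R \<and>
        Homeo_sub Q \<cong> circle_group\<lparr>carrier := R\<rparr>) \<and>
      (\<exists>\<psi> \<Phi>.
        \<psi> \<in> iso (restricted_wreath (Homeo_sub H0) (Homeo_sub Q))
                (subgroup_generated Homeo_circle (H0 \<union> Q)) \<and>
        \<Phi> \<in> mon (wreath (Homeo_sub H0) (Homeo_sub Q)) Homeo_circle \<and>
        (\<forall>x\<in>carrier (restricted_wreath (Homeo_sub H0) (Homeo_sub Q)). \<Phi> x = \<psi> x) \<and>
        G \<subseteq> \<Phi> ` carrier (wreath (Homeo_sub H0) (Homeo_sub Q)) \<and>
        (\<forall>g\<in>G. \<Phi> (\<iota> g) = g)))"
proof (cases "\<exists>f\<in>G. (\<exists>q. f q = q) \<and> f \<noteq> id")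
  case False
  then show ?thesis using comm_group_if_free_action[OF assms(1)] by blast
next
  case True
  obtain p where "\<And>f. f \<in> G \<Longrightarrow> \<exists>q. f q = q \<Longrightarrow> f p = p"
    using common_fixed_point[OF assms] by blast
  then interpret circle_group_kernel G
    by (intro circle_group_kernel.intro assms(1) True) blast
  obtain \<iota> where \<iota>: "\<iota> \<in> mon (Homeo_sub G) (wreath (Homeo_sub H0) (Homeo_sub Q))" "\<And>g. g \<in> G \<Longrightarrow> Phi (\<iota> g) = g"
    using embedding_G by blast
  have "\<forall>h\<in>H0. Rot h = 0" using Rot_eta by (auto simp: H0_def)
  moreover have "G \<subseteq> Phi ` carrier (wreath (Homeo_sub H0) (Homeo_sub Q))"
  proof
    fix g assume "g \<in> G"
    then have "\<iota> g \<in> carrier (wreath (Homeo_sub H0) (Homeo_sub Q))"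
      using \<iota>(1) by (auto simp: mon_def hom_def)
    then show "g \<in> Phi ` carrier (wreath (Homeo_sub H0) (Homeo_sub Q))"
      using \<iota>(2)[OF \<open>g \<in> G\<close>] by (metis imageI)
  qed
  \<comment> \<open>\<open>Phi\<close> is the witness both for the isomorphism onto the generated
    subgroup and for its extension; \<open>T\<close> is the countable subgroup of the
    circle.\<close>
  ultimately show ?thesis
    using subgroup_H0 subgroup_Q \<iota> H0_interval_embedding H0_no_free[OF assms(2)] Q_iso_quotient
      subgroup_T countable_T Q_iso_T Phi_iso Phi_mon by blast
qed

end
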